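(* (i) There is an absolute constant $C$ such that for every $m\ge 2$, every $n\in\mathbb N$ and every nonempty $\Lambda\subseteq\mathcal M_{m,n}$, $$\mu_\Lambda\{a\in\mathbb S_\Lambda: R_m(a)>1\}\le C\,\frac{\log m}{m^2}.$$ (ii) For every sequence of positive integers $(n_m)_{m\ge2}$ and every sequence of nonempty supports $(\Lambda_m)_{m\ge 2}$ with $\Lambda_m\subseteq\mathcal M_{m,n_m}$, with respect to the product probability measure $\boldsymbol\mu:=\bigotimes_{m\ge2}\mu_{\Lambda_m}$ on $\prod_{m\ge2}\mathbb S_{\Lambda_m}$, $$\boldsymbol\mu\bigl\{(a^{(m)})_{m\ge2}: R_m(a^{(m)})\le 1\ \text{for all sufficiently large } m\bigr\}=1.$$ (iii) The threshold $1$ is optimal: it cannot be replaced by any $t<1$ in (ii); that is, for every $t<1$ there is a sequence of nonempty supports $(\Lambda_m)_{m\ge2}$ for which the conclusion of (ii) fails with $R_m(a^{(m)})\le 1$ replaced by $R_m(a^{(m)})\le t$.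
   Context: For $m,n\in\mathbb N$ let $\mathcal M_{m,n}:=\{\alpha\in\mathbb N_0^n: |\alpha|=\alpha_1+\dots+\alpha_n=m\}$ and $q_m:=2m/(m+1)$. For nonempty $\Lambda\subseteq\mathcal M_{m,n}$ and $a=(a_\alpha)_{\alpha\in\Lambda}\in\mathbb C^\Lambda$ put $\|a\|_p:=(\sum_{\alpha\in\Lambda}|a_\alpha|^p)^{1/p}$, $P_a(z):=\sum_{\alpha\in\Lambda}a_\alpha z^\alpha$ for $z\in\mathbb C^n$, and $\|P_a\|_\infty:=\sup|P_a(z)|$ over the unit polydisc (equivalently over $\{z\in\mathbb C^n:|z_j|=1\ \forall j\}$). The Bohnenblust--Hille ratio is $R_m(a):=\|a\|_{q_m}/\|P_a\|_\infty$ for $a\neq0$ and $R_m(0):=0$. $\mathbb S_\Lambda:=\{a\in\mathbb C^\Lambda:\|a\|_2=1\}$ and $\mu_\Lambda$ is normalized (total mass one) Euclidean surface measure on $\mathbb S_\Lambda$, where $\mathbb C^\Lambda\simeq\mathbb R^{2|\Lambda|}$. *)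

theory Defs
  imports "HOL-Probability.Probability"
begin

definition multi_indices :: "nat \<Rightarrow> nat \<Rightarrow> (nat \<Rightarrow> nat) set" where
  "multi_indices m n = {\<alpha> \<in> {1..n} \<rightarrow>\<^sub>E UNIV. (\<Sum>j=1..n. \<alpha> j) = m}"

definition lp_norm :: "real \<Rightarrow> 'i set \<Rightarrow> ('i \<Rightarrow> complex) \<Rightarrow> real" where
  "lp_norm p I a = (\<Sum>i\<in>I. cmod (a i) powr p) powr (1 / p)"

definition poly_fun :: "nat \<Rightarrow> (nat \<Rightarrow> nat) set \<Rightarrow> ((nat \<Rightarrow> nat) \<Rightarrow> complex) \<Rightarrow> (nat \<Rightarrow> complex) \<Rightarrow> complex"
  where "poly_fun n \<Lambda> a z = (\<Sum>\<alpha>\<in>\<Lambda>. a \<alpha> * (\<Prod>j=1..n. z j ^ \<alpha> j))"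

text \<open>Only the coordinates \<open>z 1, \<dots>, z n\<close> of a point matter; the others are left unconstrained.\<close>

definition unit_polydisc :: "nat \<Rightarrow> (nat \<Rightarrow> complex) set" where
  "unit_polydisc n = {z. \<forall>j\<in>{1..n}. cmod (z j) < 1}"

definition poly_sup_norm :: "nat \<Rightarrow> (nat \<Rightarrow> nat) set \<Rightarrow> ((nat \<Rightarrow> nat) \<Rightarrow> complex) \<Rightarrow> real" where
  "poly_sup_norm n \<Lambda> a = (SUP z\<in>unit_polydisc n. cmod (poly_fun n \<Lambda> a z))"

definition bh_exponent :: "nat \<Rightarrow> real" where
  "bh_exponent m = 2 * real m / (real m + 1)"

definition bh_ratio :: "nat \<Rightarrow> nat \<Rightarrow> (nat \<Rightarrow> nat) set \<Rightarrow> ((nat \<Rightarrow> nat) \<Rightarrow> complex) \<Rightarrow> real" where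
  "bh_ratio m n \<Lambda> a =
     (if \<forall>\<alpha>\<in>\<Lambda>. a \<alpha> = 0 then 0 else lp_norm (bh_exponent m) \<Lambda> a / poly_sup_norm n \<Lambda> a)"

text \<open>
  \<open>\<complex>\<^sup>I\<close> is the set of extensional functions \<open>I \<rightarrow>\<^sub>E UNIV\<close>, carrying the product of the Lebesgue
  measures on \<open>\<complex>\<close>, i.e. Lebesgue measure on the real space of dimension \<open>2 * card I\<close>.
\<close>

definition coeff_lborel :: "'i set \<Rightarrow> ('i \<Rightarrow> complex) measure" where
  "coeff_lborel I = (\<Pi>\<^sub>M i\<in>I. lborel)"

definition coeff_sphere :: "'i set \<Rightarrow> ('i \<Rightarrow> complex) set" where
  "coeff_sphere I = {a \<in> I \<rightarrow>\<^sub>E UNIV. lp_norm 2 I a = 1}"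

definition coeff_punctured_ball :: "'i set \<Rightarrow> ('i \<Rightarrow> complex) set" where
  "coeff_punctured_ball I = {a \<in> I \<rightarrow>\<^sub>E UNIV. 0 < lp_norm 2 I a \<and> lp_norm 2 I a \<le> 1}"

definition radial_proj :: "'i set \<Rightarrow> ('i \<Rightarrow> complex) \<Rightarrow> 'i \<Rightarrow> complex" where
  "radial_proj I a = (\<lambda>i\<in>I. a i / of_real (lp_norm 2 I a))"

text \<open>
  Euclidean surface measure on the unit sphere, as given by polar coordinates: for real dimension
  \<open>d\<close>, integration of \<open>r ^ (d - 1)\<close> over \<open>0 < r \<le> 1\<close> shows that the surface measure of a Borel
  subset \<open>E\<close> of the sphere is \<open>d\<close> times the Lebesgue measure of the cone
  \<open>{r x | 0 < r \<le> 1, x \<in> E}\<close>, which is the preimage of \<open>E\<close> in the punctured ball under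
  \<open>x \<mapsto> x / \<parallel>x\<parallel>\<close>; see \<open>emeasure_surface_measure\<close> below.
\<close>

definition surface_measure :: "'i set \<Rightarrow> ('i \<Rightarrow> complex) measure" where
  "surface_measure I =
     scale_measure (of_nat (2 * card I))
       (distr (restrict_space (coeff_lborel I) (coeff_punctured_ball I))
              (restrict_space (coeff_lborel I) (coeff_sphere I))
              (radial_proj I))"

definition sphere_measure :: "'i set \<Rightarrow> ('i \<Rightarrow> complex) measure" where
  "sphere_measure I =
     scale_measure (1 / emeasure (surface_measure I) (space (surface_measure I))) (surface_measure I)"

lemma space_coeff_lborel: "space (coeff_lborel I) = I \<rightarrow>\<^sub>E UNIV"
  by (simp add: coeff_lborel_def space_PiM)

lemma measurable_coeff [measurable]: "i \<in> I \<Longrightarrow> (\<lambda>a. a i) \<in> borel_measurable (coeff_lborel I)"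
  unfolding coeff_lborel_def by measurable

lemma measurable_lp_norm [measurable]:
  "lp_norm p I \<in> borel_measurable (coeff_lborel I)"
proof -
  have "(\<lambda>a. (\<Sum>i\<in>I. cmod (a i) powr p) powr (1 / p)) \<in> borel_measurable (coeff_lborel I)"
    by measurable
  then show ?thesis
    by (simp add: lp_norm_def[abs_def])
qed

lemma sets_coeff_sphere: "coeff_sphere I \<in> sets (coeff_lborel I)"
proof -
  have "{a \<in> space (coeff_lborel I). lp_norm 2 I a = 1} \<in> sets (coeff_lborel I)"
    by measurable
  then show ?thesis by (simp add: coeff_sphere_def space_coeff_lborel)
qed

lemma sets_coeff_punctured_ball: "coeff_punctured_ball I \<in> sets (coeff_lborel I)"
proof -
  have "{a \<in> space (coeff_lborel I). 0 < lp_norm 2 I a \<and> lp_norm 2 I a \<le> 1} \<in> sets (coeff_lborel I)"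
    by measurable
  then show ?thesis by (simp add: coeff_punctured_ball_def space_coeff_lborel)
qed

lemma lp_norm_2: "lp_norm 2 I a = sqrt (\<Sum>i\<in>I. (cmod (a i))\<^sup>2)"
  by (simp add: lp_norm_def powr_half_sqrt sum_nonneg)

lemma lp_norm_2_scale:
  assumes "r \<ge> 0"
  shows "lp_norm 2 I (\<lambda>i\<in>I. of_real r * a i) = r * lp_norm 2 I a"
proof -
  have "(\<Sum>i\<in>I. (cmod ((\<lambda>i\<in>I. of_real r * a i) i))\<^sup>2) = r\<^sup>2 * (\<Sum>i\<in>I. (cmod (a i))\<^sup>2)"
    by (simp add: norm_mult power_mult_distrib sum_distrib_left)
  then show ?thesis
    using assms by (simp add: lp_norm_2 real_sqrt_mult)
qed

lemma radial_proj_in_sphere: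
  assumes "a \<in> coeff_punctured_ball I"
  shows "radial_proj I a \<in> coeff_sphere I"
proof -
  let ?r = "lp_norm 2 I a"
  have r: "?r > 0" using assms by (simp add: coeff_punctured_ball_def)
  have "radial_proj I a = (\<lambda>i\<in>I. of_real (1 / ?r) * a i)"
    by (auto simp: radial_proj_def fun_eq_iff field_simps)
  then have "lp_norm 2 I (radial_proj I a) = 1"
    using r lp_norm_2_scale[of "1 / ?r" I a] by simp
  then show ?thesis by (simp add: coeff_sphere_def radial_proj_def)
qed

lemma measurable_radial_proj [measurable]:
  "radial_proj I \<in> restrict_space (coeff_lborel I) (coeff_punctured_ball I)
     \<rightarrow>\<^sub>M restrict_space (coeff_lborel I) (coeff_sphere I)"
proof (rule measurable_restrict_space2)
  show "radial_proj I \<in> space (restrict_space (coeff_lborel I) (coeff_punctured_ball I)) \<rightarrow> coeff_sphere I"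
    by (auto simp: space_restrict_space radial_proj_in_sphere)
  have "(\<lambda>a. \<lambda>i\<in>I. a i / of_real (lp_norm 2 I a)) \<in> coeff_lborel I \<rightarrow>\<^sub>M (\<Pi>\<^sub>M i\<in>I. lborel)"
    by measurable
  then have "radial_proj I \<in> coeff_lborel I \<rightarrow>\<^sub>M coeff_lborel I"
    by (simp add: radial_proj_def[abs_def] coeff_lborel_def[symmetric])
  then show "radial_proj I \<in> restrict_space (coeff_lborel I) (coeff_punctured_ball I) \<rightarrow>\<^sub>M coeff_lborel I"
    by (rule measurable_restrict_space1)
qed

lemma space_surface_measure: "space (surface_measure I) = coeff_sphere I"
  using sets_coeff_sphere[of I, THEN sets.sets_into_space]
  by (auto simp: surface_measure_def space_scale_measure space_restrict_space)

lemma sets_surface_measure [measurable_cong]: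
  "sets (surface_measure I) = sets (restrict_space (coeff_lborel I) (coeff_sphere I))"
  by (simp add: surface_measure_def)

lemma radial_proj_vimage_eq_cone:
  assumes "E \<subseteq> coeff_sphere I"
  shows "{a \<in> coeff_punctured_ball I. radial_proj I a \<in> E} =
    {\<lambda>i\<in>I. of_real r * x i | r x. 0 < r \<and> r \<le> 1 \<and> x \<in> E}"
proof (intro set_eqI iffI)
  fix a assume a: "a \<in> {a \<in> coeff_punctured_ball I. radial_proj I a \<in> E}"
  let ?r = "lp_norm 2 I a"
  have r: "0 < ?r" "?r \<le> 1" "a \<in> extensional I"
    using a by (auto simp: coeff_punctured_ball_def PiE_def)
  have "a = (\<lambda>i\<in>I. of_real ?r * radial_proj I a i)"
    using r by (auto simp: radial_proj_def fun_eq_iff extensional_def)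
  then show "a \<in> {\<lambda>i\<in>I. of_real r * x i | r x. 0 < r \<and> r \<le> 1 \<and> x \<in> E}"
    using r a by blast
next
  fix a assume "a \<in> {\<lambda>i\<in>I. of_real r * x i | r x. 0 < r \<and> r \<le> 1 \<and> x \<in> E}"
  then obtain r x where rx: "a = (\<lambda>i\<in>I. of_real r * x i)" "0 < r" "r \<le> 1" "x \<in> E" by blast
  have x: "lp_norm 2 I x = 1" "x \<in> extensional I"
    using rx assms by (auto simp: coeff_sphere_def PiE_def)
  have n: "lp_norm 2 I a = r" using lp_norm_2_scale[of r I x] rx x by simp
  have "radial_proj I a = x"
    unfolding radial_proj_def n using rx x by (auto simp: fun_eq_iff extensional_def)
  then show "a \<in> {a \<in> coeff_punctured_ball I. radial_proj I a \<in> E}"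
    using n rx by (auto simp: coeff_punctured_ball_def)
qed

lemma emeasure_surface_measure:
  assumes "E \<in> sets (surface_measure I)"
  shows "emeasure (surface_measure I) E = of_nat (2 * card I) *
    emeasure (coeff_lborel I) {\<lambda>i\<in>I. of_real r * x i | r x. 0 < r \<and> r \<le> 1 \<and> x \<in> E}"
proof -
  let ?B = "restrict_space (coeff_lborel I) (coeff_punctured_ball I)"
  have E: "E \<in> sets (restrict_space (coeff_lborel I) (coeff_sphere I))"
    using assms by (simp add: sets_surface_measure)
  have ES: "E \<subseteq> coeff_sphere I"
    using sets.sets_into_space[OF assms] by (simp add: space_surface_measure)
  have sp: "space ?B = coeff_punctured_ball I"
    using sets_coeff_punctured_ball[of I, THEN sets.sets_into_space] by (auto simp: space_restrict_space)
  have "emeasure (distr ?B (restrict_space (coeff_lborel I) (coeff_sphere I)) (radial_proj I)) E =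
      emeasure ?B (radial_proj I -` E \<inter> space ?B)"
    by (rule emeasure_distr[OF measurable_radial_proj E])
  also have "\<dots> = emeasure (coeff_lborel I) (radial_proj I -` E \<inter> space ?B)"
    by (rule emeasure_restrict_space)
      (use sets_coeff_punctured_ball[of I] sp in \<open>auto intro: sets.Int\<close>)
  also have "radial_proj I -` E \<inter> space ?B = {\<lambda>i\<in>I. of_real r * x i | r x. 0 < r \<and> r \<le> 1 \<and> x \<in> E}"
    unfolding radial_proj_vimage_eq_cone[OF ES, symmetric] sp by auto
  finally show ?thesis
    by (simp add: surface_measure_def)
qed

lemma emeasure_punctured_ball_finite:
  assumes "finite I"
  shows "emeasure (coeff_lborel I) (coeff_punctured_ball I) < \<infinity>"
proof -
  interpret product_sigma_finite "\<lambda>_::'a. lborel :: complex measure" by unfold_locales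
  have "coeff_punctured_ball I \<subseteq> (\<Pi>\<^sub>E i\<in>I. cball 0 1)"
  proof
    fix a assume a: "a \<in> coeff_punctured_ball I"
    have "cmod (a i) \<le> 1" if "i \<in> I" for i
    proof -
      have "(cmod (a i))\<^sup>2 \<le> (\<Sum>i\<in>I. (cmod (a i))\<^sup>2)"
        using assms that by (intro member_le_sum) auto
      also have "\<dots> \<le> 1"
        using a by (simp add: coeff_punctured_ball_def lp_norm_2)
      finally show ?thesis by (simp add: power2_le_iff_abs_le abs_square_le_1)
    qed
    then show "a \<in> (\<Pi>\<^sub>E i\<in>I. cball 0 1)"
      using a by (auto simp: coeff_punctured_ball_def PiE_def)
  qed
  then have "emeasure (coeff_lborel I) (coeff_punctured_ball I)
      \<le> emeasure (coeff_lborel I) (\<Pi>\<^sub>E i\<in>I. cball 0 1)"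
    unfolding coeff_lborel_def using assms by (intro emeasure_mono sets_PiM_I_finite) auto
  also have "\<dots> = (\<Prod>i\<in>I. emeasure lborel (cball 0 1 :: complex set))"
    unfolding coeff_lborel_def using assms by (intro emeasure_PiM) auto
  also have "\<dots> < \<infinity>"
    using emeasure_lborel_cball_finite[of "0::complex" 1]
    by (simp add: power_less_top_ennreal)
  finally show ?thesis .
qed

lemma emeasure_punctured_ball_pos:
  assumes "finite I" "I \<noteq> {}"
  shows "emeasure (coeff_lborel I) (coeff_punctured_ball I) > 0"
proof -
  interpret product_sigma_finite "\<lambda>_::'a. lborel :: complex measure" by unfold_locales
  define k where "k = real (card I)"
  have k: "k \<ge> 1" using assms by (simp add: k_def Suc_le_eq card_gt_0_iff)
  define c where "c = 1 / (2 * k)"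
  have c: "c > 0" using k by (simp add: c_def)
  let ?A = "ball (of_real c) c :: complex set"
  have A: "0 < cmod w \<and> cmod w \<le> 1 / k" if "w \<in> ?A" for w
  proof -
    have d: "cmod (of_real c - w) < c" using that by (simp add: dist_norm)
    have "cmod w \<le> cmod (of_real c) + cmod (of_real c - w)"
      by (metis norm_minus_commute norm_triangle_sub)
    also have "\<dots> \<le> c + c" using d c by simp
    also have "\<dots> = 1 / k" using k by (simp add: c_def)
    finally show ?thesis using d c by auto
  qed
  have "(\<Pi>\<^sub>E i\<in>I. ?A) \<subseteq> coeff_punctured_ball I"
  proof
    fix a assume a: "a \<in> (\<Pi>\<^sub>E i\<in>I. ?A)"
    have a': "0 < cmod (a i)" "cmod (a i) \<le> 1 / k" if "i \<in> I" for i
      using A[of "a i"] PiE_mem[OF a that] by auto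
    have "(\<Sum>i\<in>I. (cmod (a i))\<^sup>2) \<le> (\<Sum>i\<in>I. (1 / k)\<^sup>2)"
      by (intro sum_mono power_mono a') auto
    also have "\<dots> = 1 / k" using k by (simp add: k_def[symmetric] power2_eq_square)
    also have "\<dots> \<le> 1" using k by simp
    finally have "lp_norm 2 I a \<le> 1" by (simp add: lp_norm_2)
    moreover have "(\<Sum>i\<in>I. (cmod (a i))\<^sup>2) > 0"
      using assms a'(1) by (intro sum_pos zero_less_power) auto
    ultimately show "a \<in> coeff_punctured_ball I"
      using a by (auto simp: coeff_punctured_ball_def lp_norm_2 PiE_def)
  qed
  then have "emeasure (coeff_lborel I) (\<Pi>\<^sub>E i\<in>I. ?A)
      \<le> emeasure (coeff_lborel I) (coeff_punctured_ball I)"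
    by (intro emeasure_mono sets_coeff_punctured_ball)
  moreover have "emeasure (coeff_lborel I) (\<Pi>\<^sub>E i\<in>I. ?A) = (\<Prod>i\<in>I. emeasure lborel ?A)"
    unfolding coeff_lborel_def using assms by (intro emeasure_PiM) auto
  moreover have "emeasure lborel ?A > 0"
    using content_ball_pos[OF c, of "of_real c :: complex"]
    by (metis measure_eq_emeasure_eq_ennreal emeasure_lborel_ball_finite emeasure_eq_ennreal_measure
        less_irrefl ennreal_zero_less_top ennreal_less_zero_iff infinity_ennreal_def)
  ultimately show ?thesis
    by (simp add: zero_less_iff_neq_zero) (metis le_zero_eq power_eq_0_iff)
qed

lemma emeasure_surface_measure_space:
  "emeasure (surface_measure I) (space (surface_measure I)) =
     of_nat (2 * card I) * emeasure (coeff_lborel I) (coeff_punctured_ball I)"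
proof -
  have "{\<lambda>i\<in>I. of_real r * x i | r x. 0 < r \<and> r \<le> 1 \<and> x \<in> coeff_sphere I} = coeff_punctured_ball I"
    unfolding radial_proj_vimage_eq_cone[OF order_refl, symmetric] using radial_proj_in_sphere by blast
  then show ?thesis
    using emeasure_surface_measure[of "space (surface_measure I)" I]
    by (simp add: space_surface_measure[symmetric])
qed

lemma prob_space_sphere_measure:
  assumes "finite I" "I \<noteq> {}"
  shows "prob_space (sphere_measure I)"
proof
  let ?s = "emeasure (surface_measure I) (space (surface_measure I))"
  have "?s \<noteq> 0"
    using emeasure_punctured_ball_pos[OF assms] assms
    by (simp add: emeasure_surface_measure_space)
  moreover have "?s \<noteq> \<infinity>"
    using emeasure_punctured_ball_finite[OF assms(1)]
    by (simp add: emeasure_surface_measure_space ennreal_mult_eq_top_iff)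
  ultimately show "emeasure (sphere_measure I) (space (sphere_measure I)) = 1"
    by (simp add: sphere_measure_def space_scale_measure ennreal_divide_times ennreal_divide_self less_top)
qed

lemma space_sphere_measure: "space (sphere_measure I) = coeff_sphere I"
  by (simp add: sphere_measure_def space_scale_measure space_surface_measure)

lemma sets_sphere_measure [measurable_cong]:
  "sets (sphere_measure I) = sets (restrict_space (coeff_lborel I) (coeff_sphere I))"
  by (simp add: sphere_measure_def sets_surface_measure)

lemma finite_multi_indices: "finite (multi_indices m n)"
proof (rule finite_subset)
  show "multi_indices m n \<subseteq> {1..n} \<rightarrow>\<^sub>E {..m}"
  proof
    fix \<alpha> assume \<alpha>: "\<alpha> \<in> multi_indices m n"
    have "\<alpha> j \<le> m" if "j \<in> {1..n}" for j
      using \<alpha> member_le_sum[OF that, of \<alpha>] by (auto simp: multi_indices_def)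
    then show "\<alpha> \<in> {1..n} \<rightarrow>\<^sub>E {..m}"
      using \<alpha> by (auto simp: multi_indices_def PiE_def)
  qed
qed (auto intro: finite_PiE)

lemma poly_fun_bound:
  assumes "z \<in> unit_polydisc n"
  shows "cmod (poly_fun n \<Lambda> a z) \<le> (\<Sum>\<alpha>\<in>\<Lambda>. cmod (a \<alpha>))"
  unfolding poly_fun_def
proof (rule sum_norm_le)
  fix \<alpha>
  have "cmod (z j ^ \<alpha> j) \<le> 1" if "j \<in> {1..n}" for j
    using assms that by (simp add: norm_power unit_polydisc_def power_le_one less_imp_le)
  then have "cmod (\<Prod>j=1..n. z j ^ \<alpha> j) \<le> 1"
    unfolding prod_norm[symmetric] by (intro prod_le_1) auto
  then show "cmod (a \<alpha> * (\<Prod>j=1..n. z j ^ \<alpha> j)) \<le> cmod (a \<alpha>)"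
    by (simp add: norm_mult mult_left_le)
qed

lemma open_unit_polydisc: "open (unit_polydisc n)"
proof -
  have "open (\<Inter>j\<in>{1..n}. {z::nat \<Rightarrow> complex. cmod (z j) < 1})"
    by (intro open_INT ballI open_Collect_less continuous_on_norm continuous_on_const
        continuous_on_product_coordinates) auto
  moreover have "unit_polydisc n = (\<Inter>j\<in>{1..n}. {z. cmod (z j) < 1})"
    by (auto simp: unit_polydisc_def)
  ultimately show ?thesis by simp
qed

lemma measurable_bh_ratio:
  assumes "finite \<Lambda>"
  shows "bh_ratio m n \<Lambda> \<in> borel_measurable (sphere_measure \<Lambda>)"
proof -
  obtain D :: "(nat \<Rightarrow> complex) set"
    where D: "countable D" "\<And>X. open X \<Longrightarrow> X \<noteq> {} \<Longrightarrow> \<exists>d\<in>D. d \<in> X"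
    using countable_dense_exists by blast
  let ?D = "D \<inter> unit_polydisc n"
  have zero: "(\<lambda>_. 0) \<in> unit_polydisc n" by (simp add: unit_polydisc_def)
  have ne: "?D \<noteq> {}" using D(2)[OF open_unit_polydisc[of n]] zero by blast
  have bdd: "bdd_above ((\<lambda>z. cmod (poly_fun n \<Lambda> a z)) ` X)" if "X \<subseteq> unit_polydisc n" for a X
    using that poly_fun_bound[of _ n \<Lambda> a] by (intro bdd_aboveI2) auto
  have eq: "poly_sup_norm n \<Lambda> a = (SUP z\<in>?D. cmod (poly_fun n \<Lambda> a z))" for a
    unfolding poly_sup_norm_def
  proof (rule antisym)
    show "(SUP z\<in>?D. cmod (poly_fun n \<Lambda> a z)) \<le> (SUP z\<in>unit_polydisc n. cmod (poly_fun n \<Lambda> a z))"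
      by (rule cSUP_subset_mono) (use ne bdd in auto)
    show "(SUP z\<in>unit_polydisc n. cmod (poly_fun n \<Lambda> a z)) \<le> (SUP z\<in>?D. cmod (poly_fun n \<Lambda> a z))"
    proof (rule cSUP_least)
      fix z assume z: "z \<in> unit_polydisc n"
      show "cmod (poly_fun n \<Lambda> a z) \<le> (SUP z\<in>?D. cmod (poly_fun n \<Lambda> a z))" (is "_ \<le> ?s")
      proof (rule ccontr)
        assume less: "\<not> cmod (poly_fun n \<Lambda> a z) \<le> ?s"
        have "open {w. ?s < cmod (poly_fun n \<Lambda> a w)}"
          unfolding poly_fun_def by (intro open_Collect_less continuous_intros) auto
        then have "open ({w. ?s < cmod (poly_fun n \<Lambda> a w)} \<inter> unit_polydisc n)"
          by (intro open_Int open_unit_polydisc)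
        then obtain d where d: "d \<in> ?D" "?s < cmod (poly_fun n \<Lambda> a d)"
          using D(2)[of "{w. ?s < cmod (poly_fun n \<Lambda> a w)} \<inter> unit_polydisc n"] less z by force
        show False using cSUP_upper[OF d(1) bdd[of ?D a]] d(2) by auto
      qed
    qed (use zero in auto)
  qed
  have "(\<lambda>a. SUP z\<in>?D. cmod (poly_fun n \<Lambda> a z)) \<in> borel_measurable (coeff_lborel \<Lambda>)"
  proof (rule borel_measurable_cSUP)
    show "(\<lambda>a. cmod (poly_fun n \<Lambda> a z)) \<in> borel_measurable (coeff_lborel \<Lambda>)" for z
      unfolding poly_fun_def by measurable
  qed (use D bdd in auto)
  then have [measurable]: "poly_sup_norm n \<Lambda> \<in> borel_measurable (coeff_lborel \<Lambda>)"
    by (simp add: eq[abs_def])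
  have [measurable]: "Measurable.pred (coeff_lborel \<Lambda>) (\<lambda>a. \<forall>\<alpha>\<in>\<Lambda>. a \<alpha> = 0)"
    using assms by measurable
  have "bh_ratio m n \<Lambda> \<in> borel_measurable (coeff_lborel \<Lambda>)"
    unfolding bh_ratio_def[abs_def] by measurable
  then have "bh_ratio m n \<Lambda> \<in> borel_measurable (restrict_space (coeff_lborel \<Lambda>) (coeff_sphere \<Lambda>))"
    by (rule measurable_restrict_space1)
  then show ?thesis
    using measurable_cong_sets[OF sets_sphere_measure refl] by blast
qed

lemma sets_eventually_bh_ratio_le:
  fixes t :: real
  assumes "\<And>m. m \<ge> 2 \<Longrightarrow> finite (\<Lambda> m)"
  shows "{a \<in> \<Pi>\<^sub>E m\<in>{2..}. coeff_sphere (\<Lambda> m).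
      \<forall>\<^sub>F m in sequentially. bh_ratio m (n m) (\<Lambda> m) (a m) \<le> t}
    \<in> sets (\<Pi>\<^sub>M m\<in>{2..}. sphere_measure (\<Lambda> m))"
proof -
  let ?M = "\<Pi>\<^sub>M m\<in>{2..}. sphere_measure (\<Lambda> m)"
  have meas: "(\<lambda>a. bh_ratio m (n m) (\<Lambda> m) (a m)) \<in> borel_measurable ?M" if "m \<ge> 2" for m
    by (rule measurable_compose[where f = "\<lambda>a. a m", OF measurable_component_singleton measurable_bh_ratio])
      (use assms that in auto)
  have "{a \<in> space ?M. bh_ratio m (n m) (\<Lambda> m) (a m) \<le> t} \<in> sets ?M" if "m \<ge> 2" for m
    using borel_measurable_le[OF meas[OF that] borel_measurable_const[of t]] by simp
  then have "(\<Union>N\<in>{2..}. \<Inter>m\<in>{N..}. {a \<in> space ?M. bh_ratio m (n m) (\<Lambda> m) (a m) \<le> t}) \<in> sets ?M"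
    by (intro sets.countable_UN' sets.countable_INT') auto
  also have "(\<Union>N\<in>{2..}. \<Inter>m\<in>{N..}. {a \<in> space ?M. bh_ratio m (n m) (\<Lambda> m) (a m) \<le> t}) =
      {a \<in> space ?M. \<forall>\<^sub>F m in sequentially. bh_ratio m (n m) (\<Lambda> m) (a m) \<le> t}"
    (is "?L = ?R")
  proof (intro set_eqI iffI)
    fix a assume "a \<in> ?R"
    then obtain N where "\<forall>m\<ge>N. bh_ratio m (n m) (\<Lambda> m) (a m) \<le> t" "a \<in> space ?M"
      by (auto simp: eventually_sequentially)
    then show "a \<in> ?L" by (intro UN_I[of "max 2 N"]) auto
  qed (auto simp: eventually_sequentially)
  finally show ?thesis by (simp add: space_PiM space_sphere_measure)
qed

end

theory Submission
  imports Defs "HOL-Real_Asymp.Real_Asymp"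
begin

text \<open>
  The event \<open>R\<^sub>m > 1\<close> is a cone, so the uniform distribution on the sphere may be replaced by that of
  \<open>N = |\<Lambda>|\<close> independent standard complex Gaussian coefficients \<open>g\<close>. Substituting
  \<open>z\<^sub>j = \<zeta> ^ (B ^ j)\<close> and using power means, the event forces the trigonometric polynomial
  \<open>p(\<zeta>) = \<Sum> g\<^sub>\<alpha> \<zeta>\<^sup>l\<^sup>(\<^sup>\<alpha>\<^sup>)\<close> to satisfy \<open>|p|\<^sup>2 \<le> h S\<close> on the unit circle, where \<open>S = \<Sum> |g\<^sub>\<alpha>|\<^sup>2\<close> is the
  mean of \<open>|p|\<^sup>2\<close> and \<open>h = N powr (1 / m)\<close>. Averages over the circle are taken over roots of unity.

  If \<open>h = 1 + e\<close> with \<open>e\<close> small, the nonnegative function \<open>h S - |p|\<^sup>2\<close> has mean \<open>e S\<close>, so the product of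
  the two extreme coefficients is at most \<open>e S\<close>; this has probability of order \<open>e\<^sup>2 ln (1 / e) / N\<close>, the
  factor \<open>1 / N\<close> coming from the fourth moment of \<open>p\<close>, which is too large for a flat polynomial unless the
  random signs of the coefficients conspire. As \<open>e\<close> has the order of \<open>ln N / m\<close>, the bound
  \<open>ln m / m\<^sup>2\<close> follows. If \<open>h\<close> is bounded away from \<open>1\<close>, then \<open>N\<close> is exponentially large in \<open>m\<close>, and the
  second moment method for the circle average of \<open>exp (u Re p)\<close> yields an exponentially small bound.
  The almost sure statement follows from the Borel--Cantelli lemma, and for a single monomial the ratio
  is always \<open>1\<close>.
\<close>

text \<open>For few monomials the obstacle is size. Given all other coefficients, the two extreme
  ones have a product of at most \<open>e * S\<close> with probability of order
  \<open>e\<^sup>2 * S\<^sup>2 * ln (1 / e)\<close>, where typically \<open>S\<close> is about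
  \<open>N\<close>. A bound uniform in \<open>N\<close> needs decay instead, to absorb the factor
  (ln N)^2 hidden in e^2. The loss of N^2 is repaid by a second constraint that does not involve the
  extreme pair: the remaining polynomial must be nearly flat too, although random signs make its
  fourth moment about twice that of a flat one. Hypercontractivity, applied to the eighth moment of
  the deviation, gives this a probability of order N^(-4), which beats N^2. For many monomials the
  obstacle is that \<open>h\<close> is unbounded, since \<open>n\<close> is arbitrary. The moment of
  order 2k of the correlation is at most (k^m / N)^k = (k / h)^(m k), which helps only while
  \<open>k\<close> is below \<open>h\<close>. Hence the exponential series is cut at
  \<open>k0\<close>, about \<open>h / 2\<close>, and its tail, of size at most exp (36 h) 2^(-m k0),
  is small once \<open>m\<close> is large.\<close>

declare measurable_coeff [measurable del]

section \<open>Complex Gaussian vectors\<close>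

definition cgauss :: "complex measure" where
  "cgauss = density lborel (\<lambda>z. ennreal (exp (- (cmod z)\<^sup>2) / pi))"

lemma sets_cgauss [simp, measurable_cong]: "sets cgauss = sets borel"
  by (simp add: cgauss_def)

lemma space_cgauss [simp]: "space cgauss = UNIV"
  by (simp add: cgauss_def)

text \<open>The disc of squared radius \<open>a\<close> has area \<open>pi * a\<close>, so both
  measures agree on half-lines, which generate the Borel sets. This is the radial half of polar
  coordinates in the plane.\<close>

lemma distr_norm_square_lborel:
  "distr lborel borel (\<lambda>z::complex. (cmod z)\<^sup>2) = density lborel (\<lambda>t. ennreal pi * indicator {0..} t)"
  (is "?M = ?N")
proof (rule measure_eqI_generator_eq[where E = "range (\<lambda>a::real. {..a})" and \<Omega> = UNIV
      and A = "\<lambda>i::nat. {..real i}"])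
  show "Int_stable (range (\<lambda>a::real. {..a}))"
    by (auto simp: Int_stable_def)
  have M: "emeasure ?M {..a} = ennreal (if a < 0 then 0 else pi * a)" for a :: real
  proof -
    have "emeasure ?M {..a} = emeasure lborel {z::complex. (cmod z)\<^sup>2 \<le> a}"
      by (subst emeasure_distr) (auto simp: vimage_def)
    also have "\<dots> = ennreal (if a < 0 then 0 else pi * a)"
    proof (cases "a < 0")
      case True
      have "\<not> (cmod z)\<^sup>2 \<le> a" for z
        using True zero_le_power2[of "cmod z"] by linarith
      then have "{z::complex. (cmod z)\<^sup>2 \<le> a} = {}" by simp
      then show ?thesis using True by simp
    next
      case False
      have iff: "(cmod z)\<^sup>2 \<le> a \<longleftrightarrow> cmod z \<le> sqrt a" for z
        using real_sqrt_le_iff[of "(cmod z)\<^sup>2" a] by simp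
      have "{z::complex. (cmod z)\<^sup>2 \<le> a} = cball 0 (sqrt a)"
        by (intro set_eqI) (metis iff mem_Collect_eq mem_cball_0)
      then show ?thesis using False emeasure_cball[of "sqrt a" "0::complex"]
        by (simp add: unit_ball_vol_2)
    qed
    finally show ?thesis .
  qed
  have N: "emeasure ?N {..a} = ennreal (if a < 0 then 0 else pi * a)" for a :: real
  proof -
    have "emeasure ?N {..a} = (\<integral>\<^sup>+t. ennreal pi * indicator ({0..} \<inter> {..a}) t \<partial>lborel)"
      by (subst emeasure_density) (auto intro!: nn_integral_cong simp: indicator_def)
    also have "{0..} \<inter> {..a} = {0..a}" by auto
    also have "(\<integral>\<^sup>+t. ennreal pi * indicator {0..a} t \<partial>lborel) = ennreal pi * emeasure lborel {0..a}"
      by (subst nn_integral_cmult_indicator) auto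
    finally show ?thesis
      by (cases "a < 0") (auto simp: ennreal_mult')
  qed
  show "emeasure ?M X = emeasure ?N X" if "X \<in> range (\<lambda>a::real. {..a})" for X
    using that M N by auto
  show "sets ?M = sigma_sets UNIV (range (\<lambda>a::real. {..a}))"
    "sets ?N = sigma_sets UNIV (range (\<lambda>a::real. {..a}))"
    by (simp_all add: borel_eq_atMost)
  show "(\<Union>i::nat. {..real i}) = UNIV"
    using real_arch_simple by auto
  show "emeasure ?M {..real i} \<noteq> \<infinity>" for i :: nat
    using M[of "real i"] by simp
qed auto

text \<open>Under \<open>cgauss\<close> the squared modulus is exponentially distributed with mean
  1: the \<open>pi\<close> of the area cancels the one in the density.\<close>

lemma nn_integral_cgauss_radial:
  assumes [measurable]: "f \<in> borel_measurable borel"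
  shows "(\<integral>\<^sup>+z. f ((cmod z)\<^sup>2) \<partial>cgauss) = (\<integral>\<^sup>+t. ennreal (exp (- t)) * f t * indicator {0..} t \<partial>lborel)"
proof -
  have "(\<integral>\<^sup>+z. f ((cmod z)\<^sup>2) \<partial>cgauss) =
      (\<integral>\<^sup>+z. ennreal (exp (- (cmod z)\<^sup>2) / pi) * f ((cmod z)\<^sup>2) \<partial>lborel)"
    unfolding cgauss_def by (subst nn_integral_density) auto
  also have "\<dots> = (\<integral>\<^sup>+t. ennreal (exp (- t) / pi) * f t \<partial>(distr lborel borel (\<lambda>z::complex. (cmod z)\<^sup>2)))"
    by (subst nn_integral_distr) auto
  also have "\<dots> = (\<integral>\<^sup>+t. (ennreal pi * indicator {0..} t) * (ennreal (exp (- t) / pi) * f t) \<partial>lborel)"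
    unfolding distr_norm_square_lborel by (subst nn_integral_density) auto
  also have "\<dots> = (\<integral>\<^sup>+t. ennreal (exp (- t)) * f t * indicator {0..} t \<partial>lborel)"
    by (intro nn_integral_cong)
      (auto simp: indicator_def ennreal_mult'[symmetric] mult.assoc[symmetric])
  finally show ?thesis .
qed

lemma nn_integral_cgauss_moment:
  "(\<integral>\<^sup>+z. ennreal ((cmod z) ^ (2 * k)) \<partial>cgauss) = ennreal (fact k)"
proof -
  have "(\<integral>\<^sup>+z. ennreal ((cmod z) ^ (2 * k)) \<partial>cgauss) = (\<integral>\<^sup>+z. ennreal (((cmod z)\<^sup>2) ^ k) \<partial>cgauss)"
    by (simp add: power_mult)
  also have "\<dots> = (\<integral>\<^sup>+t. ennreal (t ^ k * exp (- t)) * indicator {0..} t \<partial>lborel)"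
    by (subst nn_integral_cgauss_radial)
      (auto intro!: nn_integral_cong simp: indicator_def ennreal_mult'[symmetric] mult.commute)
  also have "\<dots> = ennreal (fact k)"
    by (subst nn_intergal_power_times_exp_Ici) simp
  finally show ?thesis .
qed

lemma prob_space_cgauss: "prob_space cgauss"
  using nn_integral_cgauss_moment[of 0] by (intro prob_spaceI) simp

interpretation cgauss: prob_space cgauss
  by (rule prob_space_cgauss)

text \<open>Completing the square: translation by \<open>cnj w / 2\<close> turns the total exponent
  into a constant minus the standard Gaussian exponent.\<close>

lemma nn_integral_cgauss_exp_Re:
  "(\<integral>\<^sup>+z. ennreal (exp (Re (w * z))) \<partial>cgauss) = ennreal (exp ((cmod w)\<^sup>2 / 4))"
proof -
  have eq: "Re (w * (cnj w / 2 + z)) - (cmod (cnj w / 2 + z))\<^sup>2 = (cmod w)\<^sup>2 / 4 - (cmod z)\<^sup>2" for z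
    unfolding cmod_power2 by (simp add: power2_eq_square field_simps)
  have "(\<integral>\<^sup>+z. ennreal (exp (Re (w * z))) \<partial>cgauss) =
      (\<integral>\<^sup>+z. ennreal (exp (- (cmod z)\<^sup>2) / pi) * ennreal (exp (Re (w * z))) \<partial>lborel)"
    unfolding cgauss_def by (subst nn_integral_density) auto
  also have "\<dots> = (\<integral>\<^sup>+z. ennreal (exp (Re (w * z) - (cmod z)\<^sup>2) / pi) \<partial>lborel)"
    by (intro nn_integral_cong)
      (auto simp: ennreal_mult'[symmetric] exp_add[symmetric])
  also have "\<dots> = (\<integral>\<^sup>+z. ennreal (exp (Re (w * z) - (cmod z)\<^sup>2) / pi) \<partial>(distr lborel borel ((+) (cnj w / 2))))"
    by (simp add: lborel_distr_plus)
  also have "\<dots> = (\<integral>\<^sup>+z. ennreal (exp (Re (w * (cnj w / 2 + z)) - (cmod (cnj w / 2 + z))\<^sup>2) / pi) \<partial>lborel)"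
    by (subst nn_integral_distr) auto
  also have "\<dots> = (\<integral>\<^sup>+z. ennreal (exp ((cmod w)\<^sup>2 / 4)) * ennreal (exp (- (cmod z)\<^sup>2) / pi) \<partial>lborel)"
    unfolding eq by (intro nn_integral_cong)
      (auto simp: ennreal_mult'[symmetric] exp_add[symmetric])
  also have "\<dots> = ennreal (exp ((cmod w)\<^sup>2 / 4)) * (\<integral>\<^sup>+z. 1 \<partial>cgauss)"
    unfolding cgauss_def by (subst nn_integral_cmult) (auto simp: nn_integral_density emeasure_density)
  also have "(\<integral>\<^sup>+z. 1 \<partial>cgauss) = 1"
    using cgauss.emeasure_space_1 by simp
  finally show ?thesis by simp
qed

abbreviation gauss :: "'i set \<Rightarrow> ('i \<Rightarrow> complex) measure" where
  "gauss I \<equiv> (\<Pi>\<^sub>M i\<in>I. cgauss)"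

lemma sets_gauss: "sets (gauss I) = sets (coeff_lborel I)"
  unfolding coeff_lborel_def by (intro sets_PiM_cong) auto

lemma space_gauss: "space (gauss I) = I \<rightarrow>\<^sub>E UNIV"
  by (simp add: space_PiM)

lemma measurable_gauss_component:
  "i \<in> I \<Longrightarrow> (\<lambda>a. a i) \<in> borel_measurable (gauss I)"
  using measurable_component_singleton[of i I "\<lambda>_. cgauss"] by (simp cong: measurable_cong_sets)

interpretation cg: product_sigma_finite "\<lambda>_::'i. cgauss"
  by unfold_locales

interpretation cleb: product_sigma_finite "\<lambda>_::'i. lborel :: complex measure"
  by unfold_locales

lemma prob_space_gauss: "prob_space (gauss I)"
  by (intro prob_space_PiM prob_space_cgauss)

text \<open>The product density depends on the squared norm alone, which is what makes the Gaussian
  measure comparable with Lebesgue measure on cones.\<close>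

lemma gauss_eq_density:
  assumes [simp]: "finite I"
  shows "gauss I = density (coeff_lborel I) (\<lambda>x. ennreal (exp (- (\<Sum>i\<in>I. (cmod (x i))\<^sup>2)) / pi ^ card I))"
proof (rule cg.PiM_eqI[symmetric])
  let ?f = "\<lambda>x. ennreal (exp (- (\<Sum>i\<in>I. (cmod (x i))\<^sup>2)) / pi ^ card I)"
  show "sets (density (coeff_lborel I) ?f) = sets (gauss I)"
    by (simp add: sets_gauss)
  have f: "?f x = (\<Prod>i\<in>I. ennreal (exp (- (cmod (x i))\<^sup>2) / pi))" for x
  proof -
    have "exp (- (\<Sum>i\<in>I. (cmod (x i))\<^sup>2)) = (\<Prod>i\<in>I. exp (- (cmod (x i))\<^sup>2))"
      unfolding sum_negf[symmetric] by (rule exp_sum) simp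
    then show ?thesis by (simp add: prod_ennreal prod_dividef)
  qed
  fix A assume A: "\<And>i. i \<in> I \<Longrightarrow> A i \<in> sets cgauss"
  then have A': "Pi\<^sub>E I A \<in> sets (coeff_lborel I)"
    unfolding coeff_lborel_def by (intro sets_PiM_I_finite) auto
  have [measurable]: "A i \<in> sets borel" if "i \<in> I" for i using A[OF that] by simp
  have ind: "indicator (Pi\<^sub>E I A) x = (\<Prod>i\<in>I. indicator (A i) (x i) :: ennreal)"
    if "x \<in> space (coeff_lborel I)" for x
    using that by (auto simp: indicator_def space_coeff_lborel PiE_iff prod_zero_iff)
  have "emeasure (density (coeff_lborel I) ?f) (Pi\<^sub>E I A) =
      (\<integral>\<^sup>+x. ?f x * indicator (Pi\<^sub>E I A) x \<partial>coeff_lborel I)"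
    by (rule emeasure_density[OF _ A']) (use measurable_coeff[measurable] in measurable)
  also have "\<dots> = (\<integral>\<^sup>+x. (\<Prod>i\<in>I. ennreal (exp (- (cmod (x i))\<^sup>2) / pi) * indicator (A i) (x i)) \<partial>coeff_lborel I)"
    by (intro nn_integral_cong) (simp add: f ind prod.distrib)
  also have "\<dots> = (\<Prod>i\<in>I. \<integral>\<^sup>+z. ennreal (exp (- (cmod z)\<^sup>2) / pi) * indicator (A i) z \<partial>lborel)"
    unfolding coeff_lborel_def by (rule cleb.product_nn_integral_prod) auto
  also have "\<dots> = (\<Prod>i\<in>I. emeasure cgauss (A i))"
    unfolding cgauss_def by (intro prod.cong refl) (subst emeasure_density, auto)
  finally show "emeasure (density (coeff_lborel I) ?f) (Pi\<^sub>E I A) = (\<Prod>i\<in>I. emeasure cgauss (A i))" .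
qed simp

text \<open>Each coordinate is a real plane, so a dilation by \<open>r\<close> contributes
  \<open>r\<^sup>2\<close> per coordinate.\<close>

lemma emeasure_coeff_lborel_scale:
  assumes [simp]: "finite I" and r: "0 < r" and A: "A \<in> sets (coeff_lborel I)"
  shows "emeasure (coeff_lborel I) A =
    ennreal (r ^ (2 * card I)) * emeasure (coeff_lborel I) {x \<in> space (coeff_lborel I). (\<lambda>i\<in>I. of_real r * x i) \<in> A}"
proof -
  let ?T = "\<lambda>x. \<lambda>i\<in>I. of_real r * x i :: complex"
  have T [measurable]: "?T \<in> coeff_lborel I \<rightarrow>\<^sub>M coeff_lborel I"
  proof -
    have "?T \<in> coeff_lborel I \<rightarrow>\<^sub>M (\<Pi>\<^sub>M i\<in>I. lborel)"
      using measurable_coeff[measurable] by measurable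
    then show ?thesis by (simp add: coeff_lborel_def)
  qed
  let ?D = "density (distr (coeff_lborel I) (coeff_lborel I) ?T) (\<lambda>_. ennreal (r ^ (2 * card I)))"
  have "?D = (\<Pi>\<^sub>M i\<in>I. lborel)"
  proof (rule cleb.PiM_eqI)
    show "sets ?D = sets (\<Pi>\<^sub>M i\<in>I. lborel)" by (simp add: coeff_lborel_def)
    fix B :: "'a \<Rightarrow> complex set" assume B: "\<And>i. i \<in> I \<Longrightarrow> B i \<in> sets lborel"
    then have B': "Pi\<^sub>E I B \<in> sets (coeff_lborel I)"
      unfolding coeff_lborel_def by (intro sets_PiM_I_finite) auto
    have one: "ennreal (r\<^sup>2) * emeasure lborel {z. of_real r * z \<in> B i} = emeasure lborel (B i)" if "i \<in> I" for i
    proof -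
      have "emeasure lborel (B i) =
          emeasure (density (distr lborel borel (\<lambda>x::complex. 0 + r *\<^sub>R x)) (\<lambda>_. ennreal (\<bar>r\<bar> ^ DIM(complex)))) (B i)"
        using lborel_affine[of r "0::complex"] r by simp
      also have "\<dots> = ennreal (r\<^sup>2) * emeasure lborel {z. of_real r * z \<in> B i}"
        using r B[OF that]
        by (subst emeasure_density_const) (auto simp: emeasure_distr vimage_def scaleR_conv_of_real)
      finally show ?thesis by simp
    qed
    have pre: "?T -` Pi\<^sub>E I B \<inter> space (coeff_lborel I) = (\<Pi>\<^sub>E i\<in>I. {z. of_real r * z \<in> B i})"
      by (auto simp: space_coeff_lborel PiE_iff)
    have Bm: "{z. of_real r * z \<in> B i} \<in> sets lborel" if "i \<in> I" for i
    proof -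
      have "(\<lambda>z::complex. of_real r * z) -` B i \<inter> space lborel \<in> sets lborel"
        using B[OF that] by (intro measurable_sets[where A = borel]) auto
      then show ?thesis by (simp add: vimage_def)
    qed
    have "emeasure ?D (Pi\<^sub>E I B) =
        ennreal (r ^ (2 * card I)) * emeasure (distr (coeff_lborel I) (coeff_lborel I) ?T) (Pi\<^sub>E I B)"
      using B' by (subst emeasure_density_const) auto
    also have "emeasure (distr (coeff_lborel I) (coeff_lborel I) ?T) (Pi\<^sub>E I B) =
        emeasure (coeff_lborel I) (\<Pi>\<^sub>E i\<in>I. {z. of_real r * z \<in> B i})"
      using B' by (subst emeasure_distr) (auto simp: pre)
    also have "\<dots> = (\<Prod>i\<in>I. emeasure lborel {z. of_real r * z \<in> B i})"
      unfolding coeff_lborel_def using Bm by (intro cleb.emeasure_PiM) auto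
    also have "ennreal (r ^ (2 * card I)) * \<dots> = (\<Prod>i\<in>I. ennreal (r\<^sup>2) * emeasure lborel {z. of_real r * z \<in> B i})"
      using r by (simp add: prod.distrib ennreal_power power_mult)
    also have "\<dots> = (\<Prod>i\<in>I. emeasure lborel (B i))"
      by (intro prod.cong refl one)
    finally show "emeasure ?D (Pi\<^sub>E I B) = (\<Prod>i\<in>I. emeasure lborel (B i))" .
  qed simp
  then have "emeasure (coeff_lborel I) A = emeasure ?D A" by (simp add: coeff_lborel_def)
  also have "\<dots> = ennreal (r ^ (2 * card I)) * emeasure (distr (coeff_lborel I) (coeff_lborel I) ?T) A"
    using A by (subst emeasure_density_const) auto
  also have "emeasure (distr (coeff_lborel I) (coeff_lborel I) ?T) A =
      emeasure (coeff_lborel I) {x \<in> space (coeff_lborel I). ?T x \<in> A}"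
    using A by (subst emeasure_distr) (auto intro!: arg_cong[where f = "emeasure _"])
  finally show ?thesis .
qed

lemma nn_integral_exp_atLeast:
  fixes a c :: real
  assumes "c > 0"
  shows "(\<integral>\<^sup>+t. ennreal (exp (- (c * t))) * indicator {a..} t \<partial>lborel) = ennreal (exp (- (c * a)) / c)"
proof -
  have lim: "((\<lambda>t. - exp (- (c * t)) / c) \<longlongrightarrow> 0) at_top"
    using assms by real_asymp
  have "(\<integral>\<^sup>+t. ennreal (exp (- (c * t))) * indicator {a..} t \<partial>lborel) = ennreal (0 - (- exp (- (c * a)) / c))"
    by (rule nn_integral_FTC_atLeast[OF _ _ _ lim])
      (use assms in \<open>auto intro!: derivative_eq_intros\<close>)
  then show ?thesis by simp
qed

section \<open>Exponential moments and small-value probabilities of Gaussian coefficients\<close>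

lemma nn_integral_cgauss_exp_norm_square:
  assumes "c < 1"
  shows "(\<integral>\<^sup>+z. ennreal (exp (c * (cmod z)\<^sup>2)) \<partial>cgauss) = ennreal (1 / (1 - c))"
proof -
  have "(\<integral>\<^sup>+z. ennreal (exp (c * (cmod z)\<^sup>2)) \<partial>cgauss) =
      (\<integral>\<^sup>+t. ennreal (exp (- t)) * ennreal (exp (c * t)) * indicator {0..} t \<partial>lborel)"
    by (subst nn_integral_cgauss_radial[symmetric]) auto
  also have "\<dots> = (\<integral>\<^sup>+t. ennreal (exp (- ((1 - c) * t))) * indicator {0..} t \<partial>lborel)"
    by (intro nn_integral_cong) (auto simp: ennreal_mult'[symmetric] exp_add[symmetric] algebra_simps)
  finally show ?thesis using assms by (subst (asm) nn_integral_exp_atLeast) auto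
qed

lemma emeasure_cgauss_disc:
  assumes "v \<ge> 0"
  shows "(\<integral>\<^sup>+w. indicator {w. (cmod w)\<^sup>2 \<le> v} w \<partial>cgauss) \<le> ennreal v"
    and "(\<integral>\<^sup>+w. indicator {w. (cmod w)\<^sup>2 \<le> v} w \<partial>cgauss) \<le> 1"
proof -
  have "(\<integral>\<^sup>+w. indicator {w. (cmod w)\<^sup>2 \<le> v} w \<partial>cgauss) = (\<integral>\<^sup>+w. indicator {..v} ((cmod w)\<^sup>2) \<partial>cgauss)"
    by (intro nn_integral_cong) (auto simp: indicator_def)
  also have "\<dots> = (\<integral>\<^sup>+t. ennreal (exp (- t)) * indicator {..v} t * indicator {0..} t \<partial>lborel)"
    by (rule nn_integral_cgauss_radial) simp
  also have "\<dots> \<le> (\<integral>\<^sup>+t. indicator {0..v} t \<partial>lborel)"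
    by (intro nn_integral_mono) (auto simp: indicator_def)
  also have "\<dots> = ennreal v" using assms by simp
  finally show "(\<integral>\<^sup>+w. indicator {w. (cmod w)\<^sup>2 \<le> v} w \<partial>cgauss) \<le> ennreal v" .
  have "(\<integral>\<^sup>+w. indicator {w. (cmod w)\<^sup>2 \<le> v} w \<partial>cgauss) \<le> (\<integral>\<^sup>+w. 1 \<partial>cgauss)"
    by (intro nn_integral_mono) (auto simp: indicator_def)
  then show "(\<integral>\<^sup>+w. indicator {w. (cmod w)\<^sup>2 \<le> v} w \<partial>cgauss) \<le> 1"
    using cgauss.emeasure_space_1 by simp
qed

text \<open>Given the squared modulus \<open>t\<close> of \<open>z\<close>, the inner probability is
  at most the minimum of 1 and \<open>u / t\<close>. Integrated against \<open>exp (- t)\<close>,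
  the ranges below \<open>u\<close>, from \<open>u\<close> to 1, and above 1 give at most
  \<open>u\<close>, \<open>u * ln (1 / u)\<close> and \<open>u\<close>. The middle range is where a
  logarithm enters.\<close>

lemma cgauss_pair_product_small:
  assumes u: "0 < u" "u \<le> 1"
  shows "(\<integral>\<^sup>+z. \<integral>\<^sup>+w. indicator {w. (cmod z)\<^sup>2 * (cmod w)\<^sup>2 \<le> u} w \<partial>cgauss \<partial>cgauss)
    \<le> ennreal (u * (2 + ln (1 / u)))"
proof -
  define h where "h t = (if t \<le> 0 then 1 else min 1 (u / t))" for t :: real
  have [measurable]: "h \<in> borel_measurable borel" unfolding h_def by measurable
  have inner: "(\<integral>\<^sup>+w. indicator {w. (cmod z)\<^sup>2 * (cmod w)\<^sup>2 \<le> u} w \<partial>cgauss) \<le> ennreal (h ((cmod z)\<^sup>2))" for z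
  proof (cases "z = 0")
    case True
    have "(\<integral>\<^sup>+w. indicator {w. (cmod z)\<^sup>2 * (cmod w)\<^sup>2 \<le> u} w \<partial>cgauss) \<le> (\<integral>\<^sup>+w. 1 \<partial>cgauss)"
      by (intro nn_integral_mono) (simp add: indicator_def)
    also have "\<dots> = ennreal (h ((cmod z)\<^sup>2))"
      using True cgauss.emeasure_space_1 by (simp add: h_def)
    finally show ?thesis .
  next
    case False
    then have "{w. (cmod z)\<^sup>2 * (cmod w)\<^sup>2 \<le> u} = {w. (cmod w)\<^sup>2 \<le> u / (cmod z)\<^sup>2}"
      by (simp add: pos_le_divide_eq mult.commute)
    then show ?thesis
      using False u emeasure_cgauss_disc[of "u / (cmod z)\<^sup>2"] by (auto simp: h_def min_def)
  qed
  have "(\<integral>\<^sup>+z. \<integral>\<^sup>+w. indicator {w. (cmod z)\<^sup>2 * (cmod w)\<^sup>2 \<le> u} w \<partial>cgauss \<partial>cgauss)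
      \<le> (\<integral>\<^sup>+z. ennreal (h ((cmod z)\<^sup>2)) \<partial>cgauss)"
    by (intro nn_integral_mono inner)
  also have "\<dots> = (\<integral>\<^sup>+t. ennreal (exp (- t)) * ennreal (h t) * indicator {0..} t \<partial>lborel)"
    by (rule nn_integral_cgauss_radial) simp
  also have "\<dots> \<le> (\<integral>\<^sup>+t. indicator {0..u} t + ennreal (u / t) * indicator {u..1} t +
      ennreal u * (ennreal (exp (- (1 * t))) * indicator {0..} t) \<partial>lborel)"
  proof (intro nn_integral_mono)
    fix t :: real
    show "ennreal (exp (- t)) * ennreal (h t) * indicator {0..} t \<le>
      indicator {0..u} t + ennreal (u / t) * indicator {u..1} t + ennreal u * (ennreal (exp (- (1 * t))) * indicator {0..} t)"
    proof (cases "t \<le> u")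
      case True
      have "exp (- t) * h t \<le> 1" if "t \<ge> 0"
        using that u by (intro mult_le_one) (auto simp: h_def)
      then have "ennreal (exp (- t)) * ennreal (h t) * indicator {0..} t \<le> indicator {0..u} t"
        using True by (auto simp: indicator_def ennreal_mult'[symmetric])
      then show ?thesis by (intro add_increasing2) auto
    next
      case False
      then have t: "t > 0" using u by simp
      show ?thesis
      proof (cases "t \<le> 1")
        case True
        have "exp (- t) * h t \<le> 1 * (u / t)"
          using t u by (intro mult_mono) (auto simp: h_def)
        then have "ennreal (exp (- t)) * ennreal (h t) * indicator {0..} t \<le> ennreal (u / t) * indicator {u..1} t"
          using True False t by (auto simp: indicator_def ennreal_mult'[symmetric] intro: ennreal_leI)
        then show ?thesis
          by (intro add_increasing2[OF _ add_increasing]) auto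
      next
        case False
        have "h t \<le> u" using False t u mult_left_mono[of 1 t u] by (auto simp: h_def divide_le_eq min_le_iff_disj)
        then have "exp (- t) * h t \<le> exp (- t) * u" by simp
        then have "ennreal (exp (- t) * h t) \<le> ennreal (exp (- t) * u)" by (rule ennreal_leI)
        then have "ennreal (exp (- t)) * ennreal (h t) * indicator {0..} t
            \<le> ennreal u * (ennreal (exp (- (1 * t))) * indicator {0..} t)"
          using t u unfolding ennreal_mult'[OF exp_ge_zero] by (simp add: indicator_def mult.commute)
        then show ?thesis by (intro add_increasing) auto
      qed
    qed
  qed
  also have "\<dots> = (\<integral>\<^sup>+t. indicator {0..u} t \<partial>lborel) + (\<integral>\<^sup>+t. ennreal (u / t) * indicator {u..1} t \<partial>lborel) +
      ennreal u * (\<integral>\<^sup>+t. ennreal (exp (- (1 * t))) * indicator {0..} t \<partial>lborel)"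
    by (simp add: nn_integral_add nn_integral_cmult)
  also have "(\<integral>\<^sup>+t. indicator {0..u} t \<partial>lborel) = ennreal u" using u by simp
  also have "(\<integral>\<^sup>+t. ennreal (u / t) * indicator {u..1} t \<partial>lborel) = ennreal (u * ln 1 - u * ln u)"
    by (rule nn_integral_FTC_Icc) (use u in \<open>auto intro!: derivative_eq_intros\<close>)
  also have "(\<integral>\<^sup>+t. ennreal (exp (- (1 * t))) * indicator {0..} t \<partial>lborel) = ennreal (exp (- (1 * 0)) / 1)"
    by (rule nn_integral_exp_atLeast) simp
  also have "ennreal u + ennreal (u * ln 1 - u * ln u) + ennreal u * ennreal (exp (- (1 * 0)) / 1) =
      ennreal (u + (u * ln 1 - u * ln u) + u * 1)"
  proof -
    define b where "b = u * ln 1 - u * ln u"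
    have "u * ln u \<le> 0" using u by (intro mult_nonneg_nonpos) auto
    then have "0 \<le> b" by (simp add: b_def)
    then show ?thesis
      using u ennreal_plus[of "u + b" u] ennreal_plus[of u b] unfolding b_def[symmetric] by simp
  qed
  also have "u + (u * ln 1 - u * ln u) + u * 1 = u * (2 + ln (1 / u))"
    using u by (simp add: ln_div algebra_simps)
  finally show ?thesis .
qed

text \<open>Given \<open>z\<close>, the inner probability is at most \<open>c\<close> times X, the
  squared modulus of \<open>z\<close>. Where X exceeds \<open>d\<close>, the bounds X \<le> 4 exp (X
  / 4) and 1 \<le> exp ((X - d) / 2) leave the exponential moment of order 3/4, still below the
  critical order 1; it equals 4, so the constant is 4 times 4.\<close>

lemma cgauss_pair_comparison_small:
  assumes c: "0 \<le> c" and d: "0 \<le> d"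
  shows "(\<integral>\<^sup>+z. \<integral>\<^sup>+w. indicator {w. (cmod w)\<^sup>2 \<le> c * (cmod z)\<^sup>2 \<and> d < (cmod z)\<^sup>2} w \<partial>cgauss \<partial>cgauss)
    \<le> ennreal (16 * c * exp (- (d / 2)))"
proof -
  have "(\<integral>\<^sup>+z. \<integral>\<^sup>+w. indicator {w. (cmod w)\<^sup>2 \<le> c * (cmod z)\<^sup>2 \<and> d < (cmod z)\<^sup>2} w \<partial>cgauss \<partial>cgauss)
      \<le> (\<integral>\<^sup>+z. ennreal (4 * c * exp (- (d / 2))) * ennreal (exp (3 / 4 * (cmod z)\<^sup>2)) \<partial>cgauss)"
  proof (intro nn_integral_mono)
    fix z :: complex
    let ?X = "(cmod z)\<^sup>2"
    show "(\<integral>\<^sup>+w. indicator {w. (cmod w)\<^sup>2 \<le> c * ?X \<and> d < ?X} w \<partial>cgauss)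
      \<le> ennreal (4 * c * exp (- (d / 2))) * ennreal (exp (3 / 4 * ?X))"
    proof (cases "d < ?X")
      case True
      have "?X / 4 \<le> exp (?X / 4)" using exp_ge_add_one_self[of "?X / 4"] by linarith
      then have "?X * 1 \<le> (4 * exp (?X / 4)) * exp ((?X - d) / 2)"
      proof (intro mult_mono)
        show "?X \<le> 4 * exp (?X / 4)" using \<open>?X / 4 \<le> exp (?X / 4)\<close> by linarith
        show "1 \<le> exp ((?X - d) / 2)" unfolding one_le_exp_iff using True by simp
      qed (rule mult_nonneg_nonneg, simp_all only: exp_ge_zero zero_le_numeral zero_le_one)
      also have "\<dots> = 4 * (exp (- (d / 2)) * exp (3 / 4 * ?X))"
      proof -
        have e: "?X / 4 + (?X - d) / 2 = - (d / 2) + 3 / 4 * ?X" by (simp add: field_simps)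
        show ?thesis unfolding mult.assoc exp_add[symmetric] e ..
      qed
      finally have "c * ?X \<le> c * (4 * (exp (- (d / 2)) * exp (3 / 4 * ?X)))"
        using c by (intro mult_left_mono) auto
      also have "\<dots> = (4 * c * exp (- (d / 2))) * exp (3 / 4 * ?X)"
        by (simp only: mult_ac)
      finally have "ennreal (c * ?X) \<le> ennreal ((4 * c * exp (- (d / 2))) * exp (3 / 4 * ?X))"
        by (rule ennreal_leI)
      also have "\<dots> = ennreal (4 * c * exp (- (d / 2))) * ennreal (exp (3 / 4 * ?X))"
        using c by (intro ennreal_mult') simp
      finally have "ennreal (c * ?X) \<le> \<dots>" .
      moreover have "(\<integral>\<^sup>+w. indicator {w. (cmod w)\<^sup>2 \<le> c * ?X \<and> d < ?X} w \<partial>cgauss)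
          \<le> (\<integral>\<^sup>+w. indicator {w. (cmod w)\<^sup>2 \<le> c * ?X} w \<partial>cgauss)"
        by (intro nn_integral_mono) (simp add: indicator_def)
      moreover have "(\<integral>\<^sup>+w. indicator {w. (cmod w)\<^sup>2 \<le> c * ?X} w \<partial>cgauss) \<le> ennreal (c * ?X)"
        using c by (intro emeasure_cgauss_disc(1)) simp
      ultimately show ?thesis by (meson order_trans)
    qed simp
  qed
  also have "\<dots> = ennreal (4 * c * exp (- (d / 2))) * (\<integral>\<^sup>+z. ennreal (exp (3 / 4 * (cmod z)\<^sup>2)) \<partial>cgauss)"
    by (rule nn_integral_cmult) measurable
  also have "(\<integral>\<^sup>+z. ennreal (exp (3 / 4 * (cmod z)\<^sup>2)) \<partial>cgauss) = ennreal (1 / (1 - 3 / 4))"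
    by (rule nn_integral_cgauss_exp_norm_square) linarith
  also have "ennreal (4 * c * exp (- (d / 2))) * ennreal (1 / (1 - 3 / 4)) =
      ennreal (4 * c * exp (- (d / 2)) * (1 / (1 - 3 / 4)))"
    using c by (intro ennreal_mult'[symmetric]) simp
  also have "4 * c * exp (- (d / 2)) * (1 / (1 - 3 / 4)) = 16 * c * exp (- (d / 2))"
    by simp
  finally show ?thesis .
qed

lemma nn_integral_gauss_prod:
  fixes f :: "'i \<Rightarrow> complex \<Rightarrow> ennreal"
  assumes "finite I" "\<And>i. i \<in> I \<Longrightarrow> f i \<in> borel_measurable borel"
  shows "(\<integral>\<^sup>+x. (\<Prod>i\<in>I. f i (x i)) \<partial>gauss I) = (\<Prod>i\<in>I. \<integral>\<^sup>+z. f i z \<partial>cgauss)"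
  using assms by (intro cg.product_nn_integral_prod) (auto simp: measurable_cong_sets[OF sets_cgauss refl])

lemma nn_integral_gauss_exp_norm_square:
  assumes "finite I" "c < 1"
  shows "(\<integral>\<^sup>+x. ennreal (exp (c * (\<Sum>i\<in>I. (cmod (x i))\<^sup>2))) \<partial>gauss I) = ennreal ((1 / (1 - c)) ^ card I)"
proof -
  have "(\<integral>\<^sup>+x. ennreal (exp (c * (\<Sum>i\<in>I. (cmod (x i))\<^sup>2))) \<partial>gauss I) =
      (\<integral>\<^sup>+x. (\<Prod>i\<in>I. ennreal (exp (c * (cmod (x i))\<^sup>2))) \<partial>gauss I)"
    using assms by (simp add: sum_distrib_left exp_sum prod_ennreal)
  also have "\<dots> = (\<Prod>i\<in>I. ennreal (1 / (1 - c)))"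
    using assms by (subst nn_integral_gauss_prod) (auto simp: nn_integral_cgauss_exp_norm_square)
  finally show ?thesis using assms by (simp add: ennreal_power)
qed

lemma nn_integral_gauss_component:
  assumes I: "finite I" "i \<in> I" and [measurable]: "f \<in> borel_measurable borel"
  shows "(\<integral>\<^sup>+x. f (x i) \<partial>gauss I) = (\<integral>\<^sup>+z. f z \<partial>cgauss)"
proof -
  have "(\<integral>\<^sup>+x. f (x i) \<partial>gauss I) = (\<integral>\<^sup>+x. (\<Prod>j\<in>I. (if j = i then f else (\<lambda>_. 1)) (x j)) \<partial>gauss I)"
    using I by (intro nn_integral_cong) (simp add: if_distribR prod.delta)
  also have "\<dots> = (\<Prod>j\<in>I. \<integral>\<^sup>+z. (if j = i then f else (\<lambda>_. 1)) z \<partial>cgauss)"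
    using I by (intro nn_integral_gauss_prod) auto
  also have "\<dots> = (\<Prod>j\<in>I. if j = i then \<integral>\<^sup>+z. f z \<partial>cgauss else 1)"
    using cgauss.emeasure_space_1 by (intro prod.cong) auto
  also have "\<dots> = (\<integral>\<^sup>+z. f z \<partial>cgauss)" using I by (simp add: prod.delta)
  finally show ?thesis .
qed

lemma emeasure_cgauss_uminus:
  assumes B: "B \<in> sets borel"
  shows "emeasure cgauss {z. - z \<in> B} = emeasure cgauss B"
proof -
  have L: "distr lborel borel uminus = (lborel :: complex measure)"
    using lborel_affine[of "-1" "0::complex"] by (simp add: density_1)
  have m: "{z. - z \<in> B} \<in> sets borel"
    using measurable_sets[of uminus borel borel B] B by (simp add: vimage_def)
  have "emeasure cgauss B = (\<integral>\<^sup>+z. ennreal (exp (- (cmod z)\<^sup>2) / pi) * indicator B z \<partial>(distr lborel borel uminus))"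
    unfolding cgauss_def L using B by (subst emeasure_density) auto
  also have "\<dots> = (\<integral>\<^sup>+z. ennreal (exp (- (cmod z)\<^sup>2) / pi) * indicator {z. - z \<in> B} z \<partial>lborel)"
    using B by (subst nn_integral_distr) (auto intro!: nn_integral_cong simp: indicator_def)
  also have "\<dots> = emeasure cgauss {z. - z \<in> B}"
    unfolding cgauss_def using m by (subst emeasure_density) auto
  finally show ?thesis by simp
qed

text \<open>This invariance allows random signs to be inserted into a Gaussian integral, which
  reduces the question to discrete signs with the moduli held fixed.\<close>

lemma distr_gauss_signs:
  fixes s :: "'i \<Rightarrow> real"
  assumes I: "finite I" and s: "\<And>i. i \<in> I \<Longrightarrow> s i = 1 \<or> s i = -1"
  shows "distr (gauss I) (gauss I) (\<lambda>x. \<lambda>i\<in>I. of_real (s i) * x i) = gauss I"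
proof (rule cg.PiM_eqI[OF I])
  let ?T = "\<lambda>x. \<lambda>i\<in>I. of_real (s i) * x i :: complex"
  have T [measurable]: "?T \<in> gauss I \<rightarrow>\<^sub>M gauss I"
    by (intro measurable_restrict) (auto simp: measurable_cong_sets[OF refl sets_cgauss])
  fix A assume A: "\<And>i. i \<in> I \<Longrightarrow> A i \<in> sets cgauss"
  then have A': "Pi\<^sub>E I A \<in> sets (gauss I)" using I by (intro sets_PiM_I_finite) auto
  have eq: "emeasure cgauss {z. of_real (s i) * z \<in> A i} = emeasure cgauss (A i)"
    "{z. of_real (s i) * z \<in> A i} \<in> sets cgauss" if "i \<in> I" for i
    using s[OF that] emeasure_cgauss_uminus[of "A i"] A[OF that]
      measurable_sets[of uminus borel borel "A i"] by (auto simp: vimage_def)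
  have "emeasure (distr (gauss I) (gauss I) ?T) (Pi\<^sub>E I A) = emeasure (gauss I) (\<Pi>\<^sub>E i\<in>I. {z. of_real (s i) * z \<in> A i})"
    using A' by (subst emeasure_distr) (auto intro!: arg_cong[where f = "emeasure _"] simp: space_gauss PiE_iff)
  also have "\<dots> = (\<Prod>i\<in>I. emeasure cgauss (A i))"
    using I eq by (subst cg.emeasure_PiM) auto
  finally show "emeasure (distr (gauss I) (gauss I) ?T) (Pi\<^sub>E I A) = (\<Prod>i\<in>I. emeasure cgauss (A i))" .
qed simp

section \<open>Cones\<close>

lemma coeff_lborel_null_origin:
  assumes "finite I" "I \<noteq> {}"
  shows "emeasure (coeff_lborel I) {x \<in> I \<rightarrow>\<^sub>E UNIV. (\<Sum>i\<in>I. (cmod (x i))\<^sup>2) = 0} = 0"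
proof -
  have "{x \<in> I \<rightarrow>\<^sub>E UNIV. (\<Sum>i\<in>I. (cmod (x i))\<^sup>2) = 0} = (\<Pi>\<^sub>E i\<in>I. {0 :: complex})"
    using assms by (auto simp: sum_nonneg_eq_0_iff PiE_iff extensional_def fun_eq_iff)
  moreover have "emeasure (coeff_lborel I) (\<Pi>\<^sub>E i\<in>I. {0}) = (\<Prod>i\<in>I. emeasure lborel {0 :: complex})"
    using assms unfolding coeff_lborel_def by (intro cleb.emeasure_PiM) auto
  moreover have "(\<Prod>i\<in>I. emeasure lborel {0 :: complex}) = 0"
    using assms by (simp add: prod_constant card_gt_0_iff)
  ultimately show ?thesis by simp
qed

text \<open>Layer-cake formula: \<open>exp (- q x)\<close> is the integral of
  \<open>exp (- t)\<close> over \<open>t \<ge> q x\<close>. By scaling, the part of the cone with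
  \<open>q \<le> t\<close> has \<open>t ^ N\<close> times the Lebesgue measure of the part with
  \<open>q \<le> 1\<close>, and the integral of \<open>t ^ N * exp (- t)\<close> is
  \<open>fact N\<close>.\<close>

lemma emeasure_gauss_cone:
  assumes I: "finite I" "I \<noteq> {}" and A: "A \<in> sets (coeff_lborel I)"
    and cone: "\<And>r x. 0 < r \<Longrightarrow> x \<in> I \<rightarrow>\<^sub>E UNIV \<Longrightarrow> (\<lambda>i\<in>I. of_real r * x i) \<in> A \<longleftrightarrow> x \<in> A"
  shows "emeasure (gauss I) A =
    ennreal (fact (card I) / pi ^ card I) * emeasure (coeff_lborel I) (A \<inter> coeff_punctured_ball I)"
proof -
  define q where "q x = (\<Sum>i\<in>I. (cmod (x i))\<^sup>2)" for x :: "'a \<Rightarrow> complex"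
  define N where "N = card I"
  define D where "D t = emeasure (coeff_lborel I) {x \<in> A. q x \<le> t}" for t
  have q [measurable]: "q \<in> borel_measurable (coeff_lborel I)"
    using measurable_coeff [measurable] unfolding q_def[abs_def] by measurable
  have spA: "A \<subseteq> I \<rightarrow>\<^sub>E UNIV" using sets.sets_into_space[OF A] by (simp add: space_coeff_lborel)
  have q_scale: "q (\<lambda>i\<in>I. of_real r * x i) = r\<^sup>2 * q x" for r x
    by (simp add: q_def norm_mult power_mult_distrib sum_distrib_left)
  have setsD: "{x \<in> A. q x \<le> t} \<in> sets (coeff_lborel I)" for t
  proof -
    have "A \<inter> {x \<in> space (coeff_lborel I). q x \<le> t} \<in> sets (coeff_lborel I)"
      using A q by (intro sets.Int) (auto intro: borel_measurable_le)
    moreover have "A \<inter> {x \<in> space (coeff_lborel I). q x \<le> t} = {x \<in> A. q x \<le> t}"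
      using sets.sets_into_space[OF A] by auto
    ultimately show ?thesis by simp
  qed
  have D_scale: "D t = ennreal (t ^ N) * D 1" if "t > 0" for t
  proof -
    have s: "sqrt t > 0" "(sqrt t)\<^sup>2 = t" using that by auto
    have "{x \<in> space (coeff_lborel I). (\<lambda>i\<in>I. of_real (sqrt t) * x i) \<in> {x \<in> A. q x \<le> t}} = {x \<in> A. q x \<le> 1}"
      using cone[OF s(1)] spA that unfolding mem_Collect_eq q_scale s(2) space_coeff_lborel
      by (auto simp: mult_le_cancel_left1)
    then show ?thesis
      using emeasure_coeff_lborel_scale[OF I(1) s(1) setsD[of t]] s(2)
      by (simp add: D_def N_def power_mult)
  qed
  interpret L: sigma_finite_measure "coeff_lborel I"
    unfolding coeff_lborel_def using I by (intro cleb.sigma_finite)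
  interpret P: pair_sigma_finite "coeff_lborel I" lborel by unfold_locales
  let ?c = "1 / pi ^ N"
  let ?g = "\<lambda>t. ennreal (?c * exp (- t))"
  have layer: "ennreal (exp (- q x) / pi ^ card I) = (\<integral>\<^sup>+t. ?g t * indicator {q x..} t \<partial>lborel)" for x
  proof -
    have "(\<integral>\<^sup>+t. ?g t * indicator {q x..} t \<partial>lborel) =
        (\<integral>\<^sup>+t. ennreal ?c * (ennreal (exp (- (1 * t))) * indicator {q x..} t) \<partial>lborel)"
    proof (intro nn_integral_cong)
      fix t
      have "?g t = ennreal ?c * ennreal (exp (- t))" by (rule ennreal_mult') simp
      then show "?g t * indicator {q x..} t = ennreal ?c * (ennreal (exp (- (1 * t))) * indicator {q x..} t)"
        by (simp add: mult.assoc)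
    qed
    also have "\<dots> = ennreal ?c * (\<integral>\<^sup>+t. ennreal (exp (- (1 * t))) * indicator {q x..} t \<partial>lborel)"
      by (rule nn_integral_cmult) measurable
    also have "(\<integral>\<^sup>+t. ennreal (exp (- (1 * t))) * indicator {q x..} t \<partial>lborel) = ennreal (exp (- (1 * q x)) / 1)"
      by (rule nn_integral_exp_atLeast) simp
    also have "ennreal ?c * ennreal (exp (- (1 * q x)) / 1) = ennreal (?c * (exp (- (1 * q x)) / 1))"
      by (rule ennreal_mult'[symmetric]) simp
    finally show ?thesis by (simp add: N_def)
  qed
  have "emeasure (gauss I) A = (\<integral>\<^sup>+x. ennreal (exp (- q x) / pi ^ card I) * indicator A x \<partial>coeff_lborel I)"
    unfolding gauss_eq_density[OF I(1)] q_def[symmetric] using A by (intro emeasure_density) measurable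
  also have "\<dots> = (\<integral>\<^sup>+x. \<integral>\<^sup>+t. ?g t * (indicator {x \<in> space (coeff_lborel I). q x \<le> t} x * indicator A x) \<partial>lborel \<partial>coeff_lborel I)"
  proof (intro nn_integral_cong)
    fix x assume x: "x \<in> space (coeff_lborel I)"
    have "ennreal (exp (- q x) / pi ^ card I) * indicator A x = (\<integral>\<^sup>+t. ?g t * indicator {q x..} t * indicator A x \<partial>lborel)"
      unfolding layer by (rule nn_integral_multc[symmetric]) measurable
    also have "\<dots> = (\<integral>\<^sup>+t. ?g t * (indicator {x \<in> space (coeff_lborel I). q x \<le> t} x * indicator A x) \<partial>lborel)"
      using x by (intro nn_integral_cong) (simp add: indicator_def)
    finally show "ennreal (exp (- q x) / pi ^ card I) * indicator A x = \<dots>" .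
  qed
  also have "\<dots> = (\<integral>\<^sup>+t. \<integral>\<^sup>+x. ?g t * (indicator {x \<in> space (coeff_lborel I). q x \<le> t} x * indicator A x) \<partial>coeff_lborel I \<partial>lborel)"
  proof (rule P.Fubini'[symmetric])
    have [measurable]: "(\<lambda>p. q (fst p)) \<in> borel_measurable (coeff_lborel I \<Otimes>\<^sub>M lborel)"
      by (rule measurable_compose[OF measurable_fst q])
    have [measurable]: "A \<in> sets (coeff_lborel I)" by (rule A)
    have "(\<lambda>p. ?g (snd p) * (indicator {p \<in> space (coeff_lborel I \<Otimes>\<^sub>M lborel). q (fst p) \<le> snd p} p * indicator A (fst p)))
        \<in> borel_measurable (coeff_lborel I \<Otimes>\<^sub>M lborel)" by measurable
    then show "case_prod (\<lambda>x t. ?g t * (indicator {x \<in> space (coeff_lborel I). q x \<le> t} x * indicator A x))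
        \<in> borel_measurable (coeff_lborel I \<Otimes>\<^sub>M lborel)"
      by (rule measurable_cong[THEN iffD1, rotated])
        (auto simp: space_pair_measure indicator_def)
  qed
  also have "\<dots> = (\<integral>\<^sup>+t. ?g t * D t \<partial>lborel)"
  proof (intro nn_integral_cong)
    fix t :: real
    have "(\<integral>\<^sup>+x. ?g t * (indicator {x \<in> space (coeff_lborel I). q x \<le> t} x * indicator A x) \<partial>coeff_lborel I) =
        (\<integral>\<^sup>+x. ?g t * indicator {x \<in> A. q x \<le> t} x \<partial>coeff_lborel I)"
      using spA by (intro nn_integral_cong) (auto simp: indicator_def)
    also have "\<dots> = ?g t * D t"
      unfolding D_def using setsD by (rule nn_integral_cmult_indicator)
    finally show "(\<integral>\<^sup>+x. ?g t * (indicator {x \<in> space (coeff_lborel I). q x \<le> t} x * indicator A x) \<partial>coeff_lborel I) = ?g t * D t" .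
  qed
  also have "\<dots> = (\<integral>\<^sup>+t. (ennreal ?c * D 1) * (ennreal (t ^ N * exp (- t)) * indicator {0..} t) \<partial>lborel)"
  proof (rule nn_integral_cong_AE)
    show "AE t in lborel. ?g t * D t = (ennreal ?c * D 1) * (ennreal (t ^ N * exp (- t)) * indicator {0..} t)"
      using AE_lborel_singleton[of "0::real"]
    proof eventually_elim
      case (elim t)
      show ?case
      proof (cases "t > 0")
        case True
        have "ennreal (?c * exp (- t)) = ennreal ?c * ennreal (exp (- t))"
          "ennreal (t ^ N * exp (- t)) = ennreal (t ^ N) * ennreal (exp (- t))"
          using True by (auto intro!: ennreal_mult' simp del: times_divide_eq_left)
        then have e: "?g t * D t = ennreal ?c * ennreal (exp (- t)) * (ennreal (t ^ N) * D 1)"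
          "ennreal (t ^ N * exp (- t)) * indicator {0..} t = ennreal (t ^ N) * ennreal (exp (- t))"
          using True by (simp_all only: D_scale[OF True]) simp
        show ?thesis unfolding e by (simp only: ac_simps)
      next
        case False
        then have "t < 0" using elim by simp
        moreover have "q x \<ge> 0" for x by (simp add: q_def sum_nonneg)
        ultimately have "\<not> q x \<le> t" for x by (meson not_le order.strict_trans2)
        then have "{x \<in> A. q x \<le> t} = {}" by simp
        then have "D t = 0" unfolding D_def by (simp only: emeasure_empty)
        then show ?thesis using \<open>t < 0\<close> by simp
      qed
    qed
  qed
  also have "\<dots> = (ennreal ?c * D 1) * (\<integral>\<^sup>+t. ennreal (t ^ N * exp (- t)) * indicator {0..} t \<partial>lborel)"
    by (rule nn_integral_cmult) measurable
  also have "\<dots> = (ennreal ?c * D 1) * ennreal (fact N)"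
    unfolding nn_intergal_power_times_exp_Ici by simp
  also have "\<dots> = (ennreal ?c * ennreal (fact N)) * D 1"
    by (simp only: ac_simps)
  also have "ennreal ?c * ennreal (fact N) = ennreal (?c * fact N)"
    by (rule ennreal_mult'[symmetric]) simp
  also have "?c * fact N = fact N / pi ^ N" by simp
  also have "D 1 = emeasure (coeff_lborel I) (A \<inter> coeff_punctured_ball I)"
  proof -
    \<comment> \<open>The ball in \<open>D 1\<close> is not punctured, so the two sets may differ by
      the origin, a null set because \<open>I\<close> is nonempty.\<close>
    let ?Z = "{x \<in> I \<rightarrow>\<^sub>E UNIV. (\<Sum>i\<in>I. (cmod (x i))\<^sup>2) = 0}"
    have Z: "?Z \<in> null_sets (coeff_lborel I)"
    proof (rule null_setsI)
      have "?Z = {x \<in> space (coeff_lborel I). q x = 0}" by (simp add: space_coeff_lborel q_def)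
      also have "\<dots> \<in> sets (coeff_lborel I)" by measurable
      finally show "?Z \<in> sets (coeff_lborel I)" .
    qed (rule coeff_lborel_null_origin[OF I])
    have "{x \<in> A. q x \<le> 1} - ?Z = A \<inter> coeff_punctured_ball I"
    proof -
      have "q x \<ge> 0" for x by (simp add: q_def sum_nonneg)
      then have "0 < q x \<longleftrightarrow> q x \<noteq> 0" for x by (simp add: less_le)
      then show ?thesis
        using spA unfolding coeff_punctured_ball_def lp_norm_2 q_def[symmetric]
        by auto
    qed
    then show ?thesis unfolding D_def using emeasure_Diff_null_set[OF Z setsD[of 1]] by simp
  qed
  finally show ?thesis by (simp add: N_def)
qed

text \<open>A cone has the same measure under the normalised surface measure and under the Gaussian
  measure, because both are proportional to the Lebesgue measure of the part of the cone that lies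
  in the unit ball.\<close>

lemma sphere_measure_cone:
  assumes I: "finite I" "I \<noteq> {}" and A: "A \<in> sets (coeff_lborel I)"
    and cone: "\<And>r x. 0 < r \<Longrightarrow> x \<in> I \<rightarrow>\<^sub>E UNIV \<Longrightarrow> (\<lambda>i\<in>I. of_real r * x i) \<in> A \<longleftrightarrow> x \<in> A"
  shows "A \<inter> coeff_sphere I \<in> sets (sphere_measure I)"
    and "measure (sphere_measure I) (A \<inter> coeff_sphere I) = measure (gauss I) A"
proof -
  let ?E = "A \<inter> coeff_sphere I" and ?B = "coeff_punctured_ball I"
  show E: "?E \<in> sets (sphere_measure I)"
    unfolding sets_sphere_measure using A sets_coeff_sphere[of I]
    by (auto simp: sets_restrict_space)
  then have E': "?E \<in> sets (surface_measure I)"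
    by (simp add: sphere_measure_def)
  have coneE: "{\<lambda>i\<in>I. of_real r * x i | r x. 0 < r \<and> r \<le> 1 \<and> x \<in> ?E} = A \<inter> ?B"
  proof -
    have "radial_proj I a \<in> A \<longleftrightarrow> a \<in> A" if "a \<in> ?B" for a
    proof -
      have "0 < lp_norm 2 I a" "a \<in> I \<rightarrow>\<^sub>E UNIV" using that by (auto simp: coeff_punctured_ball_def)
      moreover have "radial_proj I a = (\<lambda>i\<in>I. of_real (1 / lp_norm 2 I a) * a i)"
        by (auto simp: radial_proj_def fun_eq_iff)
      ultimately show ?thesis using cone[of "1 / lp_norm 2 I a" a] by simp
    qed
    then show ?thesis
      using radial_proj_in_sphere
      by (subst radial_proj_vimage_eq_cone[symmetric]) auto
  qed
  let ?k = "fact (card I) / pi ^ card I :: real"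
  have gA: "emeasure (gauss I) A = ennreal ?k * emeasure (coeff_lborel I) (A \<inter> ?B)"
    by (rule emeasure_gauss_cone[OF I A cone])
  \<comment> \<open>The whole space is a cone of Gaussian mass 1, which identifies the
    proportionality constant as the inverse volume of the ball without computing that
    volume.\<close>
  have "emeasure (gauss I) (I \<rightarrow>\<^sub>E UNIV) = ennreal ?k * emeasure (coeff_lborel I) ((I \<rightarrow>\<^sub>E UNIV) \<inter> ?B)"
    by (rule emeasure_gauss_cone[OF I]) (auto simp: space_coeff_lborel[symmetric], simp add: space_coeff_lborel)
  moreover have "(I \<rightarrow>\<^sub>E UNIV) \<inter> ?B = ?B" by (auto simp: coeff_punctured_ball_def)
  moreover have "emeasure (gauss I) (I \<rightarrow>\<^sub>E UNIV) = 1"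
    using prob_space.emeasure_space_1[OF prob_space_gauss, of I] by (simp add: space_gauss)
  ultimately have gB: "1 = ennreal ?k * emeasure (coeff_lborel I) ?B" by simp
  obtain b where b: "emeasure (coeff_lborel I) ?B = ennreal b" "b > 0"
    using emeasure_punctured_ball_finite[OF I(1)] emeasure_punctured_ball_pos[OF I]
    by (cases "emeasure (coeff_lborel I) ?B") auto
  have "emeasure (coeff_lborel I) (A \<inter> ?B) \<le> ennreal b"
    unfolding b(1)[symmetric] by (intro emeasure_mono sets_coeff_punctured_ball) auto
  then obtain x where x: "emeasure (coeff_lborel I) (A \<inter> ?B) = ennreal x" "x \<ge> 0"
    by (cases "emeasure (coeff_lborel I) (A \<inter> ?B)") (auto simp: top_unique)
  have kb: "?k * b = 1"
    using gB b by (simp add: ennreal_mult'[symmetric])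
  have n: "card I > 0" using I by (simp add: card_gt_0_iff)
  have "emeasure (sphere_measure I) ?E = (1 / (ennreal (2 * card I) * ennreal b)) * (ennreal (2 * card I) * ennreal x)"
    unfolding sphere_measure_def emeasure_scale_measure emeasure_surface_measure[OF E'] coneE
      emeasure_surface_measure_space b(1) x(1) by (simp add: ennreal_of_nat_eq_real_of_nat)
  also have "\<dots> = ennreal (1 / (2 * card I * b) * (2 * card I * x))"
    using n b x by (simp add: ennreal_mult'[symmetric] divide_ennreal flip: ennreal_1)
  also have "1 / (2 * card I * b) * (2 * card I * x) = ?k * x"
    using n b kb by (simp add: field_simps)
  also have "ennreal (?k * x) = emeasure (gauss I) A"
    unfolding gA x(1) by (rule ennreal_mult') simp
  finally show "measure (sphere_measure I) ?E = measure (gauss I) A"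
    by (simp add: measure_def)
qed

section \<open>Random signs\<close>

text \<open>A choice of signs is encoded by the set \<open>U\<close> of indices that carry -1. The
  value is then the Walsh character of \<open>S\<close>, and uniform random signs become a uniformly
  chosen subset \<open>U\<close>.\<close>

definition walsh :: "'i set \<Rightarrow> 'i set \<Rightarrow> real" where
  "walsh U S = (\<Prod>i\<in>S. if i \<in> U then -1 else 1)"

definition sdiff :: "'i set \<Rightarrow> 'i set \<Rightarrow> 'i set" where
  "sdiff S T = (S - T) \<union> (T - S)"

text \<open>A sign that occurs in both products is squared and drops out.\<close>

lemma walsh_sdiff:
  assumes "finite S" "finite T"
  shows "walsh U (sdiff S T) = walsh U S * walsh U T"
proof -
  let ?s = "\<lambda>i. if i \<in> U then -1 else 1 :: real"
  have sq: "prod ?s (S \<inter> T) * prod ?s (S \<inter> T) = 1"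
    unfolding prod.distrib[symmetric] by (intro prod.neutral) auto
  have "walsh U S = prod ?s (S - T) * prod ?s (S \<inter> T)"
    unfolding walsh_def using assms prod.Int_Diff[of S ?s T] by (simp add: mult.commute)
  moreover have "walsh U T = prod ?s (T - S) * prod ?s (S \<inter> T)"
    unfolding walsh_def using assms prod.Int_Diff[of T ?s S] by (simp add: mult.commute Int_commute)
  moreover have "walsh U (sdiff S T) = prod ?s (S - T) * prod ?s (T - S)"
    unfolding walsh_def sdiff_def using assms by (intro prod.union_disjoint) auto
  ultimately have "walsh U S * walsh U T = walsh U (sdiff S T) * (prod ?s (S \<inter> T) * prod ?s (S \<inter> T))"
    by (simp add: mult_ac)
  then show ?thesis using sq by simp
qed

lemma finite_sdiff: "finite S \<Longrightarrow> finite T \<Longrightarrow> finite (sdiff S T)"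
  by (simp add: sdiff_def)

lemma card_sdiff_le:
  assumes "finite S" "finite T" shows "card (sdiff S T) \<le> card S + card T"
  unfolding sdiff_def using assms
  by (intro order_trans[OF card_Un_le] add_mono card_mono) auto

lemma sum_Pow_insert:
  fixes F :: "'i set \<Rightarrow> 'a :: comm_monoid_add"
  assumes "finite I" "i \<notin> I"
  shows "(\<Sum>U\<in>Pow (insert i I). F U) = (\<Sum>U\<in>Pow I. F U + F (insert i U))"
proof -
  have "(\<Sum>U\<in>Pow (insert i I). F U) = (\<Sum>U\<in>Pow I. F U) + (\<Sum>U\<in>insert i ` Pow I. F U)"
    unfolding Pow_insert using assms by (intro sum.union_disjoint) auto
  also have "(\<Sum>U\<in>insert i ` Pow I. F U) = (\<Sum>U\<in>Pow I. F (insert i U))"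
    using assms by (subst sum.reindex) (auto intro!: inj_onI)
  finally show ?thesis by (simp add: sum.distrib)
qed

lemma walsh_insert_notin: "i \<notin> S \<Longrightarrow> walsh (insert i U) S = walsh U S"
  unfolding walsh_def by (intro prod.cong) auto

lemma walsh_insert_in:
  assumes "finite S" "i \<in> S" "i \<notin> U"
  shows "walsh (insert i U) S = - walsh U S"
proof -
  have "walsh V S = (if i \<in> V then -1 else 1) * walsh V (S - {i})" for V
    unfolding walsh_def using assms by (simp add: prod.remove)
  then show ?thesis using assms walsh_insert_notin[of i "S - {i}" U] by simp
qed

text \<open>If the sets differ, inserting or removing an element of their symmetric difference
  negates the summand, so the subsets \<open>U\<close> cancel in pairs.\<close>

lemma sum_walsh_orthogonal:
  assumes I: "finite I" and S: "S \<subseteq> I" and T: "T \<subseteq> I"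
  shows "(\<Sum>U\<in>Pow I. walsh U S * walsh U T) = (if S = T then 2 ^ card I else 0)"
proof -
  have fin: "finite S" "finite T" using assms finite_subset by auto
  have eq: "walsh U S * walsh U T = walsh U (sdiff S T)" for U
    using walsh_sdiff[OF fin] by simp
  show ?thesis
  proof (cases "S = T")
    case True
    then have "sdiff S T = {}" by (simp add: sdiff_def)
    then show ?thesis using True I unfolding eq by (simp add: walsh_def card_Pow)
  next
    case False
    then obtain i where i: "i \<in> sdiff S T" by (auto simp: sdiff_def)
    then have "i \<in> I" using S T by (auto simp: sdiff_def)
    then have I': "I = insert i (I - {i})" by auto
    have "(\<Sum>U\<in>Pow I. walsh U (sdiff S T)) = (\<Sum>U\<in>Pow (I - {i}). walsh U (sdiff S T) + walsh (insert i U) (sdiff S T))"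
      by (subst I', rule sum_Pow_insert) (use I in auto)
    also have "\<dots> = 0"
      using i fin by (intro sum.neutral ballI) (subst walsh_insert_in, auto simp: finite_sdiff)
    finally show ?thesis using False unfolding eq by simp
  qed
qed

text \<open>Bonami's hypercontractive inequality between the second and the fourth moment.\<close>

lemma bonami:
  fixes b :: "'x \<Rightarrow> real" and S :: "'x \<Rightarrow> 'i set"
  assumes "finite I" "finite X" "\<And>x. x \<in> X \<Longrightarrow> S x \<subseteq> I \<and> card (S x) \<le> d"
  shows "2 ^ card I * (\<Sum>U\<in>Pow I. (\<Sum>x\<in>X. b x * walsh U (S x)) ^ 4)
    \<le> 9 ^ d * (\<Sum>U\<in>Pow I. (\<Sum>x\<in>X. b x * walsh U (S x))\<^sup>2)\<^sup>2"
  using assms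
proof (induction I arbitrary: X S d rule: finite_induct)
  case empty
  then have "(\<Sum>x\<in>X. b x * walsh {} (S x)) ^ 4 * 1 \<le> (\<Sum>x\<in>X. b x * walsh {} (S x)) ^ 4 * 9 ^ d"
    by (intro mult_left_mono) auto
  then show ?case by (simp add: power_mult[symmetric] mult.commute)
next
  case (insert i I)
  define X0 where "X0 = {x \<in> X. i \<notin> S x}"
  define X1 where "X1 = {x \<in> X. i \<in> S x}"
  define S' where "S' x = S x - {i}" for x
  \<comment> \<open>\<open>g\<close> collects the characters that avoid \<open>i\<close>, and
    \<open>h\<close> is the cofactor of the sign of \<open>i\<close>. The polynomial is thus
    \<open>g + h\<close> or \<open>g - h\<close>, and \<open>h\<close> has degree at most
    \<open>d - 1\<close>.\<close>
  define g where "g U = (\<Sum>x\<in>X0. b x * walsh U (S x))" for U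
  define h where "h U = (\<Sum>x\<in>X1. b x * walsh U (S' x))" for U
  let ?f = "\<lambda>U. \<Sum>x\<in>X. b x * walsh U (S x)"
  have fin: "finite X0" "finite X1" "X0 \<inter> X1 = {}" "X = X0 \<union> X1"
    using insert.prems by (auto simp: X0_def X1_def)
  have finS: "finite (S x)" if "x \<in> X" for x
    using insert.prems(2)[OF that] insert.hyps(1) finite_subset by blast
  have split: "?f U = (\<Sum>x\<in>X0. b x * walsh U (S x)) + (\<Sum>x\<in>X1. b x * walsh U (S x))" for U
    using fin sum.union_disjoint[OF fin(1-3), of "\<lambda>x. b x * walsh U (S x)"] by simp
  have w: "walsh V (S x) = (if i \<in> V then -1 else 1) * walsh V (S' x)" if "x \<in> X1" for V x
  proof -
    have "finite (S x)" "i \<in> S x" using that finS by (auto simp: X1_def)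
    then show ?thesis unfolding walsh_def S'_def by (rule prod.remove)
  qed
  have fU: "?f U = g U + h U" "?f (insert i U) = g U - h U" if "U \<in> Pow I" for U
  proof -
    have "i \<notin> U" using that insert.hyps by auto
    then show "?f U = g U + h U"
      unfolding split g_def h_def using w[of _ U] by simp
    have "(\<Sum>x\<in>X1. b x * walsh (insert i U) (S x)) = (\<Sum>x\<in>X1. - (b x * walsh U (S' x)))"
      using w[of _ "insert i U"] by (intro sum.cong) (auto simp: S'_def walsh_insert_notin)
    moreover have "(\<Sum>x\<in>X0. b x * walsh (insert i U) (S x)) = g U"
      unfolding g_def by (intro sum.cong) (auto simp: X0_def walsh_insert_notin)
    ultimately show "?f (insert i U) = g U - h U"
      unfolding split h_def by (simp add: sum_negf)
  qed
  define G where "G = (\<Sum>U\<in>Pow I. (g U)\<^sup>2)"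
  define H where "H = (\<Sum>U\<in>Pow I. (h U)\<^sup>2)"
  define c where "c = (2::real) ^ card I"
  have GH: "G \<ge> 0" "H \<ge> 0" "c > 0" by (auto simp: G_def H_def c_def sum_nonneg)
  have s4: "(\<Sum>U\<in>Pow (insert i I). ?f U ^ 4) =
      2 * ((\<Sum>U\<in>Pow I. g U ^ 4) + 6 * (\<Sum>U\<in>Pow I. (g U)\<^sup>2 * (h U)\<^sup>2) + (\<Sum>U\<in>Pow I. h U ^ 4))"
  proof -
    have "(\<Sum>U\<in>Pow (insert i I). ?f U ^ 4) = (\<Sum>U\<in>Pow I. (g U + h U) ^ 4 + (g U - h U) ^ 4)"
      using sum_Pow_insert[OF insert.hyps, of "\<lambda>U. ?f U ^ 4"] fU by simp
    also have "\<dots> = (\<Sum>U\<in>Pow I. 2 * (g U ^ 4 + 6 * ((g U)\<^sup>2 * (h U)\<^sup>2) + h U ^ 4))"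
      by (intro sum.cong refl) (simp add: power2_eq_square power4_eq_xxxx algebra_simps)
    finally show ?thesis
      by (simp add: sum_distrib_left[symmetric] sum.distrib)
  qed
  have s2: "(\<Sum>U\<in>Pow (insert i I). (?f U)\<^sup>2) = 2 * (G + H)"
  proof -
    have "(\<Sum>U\<in>Pow (insert i I). (?f U)\<^sup>2) = (\<Sum>U\<in>Pow I. (g U + h U)\<^sup>2 + (g U - h U)\<^sup>2)"
      using sum_Pow_insert[OF insert.hyps, of "\<lambda>U. (?f U)\<^sup>2"] fU by simp
    also have "\<dots> = (\<Sum>U\<in>Pow I. 2 * ((g U)\<^sup>2 + (h U)\<^sup>2))"
      by (intro sum.cong refl) (simp add: power2_eq_square algebra_simps)
    finally show ?thesis
      by (simp add: sum_distrib_left[symmetric] sum.distrib G_def H_def)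
  qed
  have g4: "c * (\<Sum>U\<in>Pow I. g U ^ 4) \<le> 9 ^ d * G\<^sup>2"
    unfolding c_def G_def g_def
  proof (rule insert.IH)
    show "S x \<subseteq> I \<and> card (S x) \<le> d" if "x \<in> X0" for x
      using insert.prems(2)[of x] that by (auto simp: X0_def)
  qed (rule fin)
  have main: "c * ((\<Sum>U\<in>Pow I. g U ^ 4) + 6 * (\<Sum>U\<in>Pow I. (g U)\<^sup>2 * (h U)\<^sup>2) + (\<Sum>U\<in>Pow I. h U ^ 4))
      \<le> 9 ^ d * (G + H)\<^sup>2"
  proof (cases "X1 = {}")
    case True
    then have "h U = 0" for U by (simp add: h_def)
    then show ?thesis using g4 by (simp add: H_def)
  next
    case False
    then obtain x where x: "x \<in> X1" by auto
    then have "card (S x) > 0" using finS[of x] by (auto simp: X1_def card_gt_0_iff)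
    then have d: "d = Suc (d - 1)" using insert.prems(2)[of x] x by (auto simp: X1_def)
    define e where "e = (9::real) ^ (d - 1)"
    have e: "9 ^ d = 9 * e" "e > 0" using d by (simp_all add: e_def flip: power_Suc)
    have h4: "c * (\<Sum>U\<in>Pow I. h U ^ 4) \<le> e * H\<^sup>2"
      unfolding c_def H_def h_def e_def
    proof (rule insert.IH)
      show "S' x \<subseteq> I \<and> card (S' x) \<le> d - 1" if "x \<in> X1" for x
        using insert.prems(2)[of x] that finS[of x] by (auto simp: X1_def S'_def card_Diff_singleton)
    qed (rule fin)
    \<comment> \<open>Under Cauchy-Schwarz the inductive constants 9^d and 9^(d-1) combine to
      \<open>3 * e\<close>. Six times this is 2 times 9^d, exactly the cross term of
      \<open>9 ^ d * (G + H)\<^sup>2\<close>; this fixes the base 9.\<close>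
    have gh: "c * (\<Sum>U\<in>Pow I. (g U)\<^sup>2 * (h U)\<^sup>2) \<le> 3 * e * G * H"
    proof (rule power2_le_imp_le)
      have "(\<Sum>U\<in>Pow I. (g U)\<^sup>2 * (h U)\<^sup>2)\<^sup>2 \<le> (\<Sum>U\<in>Pow I. ((g U)\<^sup>2)\<^sup>2) * (\<Sum>U\<in>Pow I. ((h U)\<^sup>2)\<^sup>2)"
        by (rule Cauchy_Schwarz_ineq_sum)
      then have "(c * (\<Sum>U\<in>Pow I. (g U)\<^sup>2 * (h U)\<^sup>2))\<^sup>2 \<le>
          (c * (\<Sum>U\<in>Pow I. g U ^ 4)) * (c * (\<Sum>U\<in>Pow I. h U ^ 4))"
        using GH by (simp add: power_mult[symmetric] power_mult_distrib power2_eq_square[of c] mult_ac)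
      also have "\<dots> \<le> (9 ^ d * G\<^sup>2) * (e * H\<^sup>2)"
        using GH e by (intro mult_mono g4 h4 mult_nonneg_nonneg sum_nonneg) auto
      also have "\<dots> = (3 * e * G * H)\<^sup>2"
        by (simp add: e power_mult_distrib power2_eq_square)
      finally show "(c * (\<Sum>U\<in>Pow I. (g U)\<^sup>2 * (h U)\<^sup>2))\<^sup>2 \<le> (3 * e * G * H)\<^sup>2" .
      show "0 \<le> 3 * e * G * H" using GH e by simp
    qed
    have "c * ((\<Sum>U\<in>Pow I. g U ^ 4) + 6 * (\<Sum>U\<in>Pow I. (g U)\<^sup>2 * (h U)\<^sup>2) + (\<Sum>U\<in>Pow I. h U ^ 4)) =
        c * (\<Sum>U\<in>Pow I. g U ^ 4) + 6 * (c * (\<Sum>U\<in>Pow I. (g U)\<^sup>2 * (h U)\<^sup>2)) + c * (\<Sum>U\<in>Pow I. h U ^ 4)"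
      by (simp add: distrib_left)
    also have "\<dots> \<le> 9 ^ d * G\<^sup>2 + 6 * (3 * e * G * H) + e * H\<^sup>2"
      by (intro add_mono mult_left_mono g4 gh h4) auto
    also have "\<dots> \<le> 9 ^ d * G\<^sup>2 + 6 * (3 * e * G * H) + 9 * (e * H\<^sup>2)"
      using e by simp
    also have "\<dots> = 9 ^ d * (G + H)\<^sup>2"
      unfolding e by (simp add: power2_eq_square algebra_simps)
    finally show ?thesis .
  qed
  have "2 ^ card (insert i I) * (\<Sum>U\<in>Pow (insert i I). ?f U ^ 4) =
      4 * (c * ((\<Sum>U\<in>Pow I. g U ^ 4) + 6 * (\<Sum>U\<in>Pow I. (g U)\<^sup>2 * (h U)\<^sup>2) + (\<Sum>U\<in>Pow I. h U ^ 4)))"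
    using insert.hyps unfolding s4 by (simp add: c_def)
  also have "\<dots> \<le> 4 * (9 ^ d * (G + H)\<^sup>2)"
    using main by simp
  also have "\<dots> = 9 ^ d * (\<Sum>U\<in>Pow (insert i I). (?f U)\<^sup>2)\<^sup>2"
    unfolding s2 power_mult_distrib by simp
  finally show ?case .
qed

definition sign_avg :: "'i set \<Rightarrow> ('i set \<Rightarrow> real) \<Rightarrow> real" where
  "sign_avg I f = (\<Sum>U\<in>Pow I. f U) / 2 ^ card I"

lemma sign_avg_bonami:
  fixes b :: "'x \<Rightarrow> real" and S :: "'x \<Rightarrow> 'i set"
  assumes "finite I" "finite X" "\<And>x. x \<in> X \<Longrightarrow> S x \<subseteq> I \<and> card (S x) \<le> d"
  shows "sign_avg I (\<lambda>U. (\<Sum>x\<in>X. b x * walsh U (S x)) ^ 4)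
    \<le> 9 ^ d * (sign_avg I (\<lambda>U. (\<Sum>x\<in>X. b x * walsh U (S x))\<^sup>2))\<^sup>2"
proof -
  define c where "c = (2::real) ^ card I"
  have c: "c > 0" by (simp add: c_def)
  have "c * (\<Sum>U\<in>Pow I. (\<Sum>x\<in>X. b x * walsh U (S x)) ^ 4) / c\<^sup>2
      \<le> 9 ^ d * (\<Sum>U\<in>Pow I. (\<Sum>x\<in>X. b x * walsh U (S x))\<^sup>2)\<^sup>2 / c\<^sup>2"
    using c bonami[OF assms, where b = b] unfolding c_def by (intro divide_right_mono) auto
  then show ?thesis
    using c unfolding sign_avg_def c_def[symmetric] by (simp add: power_divide power2_eq_square)
qed

text \<open>The fourth-moment inequality is used twice: for the polynomial itself (degree 4, cost
  9^4) and for its square (degree 8, cost 9^8), together 9^8 times (9^4)^2. A fourth moment would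
  only yield decay N^(-2), which the weight in \<open>flat_event_weight\<close> would
  consume.\<close>

lemma sign_avg_eighth_moment:
  fixes b :: "'x \<Rightarrow> real" and S :: "'x \<Rightarrow> 'i set"
  assumes I: "finite I" "finite X" and S: "\<And>x. x \<in> X \<Longrightarrow> S x \<subseteq> I \<and> card (S x) \<le> 4"
  shows "sign_avg I (\<lambda>U. (\<Sum>x\<in>X. b x * walsh U (S x)) ^ 8)
    \<le> 9 ^ 16 * (sign_avg I (\<lambda>U. (\<Sum>x\<in>X. b x * walsh U (S x))\<^sup>2)) ^ 4"
proof -
  let ?f = "\<lambda>U. \<Sum>x\<in>X. b x * walsh U (S x)"
  have fin: "finite (S x)" if "x \<in> X" for x using S[OF that] I finite_subset by blast
  have sq: "(?f U)\<^sup>2 = (\<Sum>p\<in>X \<times> X. (b (fst p) * b (snd p)) * walsh U (sdiff (S (fst p)) (S (snd p))))" for U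
    unfolding power2_eq_square sum_product sum.cartesian_product
    by (intro sum.cong) (auto simp: walsh_sdiff fin)
  have "sign_avg I (\<lambda>U. ((?f U)\<^sup>2) ^ 4) \<le> 9 ^ 8 * (sign_avg I (\<lambda>U. ((?f U)\<^sup>2)\<^sup>2))\<^sup>2"
    unfolding sq
  proof (rule sign_avg_bonami)
    fix p assume "p \<in> X \<times> X"
    then have p: "fst p \<in> X" "snd p \<in> X" by auto
    show "sdiff (S (fst p)) (S (snd p)) \<subseteq> I \<and> card (sdiff (S (fst p)) (S (snd p))) \<le> 8"
      using S[OF p(1)] S[OF p(2)] card_sdiff_le[OF fin[OF p(1)] fin[OF p(2)]]
      by (auto simp: sdiff_def)
  qed (use I in auto)
  also have "\<dots> \<le> 9 ^ 8 * (9 ^ 4 * (sign_avg I (\<lambda>U. (?f U)\<^sup>2))\<^sup>2)\<^sup>2"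
    proof (intro mult_left_mono power_mono)
    show "sign_avg I (\<lambda>U. ((?f U)\<^sup>2)\<^sup>2) \<le> 9 ^ 4 * (sign_avg I (\<lambda>U. (?f U)\<^sup>2))\<^sup>2"
      using sign_avg_bonami[OF I S, where b = b] by (simp add: power_mult[symmetric])
  qed (auto simp: sign_avg_def sum_nonneg)
  finally show ?thesis
    by (simp add: power_mult[symmetric] power_mult_distrib)
qed

text \<open>Characters of distinct sets are orthogonal. A product of two coefficients with the same
  set is split by the arithmetic-geometric mean inequality, and every index has at most
  \<open>K\<close> partners.\<close>

lemma sign_avg_second_moment_le:
  fixes b :: "'x \<Rightarrow> real" and S :: "'x \<Rightarrow> 'i set"
  assumes I: "finite I" "finite X" and S: "\<And>x. x \<in> X \<Longrightarrow> S x \<subseteq> I"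
    and K: "\<And>x. x \<in> X \<Longrightarrow> card {y \<in> X. S y = S x} \<le> K"
  shows "sign_avg I (\<lambda>U. (\<Sum>x\<in>X. b x * walsh U (S x))\<^sup>2) \<le> real K * (\<Sum>x\<in>X. (b x)\<^sup>2)"
proof -
  have count: "(\<Sum>y\<in>X. if S y = S x then c else 0) \<le> real K * c" if "x \<in> X" "c \<ge> 0" for x c
  proof -
    have "(\<Sum>y\<in>X. if S y = S x then c else 0) = (\<Sum>y\<in>{y \<in> X. S y = S x}. c)"
      using I by (intro sum.inter_filter[symmetric])
    also have "\<dots> \<le> real K * c"
      using K[OF that(1)] that(2) by (simp add: mult_right_mono)
    finally show ?thesis .
  qed
  have "(\<Sum>U\<in>Pow I. (\<Sum>x\<in>X. b x * walsh U (S x))\<^sup>2) =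
      (\<Sum>U\<in>Pow I. \<Sum>x\<in>X. \<Sum>y\<in>X. (b x * b y) * (walsh U (S x) * walsh U (S y)))"
    by (simp add: power2_eq_square sum_product mult_ac)
  also have "\<dots> = (\<Sum>x\<in>X. \<Sum>y\<in>X. (b x * b y) * (\<Sum>U\<in>Pow I. walsh U (S x) * walsh U (S y)))"
    unfolding sum_distrib_left by (subst sum.swap, intro sum.cong refl, rule sum.swap)
  also have "\<dots> = (\<Sum>x\<in>X. \<Sum>y\<in>X. 2 ^ card I * (if S y = S x then b x * b y else 0))"
    using S I by (intro sum.cong refl) (auto simp: sum_walsh_orthogonal)
  also have "\<dots> \<le> (\<Sum>x\<in>X. \<Sum>y\<in>X. 2 ^ card I * ((if S y = S x then (b x)\<^sup>2 / 2 else 0) + (if S x = S y then (b y)\<^sup>2 / 2 else 0)))"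
  proof (intro sum_mono mult_left_mono)
    fix x y
    have "b x * b y \<le> (b x)\<^sup>2 / 2 + (b y)\<^sup>2 / 2"
      using sum_squares_bound[of "b x" "b y"] by simp
    then show "(if S y = S x then b x * b y else 0) \<le> (if S y = S x then (b x)\<^sup>2 / 2 else 0) + (if S x = S y then (b y)\<^sup>2 / 2 else 0)"
      by auto
  qed auto
  also have "\<dots> = 2 ^ card I * ((\<Sum>x\<in>X. \<Sum>y\<in>X. if S y = S x then (b x)\<^sup>2 / 2 else 0) +
      (\<Sum>x\<in>X. \<Sum>y\<in>X. if S x = S y then (b y)\<^sup>2 / 2 else 0))"
    by (simp add: sum_distrib_left sum.distrib distrib_left)
  also have "(\<Sum>x\<in>X. \<Sum>y\<in>X. if S x = S y then (b y)\<^sup>2 / 2 else 0) = (\<Sum>x\<in>X. \<Sum>y\<in>X. if S y = S x then (b x)\<^sup>2 / 2 else 0)"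
    by (rule sum.swap)
  also have "2 ^ card I * ((\<Sum>x\<in>X. \<Sum>y\<in>X. if S y = S x then (b x)\<^sup>2 / 2 else 0) + \<dots>) \<le>
      2 ^ card I * ((\<Sum>x\<in>X. real K * ((b x)\<^sup>2 / 2)) + (\<Sum>x\<in>X. real K * ((b x)\<^sup>2 / 2)))"
    by (intro mult_left_mono add_mono sum_mono count) auto
  also have "\<dots> = 2 ^ card I * (real K * (\<Sum>x\<in>X. (b x)\<^sup>2))"
    by (simp add: sum.distrib[symmetric] sum_distrib_left)
  finally show ?thesis
    unfolding sign_avg_def by (simp add: divide_le_eq mult.commute)
qed

section \<open>Averages over roots of unity\<close>

definition uroot :: "nat \<Rightarrow> nat \<Rightarrow> complex" where
  "uroot Q r = exp (2 * of_real pi * \<i> * of_nat r / of_nat Q)"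

text \<open>A discrete substitute for the mean over the circle, exact once all exponents that occur
  are below \<open>Q\<close>; circle averages become finite sums, which commute with every integral.
  The value type is general so that real and complex functions share one notion.\<close>

definition root_avg :: "nat \<Rightarrow> (complex \<Rightarrow> 'a :: real_normed_field) \<Rightarrow> 'a" where
  "root_avg Q F = (\<Sum>r<Q. F (uroot Q r)) / of_nat Q"

lemma norm_uroot [simp]: "cmod (uroot Q r) = 1"
proof -
  have "2 * of_real pi * \<i> * of_nat r / of_nat Q = \<i> * complex_of_real (2 * pi * real r / real Q)"
    by simp
  then show ?thesis unfolding uroot_def by (simp only: norm_exp_i_times)
qed

text \<open>At the \<open>r\<close>-th root the product is the \<open>r\<close>-th power of one
  fixed \<open>Q\<close>-th root of unity, which is not 1 when the exponents differ, so the
  geometric sum vanishes.\<close>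

lemma root_avg_char:
  assumes "a < Q" "b < Q"
  shows "root_avg Q (\<lambda>\<zeta>. \<zeta> ^ a * cnj \<zeta> ^ b) = (if a = b then 1 else (0 :: complex))"
proof -
  have Q: "Q > 0" using assms by simp
  define \<omega> where "\<omega> = uroot Q a * cnj (uroot Q b)"
  have pow: "uroot Q r ^ k = uroot Q k ^ r" for r k
    unfolding uroot_def exp_of_nat_mult[symmetric] by (rule arg_cong[where f = exp]) simp
  have "uroot Q r ^ a * cnj (uroot Q r) ^ b = \<omega> ^ r" for r
    unfolding \<omega>_def power_mult_distrib complex_cnj_power[symmetric] pow[of r a] pow[of r b] ..
  then have eq: "root_avg Q (\<lambda>\<zeta>. \<zeta> ^ a * cnj \<zeta> ^ b) = (\<Sum>r<Q. \<omega> ^ r) / of_nat Q"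
    by (simp add: root_avg_def)
  have unit: "uroot Q b * cnj (uroot Q b) = 1"
    by (simp add: complex_norm_square[symmetric])
  show ?thesis
  proof (cases "a = b")
    case True
    then have "\<omega> = 1" using unit by (simp add: \<omega>_def)
    then show ?thesis using True Q eq by simp
  next
    case False
    have "\<omega> \<noteq> 1"
    proof
      assume "\<omega> = 1"
      then have "uroot Q a = uroot Q b"
      proof -
        have "uroot Q a = uroot Q a * (uroot Q b * cnj (uroot Q b))" unfolding unit by simp
        also have "\<dots> = \<omega> * uroot Q b" by (simp add: \<omega>_def)
        finally show ?thesis using \<open>\<omega> = 1\<close> by simp
      qed
      then have "a mod Q = b mod Q"
        using complex_root_unity_eq[of Q a b] Q by (simp add: uroot_def)
      then show False using assms False by simp
    qed
    moreover have "\<omega> ^ Q = 1"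
    proof -
      have "uroot Q k ^ Q = 1" for k
        using Q unfolding uroot_def by (intro complex_root_unity) simp
      then show ?thesis unfolding \<omega>_def power_mult_distrib complex_cnj_power[symmetric] by simp
    qed
    ultimately have "(\<Sum>r<Q. \<omega> ^ r) = 0" by (simp add: sum_gp_strict)
    then show ?thesis using False eq by simp
  qed
qed

lemma root_avg_sum:
  assumes "\<And>x. x \<in> X \<Longrightarrow> e x < Q \<and> f x < Q" "finite X"
  shows "root_avg Q (\<lambda>\<zeta>. \<Sum>x\<in>X. k x * (\<zeta> ^ e x * cnj \<zeta> ^ f x)) = (\<Sum>x\<in>{x \<in> X. e x = f x}. k x)"
proof -
  have "root_avg Q (\<lambda>\<zeta>. \<Sum>x\<in>X. k x * (\<zeta> ^ e x * cnj \<zeta> ^ f x)) =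
      (\<Sum>x\<in>X. k x * root_avg Q (\<lambda>\<zeta>. \<zeta> ^ e x * cnj \<zeta> ^ f x))"
    unfolding root_avg_def sum_distrib_left times_divide_eq_right[symmetric] sum_divide_distrib
    by (subst sum.swap) (simp add: sum_distrib_left)
  also have "\<dots> = (\<Sum>x\<in>X. if e x = f x then k x else 0)"
    using assms(1) by (intro sum.cong refl) (simp add: root_avg_char)
  finally show ?thesis using assms(2) by (simp add: sum.inter_filter)
qed

lemma root_avg_of_real: "complex_of_real (root_avg Q F) = root_avg Q (\<lambda>\<zeta>. complex_of_real (F \<zeta>))"
  by (simp add: root_avg_def)

lemma root_avg_mono:
  assumes "\<And>r. r < Q \<Longrightarrow> F (uroot Q r) \<le> (G (uroot Q r) :: real)"
  shows "root_avg Q F \<le> root_avg Q G"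
  using assms unfolding root_avg_def by (intro divide_right_mono sum_mono) auto

lemma root_avg_const: "Q > 0 \<Longrightarrow> root_avg Q (\<lambda>_. c) = c"
  by (simp add: root_avg_def)

lemma root_avg_add: "root_avg Q (\<lambda>\<zeta>. F \<zeta> + G \<zeta>) = root_avg Q F + root_avg Q G"
  by (simp add: root_avg_def sum.distrib add_divide_distrib)

lemma root_avg_cmult: "root_avg Q (\<lambda>\<zeta>. c * F \<zeta>) = c * root_avg Q F"
  by (simp add: root_avg_def sum_distrib_left)

definition trig_poly :: "'i set \<Rightarrow> ('i \<Rightarrow> nat) \<Rightarrow> ('i \<Rightarrow> complex) \<Rightarrow> complex \<Rightarrow> complex" where
  "trig_poly L l c \<zeta> = (\<Sum>\<alpha>\<in>L. c \<alpha> * \<zeta> ^ l \<alpha>)"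

lemma trig_poly_norm_square:
  "complex_of_real ((cmod (trig_poly L l c \<zeta>))\<^sup>2) =
    (\<Sum>x\<in>L \<times> L. (c (fst x) * cnj (c (snd x))) * (\<zeta> ^ l (fst x) * cnj \<zeta> ^ l (snd x)))"
  unfolding complex_norm_square trig_poly_def cnj_sum sum_product sum.cartesian_product
  by (intro sum.cong) (auto simp: mult_ac)

lemma root_avg_norm_square:
  assumes L: "finite L" "inj_on l L" and Q: "\<And>\<alpha>. \<alpha> \<in> L \<Longrightarrow> l \<alpha> < Q"
  shows "root_avg Q (\<lambda>\<zeta>. (cmod (trig_poly L l c \<zeta>))\<^sup>2) = (\<Sum>\<alpha>\<in>L. (cmod (c \<alpha>))\<^sup>2)"
proof -
  have "complex_of_real (root_avg Q (\<lambda>\<zeta>. (cmod (trig_poly L l c \<zeta>))\<^sup>2)) =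
      (\<Sum>x\<in>{x \<in> L \<times> L. l (fst x) = l (snd x)}. c (fst x) * cnj (c (snd x)))"
    unfolding root_avg_of_real trig_poly_norm_square using L Q by (intro root_avg_sum) auto
  also have "{x \<in> L \<times> L. l (fst x) = l (snd x)} = (\<lambda>\<alpha>. (\<alpha>, \<alpha>)) ` L"
    using L by (auto dest: inj_onD)
  also have "(\<Sum>x\<in>(\<lambda>\<alpha>. (\<alpha>, \<alpha>)) ` L. c (fst x) * cnj (c (snd x))) = (\<Sum>\<alpha>\<in>L. c \<alpha> * cnj (c \<alpha>))"
    by (subst sum.reindex) (auto intro: inj_onI)
  also have "\<dots> = complex_of_real (\<Sum>\<alpha>\<in>L. (cmod (c \<alpha>))\<^sup>2)"
    unfolding of_real_sum complex_norm_square ..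
  finally show ?thesis by (simp only: of_real_eq_iff)
qed

text \<open>The nonnegative function \<open>H - |p|\<^sup>2\<close> has mean \<open>H - S\<close>, which therefore dominates all its
  other Fourier coefficients; the extreme one is a single product.\<close>

lemma extreme_coefficients_bound:
  assumes L: "finite L" "inj_on l L" and Q: "\<And>\<alpha>. \<alpha> \<in> L \<Longrightarrow> 2 * l \<alpha> < Q"
    and a: "a \<in> L" "\<And>\<alpha>. \<alpha> \<in> L \<Longrightarrow> l \<alpha> \<le> l a" and b: "b \<in> L" "\<And>\<alpha>. \<alpha> \<in> L \<Longrightarrow> l b \<le> l \<alpha>"
    and ab: "a \<noteq> b"
    and H: "\<And>r. r < Q \<Longrightarrow> (cmod (trig_poly L l c (uroot Q r)))\<^sup>2 \<le> H"
  shows "cmod (c a) * cmod (c b) \<le> H - (\<Sum>\<alpha>\<in>L. (cmod (c \<alpha>))\<^sup>2)"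
proof -
  have Q0: "Q > 0" using Q[OF a(1)] by simp
  have lab: "l a \<noteq> l b" using L a b ab by (auto dest: inj_onD)
  define p where "p \<zeta> = trig_poly L l c \<zeta>" for \<zeta>
  define ch where "ch \<zeta> = \<zeta> ^ l b * cnj \<zeta> ^ l a" for \<zeta> :: complex
  have sum2: "l \<alpha> + l \<beta> < Q" if "\<alpha> \<in> L" "\<beta> \<in> L" for \<alpha> \<beta> using Q[OF that(1)] Q[OF that(2)] by simp
  have "root_avg Q (\<lambda>\<zeta>. of_real ((cmod (p \<zeta>))\<^sup>2) * ch \<zeta>) =
      root_avg Q (\<lambda>\<zeta>. \<Sum>x\<in>L \<times> L. (c (fst x) * cnj (c (snd x))) *
        (\<zeta> ^ (l (fst x) + l b) * cnj \<zeta> ^ (l (snd x) + l a)))"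
    unfolding p_def trig_poly_norm_square ch_def sum_distrib_right
    by (intro arg_cong[where f = "root_avg Q"] ext sum.cong refl) (simp add: power_add mult_ac)
  also have "\<dots> = (\<Sum>x\<in>{x \<in> L \<times> L. l (fst x) + l b = l (snd x) + l a}. c (fst x) * cnj (c (snd x)))"
    using L sum2 a(1) b(1) by (intro root_avg_sum) auto
  \<comment> \<open>Since \<open>l a\<close> is maximal and \<open>l b\<close> minimal, the left
    side never exceeds the right side, and equality forces equality in both coordinates. So a single
    product of coefficients survives.\<close>
  also have "{x \<in> L \<times> L. l (fst x) + l b = l (snd x) + l a} = {(a, b)}"
  proof -
    have "\<alpha> = a \<and> \<beta> = b" if "\<alpha> \<in> L" "\<beta> \<in> L" "l \<alpha> + l b = l \<beta> + l a" for \<alpha> \<beta>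
    proof -
      have "l \<alpha> = l a" "l \<beta> = l b" using a(2)[OF that(1)] b(2)[OF that(2)] that(3) by auto
      then show ?thesis using that L a b by (auto dest: inj_onD)
    qed
    then show ?thesis using a(1) b(1) by auto
  qed
  finally have 1: "root_avg Q (\<lambda>\<zeta>. of_real ((cmod (p \<zeta>))\<^sup>2) * ch \<zeta>) = c a * cnj (c b)" by simp
  have 2: "root_avg Q ch = 0"
    unfolding ch_def using lab Q[OF a(1)] Q[OF b(1)] by (subst root_avg_char) auto
  have "root_avg Q (\<lambda>\<zeta>. of_real (H - (cmod (p \<zeta>))\<^sup>2) * ch \<zeta>) =
      root_avg Q (\<lambda>\<zeta>. of_real H * ch \<zeta> + (- 1) * (of_real ((cmod (p \<zeta>))\<^sup>2) * ch \<zeta>))"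
    by (simp add: left_diff_distrib)
  also have "\<dots> = - (c a * cnj (c b))"
    unfolding root_avg_add root_avg_cmult 1 2 by simp
  finally have "cmod (c a) * cmod (c b) = cmod (root_avg Q (\<lambda>\<zeta>. of_real (H - (cmod (p \<zeta>))\<^sup>2) * ch \<zeta>))"
    by (simp add: norm_mult)
  also have "\<dots> \<le> root_avg Q (\<lambda>\<zeta>. H - (cmod (p \<zeta>))\<^sup>2)"
    unfolding root_avg_def norm_divide norm_of_nat
  proof (intro divide_right_mono sum_norm_le)
    fix r assume "r \<in> {..<Q}"
    then have "0 \<le> H - (cmod (p (uroot Q r)))\<^sup>2" using H by (simp add: p_def)
    then show "cmod (of_real (H - (cmod (p (uroot Q r)))\<^sup>2) * ch (uroot Q r)) \<le> H - (cmod (p (uroot Q r)))\<^sup>2"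
      by (simp add: norm_mult ch_def norm_power del: of_real_diff of_real_power)
  qed auto
  also have "\<dots> = root_avg Q (\<lambda>\<zeta>. H + (- 1) * (cmod (p \<zeta>))\<^sup>2)" by simp
  also have "\<dots> = H - (\<Sum>\<alpha>\<in>L. (cmod (c \<alpha>))\<^sup>2)"
    unfolding root_avg_add root_avg_cmult root_avg_const[OF Q0] p_def
    using root_avg_norm_square[OF L, of Q c] Q by fastforce
  finally show ?thesis .
qed

section \<open>The fourth moment on the circle and additive quadruples\<close>

definition quads :: "'i set \<Rightarrow> ('i \<Rightarrow> nat) \<Rightarrow> ('i \<times> 'i \<times> 'i \<times> 'i) set" where
  "quads L l = {(p, q, r, t). p \<in> L \<and> q \<in> L \<and> r \<in> L \<and> t \<in> L \<and> l p + l t = l q + l r}"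

text \<open>For injective \<open>l\<close> the excluded solutions are the diagonal ones, whose terms
  do not depend on the signs of the coefficients. The remaining ones carry all the
  fluctuation.\<close>

definition proper_quads :: "'i set \<Rightarrow> ('i \<Rightarrow> nat) \<Rightarrow> ('i \<times> 'i \<times> 'i \<times> 'i) set" where
  "proper_quads L l = {(p, q, r, t) \<in> quads L l. p \<noteq> q \<and> p \<noteq> r}"

definition quad_term :: "('i \<Rightarrow> complex) \<Rightarrow> 'i \<times> 'i \<times> 'i \<times> 'i \<Rightarrow> complex" where
  "quad_term c = (\<lambda>(p, q, r, t). c p * cnj (c q) * cnj (c r) * c t)"

lemma finite_quads:
  assumes "finite L" shows "finite (quads L l)" "finite (proper_quads L l)"
proof -
  show "finite (quads L l)"
    by (rule finite_subset[of _ "L \<times> L \<times> L \<times> L"]) (use assms in \<open>auto simp: quads_def\<close>)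
  then show "finite (proper_quads L l)"
    by (rule rev_finite_subset) (auto simp: proper_quads_def)
qed

text \<open>The fourth power involves sums of two frequencies. These stay below \<open>Q\<close>, so
  there is no wrap-around and the average retains exactly the true additive coincidences.\<close>

lemma root_avg_norm_power4:
  assumes L: "finite L" and Q: "\<And>\<alpha>. \<alpha> \<in> L \<Longrightarrow> 2 * l \<alpha> < Q"
  shows "root_avg Q (\<lambda>\<zeta>. (cmod (trig_poly L l c \<zeta>)) ^ 4) = Re (\<Sum>x\<in>quads L l. quad_term c x)"
proof -
  let ?X = "(L \<times> L) \<times> (L \<times> L)"
  let ?k = "\<lambda>x. (c (fst (fst x)) * cnj (c (snd (fst x)))) * (c (fst (snd x)) * cnj (c (snd (snd x))))"
  have sum2: "l \<alpha> + l \<beta> < Q" if "\<alpha> \<in> L" "\<beta> \<in> L" for \<alpha> \<beta> using Q[OF that(1)] Q[OF that(2)] by simp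
  have "complex_of_real ((cmod (trig_poly L l c \<zeta>)) ^ 4) =
      (\<Sum>x\<in>?X. ?k x * (\<zeta> ^ (l (fst (fst x)) + l (fst (snd x))) * cnj \<zeta> ^ (l (snd (fst x)) + l (snd (snd x)))))" for \<zeta>
  proof -
    have "complex_of_real ((cmod (trig_poly L l c \<zeta>)) ^ 4) =
        complex_of_real ((cmod (trig_poly L l c \<zeta>))\<^sup>2) * complex_of_real ((cmod (trig_poly L l c \<zeta>))\<^sup>2)"
      by (simp flip: power_add)
    then show ?thesis
      unfolding trig_poly_norm_square sum_product sum.cartesian_product
      by (auto intro!: sum.cong simp: power_add mult_ac)
  qed
  then have "complex_of_real (root_avg Q (\<lambda>\<zeta>. (cmod (trig_poly L l c \<zeta>)) ^ 4)) =
      root_avg Q (\<lambda>\<zeta>. \<Sum>x\<in>?X. ?k x * (\<zeta> ^ (l (fst (fst x)) + l (fst (snd x))) * cnj \<zeta> ^ (l (snd (fst x)) + l (snd (snd x)))))"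
    unfolding root_avg_of_real by simp
  also have "\<dots> = (\<Sum>x\<in>{x \<in> ?X. l (fst (fst x)) + l (fst (snd x)) = l (snd (fst x)) + l (snd (snd x))}. ?k x)"
    using L sum2 by (intro root_avg_sum) auto
  also have "\<dots> = (\<Sum>x\<in>quads L l. quad_term c x)"
    by (rule sum.reindex_bij_witness[where i = "\<lambda>(p, q, r, t). ((p, q), (t, r))" and j = "\<lambda>((p, q), (t, r)). (p, q, r, t)"])
      (auto simp: quads_def quad_term_def mult_ac)
  finally show ?thesis by (metis Re_complex_of_real)
qed

text \<open>Inclusion-exclusion over the diagonals \<open>p = q\<close>, \<open>r = t\<close> and
  \<open>p = r\<close>, \<open>q = t\<close>, which meet where all four entries coincide.
  Injectivity of \<open>l\<close> excludes any other quadruple with \<open>p = q\<close> or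
  \<open>p = r\<close>.\<close>

lemma sum_quads_split:
  assumes L: "finite L" "inj_on l L"
  shows "Re (\<Sum>x\<in>quads L l. quad_term c x) =
    2 * (\<Sum>\<alpha>\<in>L. (cmod (c \<alpha>))\<^sup>2)\<^sup>2 - (\<Sum>\<alpha>\<in>L. (cmod (c \<alpha>)) ^ 4) + (\<Sum>x\<in>proper_quads L l. Re (quad_term c x))"
proof -
  define A where "A = (\<lambda>(p, r). (p, p, r, r)) ` (L \<times> L)"
  define B where "B = (\<lambda>(p, q). (p, q, p, q)) ` (L \<times> L)"
  have AB: "finite A" "finite B" "A \<inter> B = (\<lambda>p. (p, p, p, p)) ` L"
    using L by (auto simp: A_def B_def image_iff)
  have dis: "(A \<union> B) \<inter> proper_quads L l = {}" by (auto simp: A_def B_def proper_quads_def)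
  have un: "quads L l = (A \<union> B) \<union> proper_quads L l"
  proof
    show "quads L l \<subseteq> (A \<union> B) \<union> proper_quads L l"
    proof
      fix x assume "x \<in> quads L l"
      then obtain p q r t where x: "x = (p, q, r, t)" "p \<in> L" "q \<in> L" "r \<in> L" "t \<in> L" "l p + l t = l q + l r"
        by (auto simp: quads_def)
      show "x \<in> (A \<union> B) \<union> proper_quads L l"
      proof (cases "p = q \<or> p = r")
        case True
        then have "p = q \<and> r = t \<or> p = r \<and> q = t" using x L by (auto dest: inj_onD)
        then show ?thesis using x by (auto simp: A_def B_def)
      next
        case False
        then show ?thesis using x by (auto simp: quads_def proper_quads_def)
      qed
    qed
    show "(A \<union> B) \<union> proper_quads L l \<subseteq> quads L l"
      by (auto simp: A_def B_def proper_quads_def quads_def)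
  qed
  have sq: "Re (c p * cnj (c p) * cnj (c r) * c r) = (cmod (c p))\<^sup>2 * (cmod (c r))\<^sup>2" for p r
  proof -
    have "c p * cnj (c p) * cnj (c r) * c r = complex_of_real ((cmod (c p))\<^sup>2 * (cmod (c r))\<^sup>2)"
      unfolding of_real_mult complex_norm_square by (simp only: mult_ac)
    then show ?thesis by (metis Re_complex_of_real)
  qed
  have qA: "Re (quad_term c (p, p, r, r)) = (cmod (c p))\<^sup>2 * (cmod (c r))\<^sup>2" for p r
    unfolding quad_term_def prod.case by (rule sq)
  have "quad_term c (p, q, p, q) = quad_term c (p, p, q, q)" for p q
    by (simp add: quad_term_def)
  then have qB: "Re (quad_term c (p, q, p, q)) = (cmod (c p))\<^sup>2 * (cmod (c q))\<^sup>2" for p q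
    by (simp only: qA)
  have sA: "(\<Sum>x\<in>A. Re (quad_term c x)) = (\<Sum>\<alpha>\<in>L. (cmod (c \<alpha>))\<^sup>2)\<^sup>2"
    unfolding A_def power2_eq_square[of "sum _ _"] sum_product sum.cartesian_product
    by (subst sum.reindex) (auto intro!: inj_onI sum.cong simp: qA)
  have sB: "(\<Sum>x\<in>B. Re (quad_term c x)) = (\<Sum>\<alpha>\<in>L. (cmod (c \<alpha>))\<^sup>2)\<^sup>2"
    unfolding B_def power2_eq_square[of "sum _ _"] sum_product sum.cartesian_product
    by (subst sum.reindex) (auto intro!: inj_onI sum.cong simp: qB)
  have sI: "(\<Sum>x\<in>A \<inter> B. Re (quad_term c x)) = (\<Sum>\<alpha>\<in>L. (cmod (c \<alpha>)) ^ 4)"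
    unfolding AB by (subst sum.reindex) (auto intro!: inj_onI sum.cong simp: qA simp flip: power_add)
  have "Re (\<Sum>x\<in>quads L l. quad_term c x) =
      (\<Sum>x\<in>A \<union> B. Re (quad_term c x)) + (\<Sum>x\<in>proper_quads L l. Re (quad_term c x))"
    unfolding un Re_sum using AB dis finite_quads(2)[OF L(1)] by (intro sum.union_disjoint) auto
  also have "(\<Sum>x\<in>A \<union> B. Re (quad_term c x)) =
      (\<Sum>x\<in>A. Re (quad_term c x)) + (\<Sum>x\<in>B. Re (quad_term c x)) - (\<Sum>x\<in>A \<inter> B. Re (quad_term c x))"
    using AB by (intro sum_Un) auto
  finally show ?thesis unfolding sA sB sI by simp
qed

text \<open>The entries of odd multiplicity: the sign of an entry that occurs an even number of
  times drops out of the term.\<close>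

definition quad_support :: "'i \<times> 'i \<times> 'i \<times> 'i \<Rightarrow> 'i set" where
  "quad_support = (\<lambda>(p, q, r, t). sdiff (sdiff {p} {q}) (sdiff {r} {t}))"

definition flip_signs :: "'i set \<Rightarrow> ('i \<Rightarrow> complex) \<Rightarrow> 'i \<Rightarrow> complex" where
  "flip_signs U c \<alpha> = of_real (if \<alpha> \<in> U then -1 else 1) * c \<alpha>"

lemma quad_term_flip_signs: "Re (quad_term (flip_signs U c) x) = Re (quad_term c x) * walsh U (quad_support x)"
proof -
  obtain p q r t where x: "x = (p, q, r, t)" by (cases x)
  have "walsh U (quad_support x) = walsh U {p} * walsh U {q} * (walsh U {r} * walsh U {t})"
    unfolding x quad_support_def prod.case by (simp add: walsh_sdiff finite_sdiff)
  moreover define s where "s \<alpha> = walsh U {\<alpha>}" for \<alpha>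
  moreover have "flip_signs U c \<alpha> = of_real (s \<alpha>) * c \<alpha>" for \<alpha>
    by (simp add: flip_signs_def s_def walsh_def)
  then have "quad_term (flip_signs U c) x = of_real (s p * s q * (s r * s t)) * quad_term c x"
    by (simp add: x quad_term_def)
  then have "Re (quad_term (flip_signs U c) x) = (s p * s q * (s r * s t)) * Re (quad_term c x)"
    by (simp only: Re_complex_of_real complex.sel times_complex.sel Im_complex_of_real)
  ultimately show ?thesis by (simp add: mult.commute)
qed

lemma card_quad_support: "card (quad_support x) \<le> 4"
proof -
  obtain p q r t where x: "x = (p, q, r, t)" by (cases x)
  have "quad_support x \<subseteq> {p, q, r, t}" by (auto simp: x quad_support_def sdiff_def)
  then have "card (quad_support x) \<le> card {p, q, r, t}" by (intro card_mono) auto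
  also have "\<dots> \<le> 4" by (auto simp: card_insert_if)
  finally show ?thesis .
qed

lemma finite_quad_support: "finite (quad_support x)"
  by (cases x) (auto simp: quad_support_def finite_sdiff)

text \<open>If two entries of a proper quadruple coincide they are \<open>p = t\<close> or \<open>q = r\<close>, and the
  repeated entry is then determined by the other two.\<close>

lemma card_quad_support_fibre:
  assumes L: "finite L" "inj_on l L"
  shows "card {y \<in> proper_quads L l. quad_support y = quad_support x} \<le> 288"
proof -
  define T where "T = quad_support x"
  have T: "finite T" "card T \<le> 4" using card_quad_support[of x] finite_quad_support[of x] by (auto simp: T_def)
  let ?Y = "{y \<in> proper_quads L l. quad_support y = T}"
  \<comment> \<open>The bound 288 is 4^4 + 4^2 + 4^2: quadruples with all entries in
    \<open>T\<close>, and for each of the two degenerate shapes the choice of the two entries that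
    lie in \<open>T\<close>.\<close>
  define Y1 where "Y1 = T \<times> T \<times> T \<times> T"
  define Y2 where "Y2 = {(p, q, r, t) \<in> proper_quads L l. p = t \<and> q \<in> T \<and> r \<in> T}"
  define Y3 where "Y3 = {(p, q, r, t) \<in> proper_quads L l. q = r \<and> p \<in> T \<and> t \<in> T}"
  have fin: "finite Y2" "finite Y3"
    using finite_quads(2)[OF L(1), of l] by (auto simp: Y2_def Y3_def intro: rev_finite_subset)
  have sub: "?Y \<subseteq> Y1 \<union> (Y2 \<union> Y3)"
  proof
    fix y assume y: "y \<in> ?Y"
    obtain p q r t where yy: "y = (p, q, r, t)" by (cases y)
    from y have m: "p \<in> L" "q \<in> L" "r \<in> L" "t \<in> L" "l p + l t = l q + l r" "p \<noteq> q" "p \<noteq> r"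
      and s: "sdiff (sdiff {p} {q}) (sdiff {r} {t}) = T" by (auto simp: yy proper_quads_def quads_def quad_support_def)
    have ne: "t \<noteq> q" "t \<noteq> r"
      using m L by (auto dest: inj_onD)
    have "\<not> (p = t \<and> q = r)"
    proof
      assume "p = t \<and> q = r"
      then have "l p = l q" using m(5) by auto
      then show False using m L by (auto dest: inj_onD)
    qed
    then consider "p = t" "q \<noteq> r" | "q = r" "p \<noteq> t" | "p \<noteq> t" "q \<noteq> r" by blast
    then show "y \<in> Y1 \<union> (Y2 \<union> Y3)"
    proof cases
      case 1
      then have "q \<in> T" "r \<in> T" using s m ne by (auto simp: sdiff_def)
      then show ?thesis using 1 y by (simp add: yy Y2_def)
    next
      case 2
      then have "p \<in> T" "t \<in> T" using s m ne by (auto simp: sdiff_def)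
      then show ?thesis using 2 y by (simp add: yy Y3_def)
    next
      case 3
      then have "p \<in> T" "q \<in> T" "r \<in> T" "t \<in> T" using s m ne by (auto simp: sdiff_def)
      then show ?thesis by (simp add: yy Y1_def)
    qed
  qed
  have TT: "card T * card T \<le> 16" using mult_mono[OF T(2) T(2)] by simp
  have c1: "card Y1 \<le> 256"
    using mult_mono[OF TT TT] by (simp add: Y1_def card_cartesian_product mult.assoc)
  have c2: "card Y2 \<le> 16"
  proof -
    have "card Y2 \<le> card (T \<times> T)"
    proof (rule card_inj_on_le[where f = "\<lambda>(p, q, r, t). (q, r)"])
      show "inj_on (\<lambda>(p, q, r, t). (q, r)) Y2"
        using L by (auto simp: inj_on_def Y2_def proper_quads_def quads_def)
    qed (use T in \<open>auto simp: Y2_def\<close>)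
    then show ?thesis using TT by (simp add: card_cartesian_product)
  qed
  have c3: "card Y3 \<le> 16"
  proof -
    have "card Y3 \<le> card (T \<times> T)"
    proof (rule card_inj_on_le[where f = "\<lambda>(p, q, r, t). (p, t)"])
      show "inj_on (\<lambda>(p, q, r, t). (p, t)) Y3"
        using L by (auto simp: inj_on_def Y3_def proper_quads_def quads_def)
    qed (use T in \<open>auto simp: Y3_def\<close>)
    then show ?thesis using TT by (simp add: card_cartesian_product)
  qed
  have "card ?Y \<le> card (Y1 \<union> (Y2 \<union> Y3))"
    using fin T sub by (intro card_mono) (auto simp: Y1_def)
  also have "\<dots> \<le> card Y1 + (card Y2 + card Y3)"
    by (meson card_Un_le add_left_mono order_trans)
  finally show ?thesis using c1 c2 c3 by (simp add: T_def)
qed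

text \<open>Any three entries of a quadruple determine the fourth. Splitting
  \<open>w r * w t\<close> into squares therefore leaves sums over triples, on which no constraint
  remains.\<close>

lemma sum_quads_weight_le:
  fixes w :: "'i \<Rightarrow> real"
  assumes L: "finite L" "inj_on l L" and w: "\<And>\<alpha>. w \<alpha> \<ge> 0"
  shows "(\<Sum>(p, q, r, t)\<in>proper_quads L l. w p * w q * w r * w t) \<le> (\<Sum>\<alpha>\<in>L. w \<alpha>)\<^sup>2 * (\<Sum>\<alpha>\<in>L. (w \<alpha>)\<^sup>2)"
proof -
  have tri: "(\<Sum>x\<in>proper_quads L l. F (j x)) \<le> (\<Sum>y\<in>L \<times> L \<times> L. F y)"
    if "inj_on j (proper_quads L l)" "j ` proper_quads L l \<subseteq> L \<times> L \<times> L" "\<And>y. F y \<ge> 0"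
    for F :: "'i \<times> 'i \<times> 'i \<Rightarrow> real" and j
  proof -
    have "(\<Sum>x\<in>proper_quads L l. F (j x)) = (\<Sum>y\<in>j ` proper_quads L l. F y)"
      using that by (simp add: sum.reindex)
    also have "\<dots> \<le> (\<Sum>y\<in>L \<times> L \<times> L. F y)"
      using that L by (intro sum_mono2) auto
    finally show ?thesis .
  qed
  let ?F = "\<lambda>(p, q, r). w p * w q * ((w r)\<^sup>2 / 2)"
  have "(\<Sum>(p, q, r, t)\<in>proper_quads L l. w p * w q * w r * w t) \<le>
      (\<Sum>x\<in>proper_quads L l. ?F ((\<lambda>(p, q, r, t). (p, q, r)) x) + ?F ((\<lambda>(p, q, r, t). (p, q, t)) x))"
  proof (intro sum_mono)
    fix x :: "'i \<times> 'i \<times> 'i \<times> 'i"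
    obtain p q r t where x: "x = (p, q, r, t)" by (cases x)
    have "w r * w t \<le> (w r)\<^sup>2 / 2 + (w t)\<^sup>2 / 2" using sum_squares_bound[of "w r" "w t"] by simp
    then have "(w p * w q) * (w r * w t) \<le> (w p * w q) * ((w r)\<^sup>2 / 2 + (w t)\<^sup>2 / 2)"
      using w by (intro mult_left_mono) auto
    then show "(case x of (p, q, r, t) \<Rightarrow> w p * w q * w r * w t) \<le>
        ?F ((\<lambda>(p, q, r, t). (p, q, r)) x) + ?F ((\<lambda>(p, q, r, t). (p, q, t)) x)"
      by (simp add: x distrib_left mult.assoc)
  qed
  also have "\<dots> \<le> (\<Sum>y\<in>L \<times> L \<times> L. ?F y) + (\<Sum>y\<in>L \<times> L \<times> L. ?F y)"
    unfolding sum.distrib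
  proof (intro add_mono tri)
    show "inj_on (\<lambda>(p, q, r, t). (p, q, r)) (proper_quads L l)" "inj_on (\<lambda>(p, q, r, t). (p, q, t)) (proper_quads L l)"
      using L by (auto simp: inj_on_def proper_quads_def quads_def)
  qed (auto simp: proper_quads_def quads_def w)
  also have "(\<Sum>y\<in>L \<times> L \<times> L. ?F y) = (\<Sum>p\<in>L. \<Sum>q\<in>L. \<Sum>r\<in>L. w p * w q * ((w r)\<^sup>2 / 2))"
    by (simp add: sum.cartesian_product)
  also have "\<dots> = (\<Sum>p\<in>L. \<Sum>q\<in>L. w p * w q) * ((\<Sum>r\<in>L. (w r)\<^sup>2) / 2)"
    by (simp add: sum_distrib_left[symmetric] sum_distrib_right[symmetric] sum_divide_distrib[symmetric])
  also have "(\<Sum>p\<in>L. \<Sum>q\<in>L. w p * w q) = (\<Sum>p\<in>L. w p)\<^sup>2"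
    by (simp add: power2_eq_square sum_product)
  finally show ?thesis by simp
qed

section \<open>Nearly flat polynomials\<close>

text \<open>The factors are 2^8 from Markov's inequality for the eighth power at distance S^2 / 2,
  9^16 from \<open>sign_avg_eighth_moment\<close>, and the fourth power of the fibre size in
  \<open>card_quad_support_fibre\<close>.\<close>

definition flat_const :: real where "flat_const = 2 ^ 8 * 9 ^ 16 * 288 ^ 4"

lemma flat_const_ge: "(10 / 3) ^ 4 \<le> flat_const" "flat_const > 0"
  by (simp_all add: flat_const_def power_divide)

abbreviation sum_pow :: "'i set \<Rightarrow> ('i \<Rightarrow> complex) \<Rightarrow> nat \<Rightarrow> real" where
  "sum_pow L c k \<equiv> (\<Sum>\<alpha>\<in>L. (cmod (c \<alpha>)) ^ k)"

lemma trig_poly_cong: "(\<And>\<alpha>. \<alpha> \<in> L \<Longrightarrow> c \<alpha> = d \<alpha>) \<Longrightarrow> trig_poly L l c = trig_poly L l d"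
  by (auto simp: trig_poly_def fun_eq_iff)

lemma sign_avg_mono:
  assumes "\<And>U. U \<subseteq> I \<Longrightarrow> f U \<le> g U"
  shows "sign_avg I f \<le> sign_avg I g"
  unfolding sign_avg_def using assms by (intro divide_right_mono sum_mono) auto

text \<open>For most choices of signs the fourth moment on the circle is close to its mean
  \<open>2 S\<^sup>2 - Q\<close>, where \<open>S = \<Sum>|c|\<^sup>2\<close> and \<open>Q = \<Sum>|c|\<^sup>4\<close>.\<close>

lemma flat_sign_fraction:
  assumes L: "finite L" "inj_on l L" and Q: "\<And>\<alpha>. \<alpha> \<in> L \<Longrightarrow> 2 * l \<alpha> < Q"
    and S: "sum_pow L c 2 > 0"
  shows "sign_avg L (\<lambda>U. if root_avg Q (\<lambda>\<zeta>. (cmod (trig_poly L l (flip_signs U c) \<zeta>)) ^ 4) \<le> 6 / 5 * (sum_pow L c 2)\<^sup>2 then 1 else 0)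
    \<le> flat_const * (sum_pow L c 4 / (sum_pow L c 2)\<^sup>2) ^ 4"
proof -
  define A where "A U = root_avg Q (\<lambda>\<zeta>. (cmod (trig_poly L l (flip_signs U c) \<zeta>)) ^ 4)" for U
  define b where "b x = Re (quad_term c x)" for x
  define f where "f U = (\<Sum>x\<in>proper_quads L l. b x * walsh U (quad_support x))" for U
  define S' where "S' = sum_pow L c 2"
  define Q4 where "Q4 = sum_pow L c 4"
  have norm_flip: "cmod (flip_signs U c \<alpha>) = cmod (c \<alpha>)" for U \<alpha>
    by (simp add: flip_signs_def norm_mult)
  have A: "A U = 2 * S'\<^sup>2 - Q4 + f U" for U
  proof -
    have "A U = Re (\<Sum>x\<in>quads L l. quad_term (flip_signs U c) x)"
      unfolding A_def by (rule root_avg_norm_power4[OF L(1)]) (rule Q)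
    also have "\<dots> = 2 * (\<Sum>\<alpha>\<in>L. (cmod (flip_signs U c \<alpha>))\<^sup>2)\<^sup>2 - (\<Sum>\<alpha>\<in>L. (cmod (flip_signs U c \<alpha>)) ^ 4) +
        (\<Sum>x\<in>proper_quads L l. Re (quad_term (flip_signs U c) x))"
      by (rule sum_quads_split[OF L])
    finally show ?thesis
      unfolding norm_flip quad_term_flip_signs S'_def Q4_def f_def b_def .
  qed
  have S0: "S' > 0" using S by (simp add: S'_def)
  have Q0: "Q4 \<ge> 0" by (simp add: Q4_def sum_nonneg)
  define R where "R = Q4 / S'\<^sup>2"
  have R0: "R \<ge> 0" using Q0 by (simp add: R_def)
  have "sign_avg L (\<lambda>U. if A U \<le> 6 / 5 * S'\<^sup>2 then 1 else 0) \<le> flat_const * R ^ 4"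
  \<comment> \<open>If \<open>R\<close> exceeds 3/10, the claimed bound is at least 1. Otherwise 2 -
    3/10 - 6/5 = 1/2 shows that the event forces \<open>f U\<close> below -S^2 / 2, so Markov's
    inequality applies to the eighth power.\<close>
  proof (cases "R \<le> 3 / 10")
    case False
    have "sign_avg L (\<lambda>U. if A U \<le> 6 / 5 * S'\<^sup>2 then 1 else 0) \<le> sign_avg L (\<lambda>_. 1)"
      by (intro sign_avg_mono) simp
    also have "\<dots> = 1" using L by (simp add: sign_avg_def card_Pow)
    also have "1 \<le> (10 / 3) ^ 4 * R ^ 4"
    proof -
      have "1 \<le> 10 / 3 * R" using False by simp
      then have "1 \<le> (10 / 3 * R) ^ 4" by (rule one_le_power)
      then show ?thesis by (simp only: power_mult_distrib)
    qed
    also have "\<dots> \<le> flat_const * R ^ 4"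
      using flat_const_ge by (intro mult_right_mono) auto
    finally show ?thesis .
  next
    case True
    then have Q4: "Q4 \<le> 3 / 10 * S'\<^sup>2" using S0 by (simp add: R_def divide_le_eq)
    have "sign_avg L (\<lambda>U. if A U \<le> 6 / 5 * S'\<^sup>2 then 1 else 0) \<le> sign_avg L (\<lambda>U. (2 / S'\<^sup>2) ^ 8 * f U ^ 8)"
    proof (intro sign_avg_mono)
      fix U
      show "(if A U \<le> 6 / 5 * S'\<^sup>2 then 1 else 0) \<le> (2 / S'\<^sup>2) ^ 8 * f U ^ 8"
      proof (cases "A U \<le> 6 / 5 * S'\<^sup>2")
        case True
        then have "S'\<^sup>2 / 2 \<le> - f U" using Q4 unfolding A by simp
        then have "1 \<le> (2 / S'\<^sup>2) * (- f U)" using S0 by (simp add: field_simps pos_le_divide_eq)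
        then have "1 \<le> ((2 / S'\<^sup>2) * (- f U)) ^ 8" by (rule one_le_power)
        then show ?thesis using True unfolding power_mult_distrib by simp
      next
        case False
        have "0 \<le> f U ^ 8" by simp
        then have "0 \<le> (2 / S'\<^sup>2) ^ 8 * f U ^ 8" by (intro mult_nonneg_nonneg) auto
        then show ?thesis using False by simp
      qed
    qed
    also have "\<dots> = (2 / S'\<^sup>2) ^ 8 * sign_avg L (\<lambda>U. f U ^ 8)"
      by (simp add: sign_avg_def sum_distrib_left)
    also have "\<dots> \<le> (2 / S'\<^sup>2) ^ 8 * (9 ^ 16 * (288 * (S'\<^sup>2 * Q4)) ^ 4)"
    proof (intro mult_left_mono)
      have sup: "quad_support x \<subseteq> L" if "x \<in> proper_quads L l" for x
        using that by (auto simp: proper_quads_def quads_def quad_support_def sdiff_def)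
      have "(\<Sum>x\<in>proper_quads L l. (b x)\<^sup>2) \<le> S'\<^sup>2 * Q4"
      proof -
        have "(b x)\<^sup>2 \<le> (case x of (p, q, r, t) \<Rightarrow> (cmod (c p))\<^sup>2 * (cmod (c q))\<^sup>2 * (cmod (c r))\<^sup>2 * (cmod (c t))\<^sup>2)" for x
        proof -
          have "\<bar>b x\<bar> \<le> cmod (quad_term c x)" unfolding b_def by (rule abs_Re_le_cmod)
          then have "\<bar>b x\<bar>\<^sup>2 \<le> (cmod (quad_term c x))\<^sup>2" by (rule power_mono) simp
          then show ?thesis
            by (cases x) (simp add: quad_term_def norm_mult power_mult_distrib)
        qed
        then have "(\<Sum>x\<in>proper_quads L l. (b x)\<^sup>2) \<le>
            (\<Sum>(p, q, r, t)\<in>proper_quads L l. (cmod (c p))\<^sup>2 * (cmod (c q))\<^sup>2 * (cmod (c r))\<^sup>2 * (cmod (c t))\<^sup>2)"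
          by (rule sum_mono)
        also have "\<dots> \<le> (\<Sum>\<alpha>\<in>L. (cmod (c \<alpha>))\<^sup>2)\<^sup>2 * (\<Sum>\<alpha>\<in>L. ((cmod (c \<alpha>))\<^sup>2)\<^sup>2)"
          using L by (intro sum_quads_weight_le) auto
        finally show ?thesis by (simp add: S'_def Q4_def power_mult[symmetric])
      qed
      then have m2: "sign_avg L (\<lambda>U. (f U)\<^sup>2) \<le> 288 * (S'\<^sup>2 * Q4)"
        unfolding f_def
        using sign_avg_second_moment_le[OF L(1) finite_quads(2)[OF L(1)], of l quad_support 288 b]
          sup card_quad_support_fibre[OF L] by fastforce
      have "sign_avg L (\<lambda>U. f U ^ 8) \<le> 9 ^ 16 * (sign_avg L (\<lambda>U. (f U)\<^sup>2)) ^ 4"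
        unfolding f_def using L sup card_quad_support
        by (intro sign_avg_eighth_moment finite_quads) auto
      also have "\<dots> \<le> 9 ^ 16 * (288 * (S'\<^sup>2 * Q4)) ^ 4"
        using m2 by (intro mult_left_mono power_mono) (auto simp: sign_avg_def sum_nonneg)
      finally show "sign_avg L (\<lambda>U. f U ^ 8) \<le> 9 ^ 16 * (288 * (S'\<^sup>2 * Q4)) ^ 4" .
    qed simp
    also have "\<dots> = flat_const * R ^ 4"
    proof -
      define w where "w = S'\<^sup>2"
      have "w > 0" using S0 by (simp add: w_def)
      moreover have "w ^ 8 = w ^ 4 * w ^ 4" by (simp flip: power_add)
      ultimately show ?thesis
        unfolding flat_const_def R_def w_def[symmetric] power_mult_distrib power_divide
        by (simp add: field_simps)
    qed
    finally show ?thesis .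
  qed
  then show ?thesis unfolding A_def S'_def Q4_def R_def .
qed

lemma measurable_trig_poly_gauss:
  "(\<lambda>x. trig_poly L l x \<zeta>) \<in> borel_measurable (gauss L)"
  unfolding trig_poly_def
  by (intro borel_measurable_sum borel_measurable_times measurable_gauss_component borel_measurable_const)

lemma measurable_sum_pow_gauss:
  "(\<lambda>x. sum_pow L x k) \<in> borel_measurable (gauss L)"
  by (intro borel_measurable_sum borel_measurable_power borel_measurable_norm
      measurable_compose[OF measurable_gauss_component]) simp_all

lemma measurable_root_avg_gauss:
  "(\<lambda>x. root_avg Q (\<lambda>\<zeta>. (cmod (trig_poly L l x \<zeta>)) ^ k)) \<in> borel_measurable (gauss L)"
  unfolding root_avg_def
  by (intro borel_measurable_divide borel_measurable_sum borel_measurable_power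
      measurable_compose[OF measurable_trig_poly_gauss borel_measurable_norm] borel_measurable_const)

lemma even_power_mean:
  fixes y :: "'i \<Rightarrow> real"
  assumes "finite L" "L \<noteq> {}" "even k"
  shows "((\<Sum>i\<in>L. y i) / card L) ^ k \<le> (\<Sum>i\<in>L. y i ^ k) / card L"
proof -
  have "(\<Sum>i\<in>L. (1 / card L) *\<^sub>R y i) ^ k \<le> (\<Sum>i\<in>L. 1 / card L * y i ^ k)"
    using assms by (intro convex_on_sum[OF _ _ convex_power_even]) auto
  then show ?thesis by (simp add: sum_divide_distrib)
qed

lemma nn_integral_gauss_power_mean:
  assumes L: "finite L" "L \<noteq> {}"
  shows "(\<integral>\<^sup>+x. ennreal ((sum_pow L x (2 * k)) / card L) \<partial>gauss L) = ennreal (fact k)"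
proof -
  have n: "card L > 0" using L by (simp add: card_gt_0_iff)
  have m: "(\<lambda>x. ennreal ((cmod (x \<alpha>)) ^ (2 * k))) \<in> borel_measurable (gauss L)" if "\<alpha> \<in> L" for \<alpha>
    using that by (intro measurable_compose[OF measurable_gauss_component[OF that]]) simp
  have "(\<integral>\<^sup>+x. ennreal ((sum_pow L x (2 * k)) / card L) \<partial>gauss L) =
      (\<integral>\<^sup>+x. ennreal (1 / card L) * (\<Sum>\<alpha>\<in>L. ennreal ((cmod (x \<alpha>)) ^ (2 * k))) \<partial>gauss L)"
    by (intro nn_integral_cong) (subst sum_ennreal, simp, subst ennreal_mult'[symmetric], auto)
  also have "\<dots> = ennreal (1 / card L) * (\<integral>\<^sup>+x. (\<Sum>\<alpha>\<in>L. ennreal ((cmod (x \<alpha>)) ^ (2 * k))) \<partial>gauss L)"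
    by (intro nn_integral_cmult borel_measurable_sum m)
  also have "(\<integral>\<^sup>+x. (\<Sum>\<alpha>\<in>L. ennreal ((cmod (x \<alpha>)) ^ (2 * k))) \<partial>gauss L) =
      (\<Sum>\<alpha>\<in>L. \<integral>\<^sup>+x. ennreal ((cmod (x \<alpha>)) ^ (2 * k)) \<partial>gauss L)"
    by (intro nn_integral_sum m)
  also have "(\<Sum>\<alpha>\<in>L. \<integral>\<^sup>+x. ennreal ((cmod (x \<alpha>)) ^ (2 * k)) \<partial>gauss L) = (\<Sum>\<alpha>\<in>L. ennreal (fact k))"
    using L by (intro sum.cong refl)
      (subst nn_integral_gauss_component, auto simp: nn_integral_cgauss_moment)
  also have "(\<Sum>\<alpha>\<in>L. ennreal (fact k)) = ennreal (card L * fact k)"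
    by (simp add: ennreal_of_nat_eq_real_of_nat ennreal_mult)
  also have "ennreal (1 / card L) * ennreal (card L * fact k) = ennreal (1 / card L * (card L * fact k))"
    by (rule ennreal_mult'[symmetric]) simp
  finally show ?thesis using n by simp
qed

text \<open>A consequence of flatness that sees only the fourth moment: if |p|^2 stays below 6/5 of
  its mean \<open>S\<close>, the mean of |p|^4 is at most 6/5 of S^2. The factor lies between 1, the
  flat case, and 2, the typical case under random signs.\<close>

definition flat_event :: "nat \<Rightarrow> 'i set \<Rightarrow> ('i \<Rightarrow> nat) \<Rightarrow> ('i \<Rightarrow> complex) set" where
  "flat_event Q L l = {x. root_avg Q (\<lambda>\<zeta>. (cmod (trig_poly L l x \<zeta>)) ^ 4) \<le> 6 / 5 * (sum_pow L x 2)\<^sup>2}"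

lemma measurable_indicator_flat_event:
  "(\<lambda>x. indicator (flat_event Q L l) x :: ennreal) \<in> borel_measurable (gauss L)"
proof -
  have "{x \<in> space (gauss L). root_avg Q (\<lambda>\<zeta>. (cmod (trig_poly L l x \<zeta>)) ^ 4) \<le> 6 / 5 * (sum_pow L x 2)\<^sup>2} \<in> sets (gauss L)"
    by (intro borel_measurable_le measurable_root_avg_gauss borel_measurable_times borel_measurable_const
        borel_measurable_power measurable_sum_pow_gauss)
  then have "(\<lambda>x. indicator {x \<in> space (gauss L). root_avg Q (\<lambda>\<zeta>. (cmod (trig_poly L l x \<zeta>)) ^ 4) \<le> 6 / 5 * (sum_pow L x 2)\<^sup>2} x :: ennreal) \<in> borel_measurable (gauss L)"
    by simp
  then show ?thesis
    by (rule measurable_cong[THEN iffD1, rotated]) (simp add: flat_event_def indicator_def)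
qed

text \<open>Averaging over all sign flips preserves the Gaussian integral. As the weight depends on
  the moduli only, the indicator is replaced by the fraction of flips that land in the event. At
  each point \<open>bd\<close> may be the bound of \<open>flat_sign_fraction\<close> or the trivial
  bound 1.\<close>

lemma flat_event_signs:
  fixes l :: "'i \<Rightarrow> nat"
  assumes L: "finite L" "inj_on l L" and Q: "\<And>\<alpha>. \<alpha> \<in> L \<Longrightarrow> 2 * l \<alpha> < Q"
    and W: "W \<in> borel_measurable borel" and bd: "\<And>x. sum_pow L x 2 > 0 \<Longrightarrow> bd x \<ge> flat_const * (sum_pow L x 4 / (sum_pow L x 2)\<^sup>2) ^ 4 \<or> bd x \<ge> (1::real)"
    and bdm: "bd \<in> borel_measurable (gauss L)" and bd0: "\<And>x. sum_pow L x 2 \<le> 0 \<Longrightarrow> bd x \<ge> 1"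
  shows "(\<integral>\<^sup>+x. indicator (flat_event Q L l) x * ennreal (W (sum_pow L x 2)) \<partial>gauss L)
    \<le> (\<integral>\<^sup>+x. ennreal (bd x) * ennreal (W (sum_pow L x 2)) \<partial>gauss L)"
proof -
  define F where "F x = (indicator (flat_event Q L l) x * ennreal (W (sum_pow L x 2)) :: ennreal)" for x
  define N where "N = (2::real) ^ card L"
  have N: "N > 0" by (simp add: N_def)
  have mW: "(\<lambda>x. ennreal (W (sum_pow L x 2))) \<in> borel_measurable (gauss L)"
    by (intro measurable_compose[OF measurable_sum_pow_gauss] measurable_compose[OF W]) simp
  have F: "F \<in> borel_measurable (gauss L)"
    unfolding F_def by (intro borel_measurable_times_ennreal measurable_indicator_flat_event mW)
  let ?T = "\<lambda>U x. \<lambda>i\<in>L. of_real (if i \<in> U then - 1 else 1) * x i :: complex"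
  have T: "?T U \<in> gauss L \<rightarrow>\<^sub>M gauss L" for U
  proof (intro measurable_restrict)
    fix i assume "i \<in> L"
    then have "(\<lambda>x. of_real (if i \<in> U then - 1 else 1) * x i) \<in> borel_measurable (gauss L)"
      by (intro borel_measurable_times borel_measurable_const measurable_gauss_component)
    then show "(\<lambda>x. of_real (if i \<in> U then - 1 else 1) * x i) \<in> gauss L \<rightarrow>\<^sub>M cgauss"
      unfolding measurable_cong_sets[OF refl sets_cgauss] .
  qed
  have D: "distr (gauss L) (gauss L) (?T U) = gauss L" for U
    by (rule distr_gauss_signs[OF L(1)]) simp
  have inv: "(\<integral>\<^sup>+x. F x \<partial>gauss L) = (\<integral>\<^sup>+x. F (?T U x) \<partial>gauss L)" for U
  proof -
    have "F \<in> borel_measurable (distr (gauss L) (gauss L) (?T U))" using F by simp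
    from nn_integral_distr[OF T[of U] this] show ?thesis unfolding D .
  qed
  have nz: "cmod (of_real (if \<alpha> \<in> U then - 1 else 1) * z) = cmod z" for \<alpha> :: 'i and U and z
    by (simp add: norm_mult)
  have nf: "sum_pow L (?T U x) k = sum_pow L x k" "sum_pow L (flip_signs U x) k = sum_pow L x k" for U x k
    by (auto intro!: sum.cong simp: flip_signs_def nz simp del: of_real_minus)
  have FT: "F (?T U x) = indicator (flat_event Q L l) (flip_signs U x) * ennreal (W (sum_pow L x 2))" for U x
  proof -
    have "trig_poly L l (?T U x) = trig_poly L l (flip_signs U x)"
      by (rule trig_poly_cong) (simp add: flip_signs_def)
    then show ?thesis unfolding F_def flat_event_def indicator_def mem_Collect_eq by (simp only: nf)
  qed
  have "ennreal N * (\<integral>\<^sup>+x. F x \<partial>gauss L) = (\<Sum>U\<in>Pow L. \<integral>\<^sup>+x. F x \<partial>gauss L)"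
  proof -
    have "ennreal N = of_nat (card (Pow L))"
      using L by (simp add: card_Pow N_def ennreal_of_nat_eq_real_of_nat)
    then show ?thesis by simp
  qed
  also have "\<dots> = (\<Sum>U\<in>Pow L. \<integral>\<^sup>+x. F (?T U x) \<partial>gauss L)"
    by (intro sum.cong refl inv)
  also have "\<dots> = (\<integral>\<^sup>+x. (\<Sum>U\<in>Pow L. F (?T U x)) \<partial>gauss L)"
    by (rule nn_integral_sum[symmetric]) (rule measurable_compose[OF T F])
  also have "\<dots> \<le> (\<integral>\<^sup>+x. ennreal N * (ennreal (bd x) * ennreal (W (sum_pow L x 2))) \<partial>gauss L)"
  proof (intro nn_integral_mono)
    fix x
    define h where "h U = (if root_avg Q (\<lambda>\<zeta>. (cmod (trig_poly L l (flip_signs U x) \<zeta>)) ^ 4) \<le> 6 / 5 * (sum_pow L x 2)\<^sup>2 then 1 else 0 :: real)" for U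
    have s1: "(\<Sum>U\<in>Pow L. F (?T U x)) = (\<Sum>U\<in>Pow L. ennreal (h U)) * ennreal (W (sum_pow L x 2))"
      unfolding FT sum_distrib_right[symmetric]
      unfolding h_def flat_event_def indicator_def mem_Collect_eq nf
      by (intro arg_cong2[where f = "(*)"] sum.cong refl) simp
    have "(\<Sum>U\<in>Pow L. ennreal (h U)) = ennreal (N * sign_avg L h)"
      using N by (simp add: sum_ennreal h_def sign_avg_def N_def)
    also have "\<dots> \<le> ennreal (N * bd x)"
    proof (intro ennreal_leI mult_left_mono)
      have "sign_avg L h \<le> sign_avg L (\<lambda>_. 1)" by (intro sign_avg_mono) (simp add: h_def)
      also have "\<dots> = 1" using L by (simp add: sign_avg_def card_Pow)
      finally have "sign_avg L h \<le> 1" .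
      moreover have "sign_avg L h \<le> flat_const * (sum_pow L x 4 / (sum_pow L x 2)\<^sup>2) ^ 4" if "sum_pow L x 2 > 0"
        unfolding h_def using L Q that by (rule flat_sign_fraction)
      ultimately show "sign_avg L h \<le> bd x"
        using bd[of x] bd0[of x] by (cases "sum_pow L x 2 > 0") (auto simp: not_less dest: order_trans)
    qed (use N in simp)
    also have "ennreal (N * bd x) = ennreal N * ennreal (bd x)"
      using N by (intro ennreal_mult') simp
    finally have s2: "(\<Sum>U\<in>Pow L. ennreal (h U)) \<le> ennreal N * ennreal (bd x)" .
    show "(\<Sum>U\<in>Pow L. F (?T U x)) \<le> ennreal N * (ennreal (bd x) * ennreal (W (sum_pow L x 2)))"
      unfolding s1 mult.assoc[symmetric] by (rule mult_right_mono[OF s2]) simp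
  qed
  also have "\<dots> = ennreal N * (\<integral>\<^sup>+x. ennreal (bd x) * ennreal (W (sum_pow L x 2)) \<partial>gauss L)"
    by (intro nn_integral_cmult borel_measurable_times_ennreal mW measurable_compose[OF bdm] measurable_ennreal)
  finally show ?thesis
    using N by (subst (asm) ennreal_mult_le_mult_iff) (auto simp: F_def[abs_def])
qed

lemma flat_event_weight_aux:
  fixes l :: "'i \<Rightarrow> nat"
  assumes L: "finite L" "inj_on l L" "L \<noteq> {}" and Q: "\<And>\<alpha>. \<alpha> \<in> L \<Longrightarrow> 2 * l \<alpha> < Q"
  defines "M \<equiv> real (card L)"
  shows "(\<integral>\<^sup>+x. indicator (flat_event Q L l) x * ennreal ((1 + sum_pow L x 2)\<^sup>2) \<partial>gauss L)
    \<le> ennreal ((1 + M)\<^sup>2 * exp (M / 2) * (1 / 2) ^ card L +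
        flat_const * 256 / M\<^sup>2 * (fact 12 + 64 * (1 + fact 6)))"
proof -
  have M: "M \<ge> 1" using L by (simp add: M_def Suc_le_eq card_gt_0_iff)
  \<comment> \<open>A sum below half its mean \<open>M\<close> has exponentially small probability,
    so the trivial bound is affordable there. Elsewhere the denominator of the sign bound can be
    replaced by a multiple of M^2.\<close>
  define bd where "bd x = (if sum_pow L x 2 < M / 2 then 1 else flat_const * (sum_pow L x 4 / (sum_pow L x 2)\<^sup>2) ^ 4)" for x
  define X6 where "X6 x = sum_pow L x 24 / M" for x
  define Z6 where "Z6 x = sum_pow L x 12 / M" for x
  define k where "k = flat_const * 256 / M\<^sup>2"
  have k: "k \<ge> 0" using flat_const_ge by (simp add: k_def)
  have nn: "X6 x \<ge> 0" "Z6 x \<ge> 0" "sum_pow L x j \<ge> 0" for x j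
    using M by (auto simp: X6_def Z6_def intro!: divide_nonneg_nonneg sum_nonneg)
  have bdm: "bd \<in> borel_measurable (gauss L)"
    unfolding bd_def
    by (intro borel_measurable_const measurable_If borel_measurable_times borel_measurable_power
        borel_measurable_divide measurable_sum_pow_gauss borel_measurable_less)
  have X6: "(\<integral>\<^sup>+x. ennreal (X6 x) \<partial>gauss L) = ennreal (fact 12)"
    using nn_integral_gauss_power_mean[OF L(1,3), of 12] by (simp add: X6_def M_def)
  have Z6: "(\<integral>\<^sup>+x. ennreal (Z6 x) \<partial>gauss L) = ennreal (fact 6)"
    using nn_integral_gauss_power_mean[OF L(1,3), of 6] by (simp add: Z6_def M_def)
  have pt: "bd x * (1 + sum_pow L x 2)\<^sup>2 \<le>
      (1 + M)\<^sup>2 * exp (M / 2) * exp (- 1 * sum_pow L x 2) + (k * X6 x + (k * 64 + k * 64 * Z6 x))" for x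
  proof -
    define S where "S = sum_pow L x 2"
    define P where "P = sum_pow L x 4"
    have S0: "S \<ge> 0" "P \<ge> 0" using nn by (auto simp: S_def P_def)
    show ?thesis
    proof (cases "S < M / 2")
      case True
      have "(1 + S)\<^sup>2 \<le> (1 + M)\<^sup>2" using True S0 M by (intro power_mono) auto
      also have "\<dots> = (1 + M)\<^sup>2 * 1" by simp
      also have "1 \<le> exp (M / 2 + - 1 * S)" using True by (subst one_le_exp_iff) simp
      then have "(1 + M)\<^sup>2 * 1 \<le> (1 + M)\<^sup>2 * exp (M / 2 + - 1 * S)" by (intro mult_left_mono) auto
      also have "\<dots> = (1 + M)\<^sup>2 * exp (M / 2) * exp (- 1 * S)" unfolding exp_add by simp
      finally have "(1 + S)\<^sup>2 \<le> (1 + M)\<^sup>2 * exp (M / 2) * exp (- 1 * S)" .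
      moreover have "0 \<le> k * X6 x + (k * 64 + k * 64 * Z6 x)"
        using k nn by (intro add_nonneg_nonneg mult_nonneg_nonneg) auto
      ultimately show ?thesis using True unfolding bd_def S_def by simp
    next
      case False
      \<comment> \<open>\<open>X\<close> and \<open>Y\<close> are normalised means of order 1. The
        fourth power of the sign bound gives M^(-4), the weight costs M^2, and M^(-2) remains; 256 =
        4^4 comes from the lower bound \<open>M / 2\<close> for \<open>S\<close>.\<close>
      define X where "X = P / M"
      define Y where "Y = (1 + S) / M"
      have XY: "X \<ge> 0" "Y \<ge> 0" using S0 M by (auto simp: X_def Y_def)
      have P: "P = M * X" and S1: "1 + S = M * Y" using M by (auto simp: X_def Y_def)
      have "P / S\<^sup>2 \<le> P / (M / 2)\<^sup>2"
        using False S0 M by (intro divide_left_mono power_mono mult_pos_pos zero_less_power) auto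
      then have "(P / S\<^sup>2) ^ 4 \<le> (P / (M / 2)\<^sup>2) ^ 4"
        using S0 by (intro power_mono) auto
      then have "flat_const * (P / S\<^sup>2) ^ 4 * (1 + S)\<^sup>2 \<le> flat_const * (P / (M / 2)\<^sup>2) ^ 4 * (1 + S)\<^sup>2"
        using flat_const_ge by (intro mult_right_mono mult_left_mono) auto
      also have "\<dots> = k * (X ^ 4 * Y\<^sup>2)"
        unfolding P S1 k_def using M by (simp add: field_simps power_mult_distrib eval_nat_numeral)
      \<comment> \<open>Decoupling the product leaves sixth powers of means. Convexity moves these
        inside, so only the moments of a single coefficient, 12! and 6!, are needed.\<close>
      also have "X ^ 4 * Y\<^sup>2 \<le> X ^ 6 + Y ^ 6"
      proof (cases "X \<le> Y")
        case True
        have "X ^ 4 * Y\<^sup>2 \<le> Y ^ 4 * Y\<^sup>2" using True XY by (intro mult_right_mono power_mono) auto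
        also have "\<dots> = Y ^ 6" by (simp flip: power_add)
        finally show ?thesis using XY by (simp add: add_increasing)
      next
        case False
        have "X ^ 4 * Y\<^sup>2 \<le> X ^ 4 * X\<^sup>2" using False XY by (intro mult_left_mono power_mono) auto
        also have "\<dots> = X ^ 6" by (simp flip: power_add)
        finally show ?thesis using XY by (simp add: add_increasing2)
      qed
      also have "X ^ 6 \<le> X6 x"
        using even_power_mean[OF L(1,3), of 6 "\<lambda>\<alpha>. (cmod (x \<alpha>)) ^ 4"]
        by (simp add: X_def P_def X6_def M_def flip: power_mult)
      also have "Y ^ 6 \<le> 64 + 64 * Z6 x"
      proof -
        define Z where "Z = S / M"
        have Z0: "Z \<ge> 0" using S0 M by (simp add: Z_def)
        have Z: "Z ^ 6 \<le> Z6 x"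
          using even_power_mean[OF L(1,3), of 6 "\<lambda>\<alpha>. (cmod (x \<alpha>))\<^sup>2"]
          by (simp add: Z_def S_def Z6_def M_def flip: power_mult)
        have "Y \<le> 1 + Z" using M by (simp add: Y_def Z_def field_simps)
        then have "Y ^ 6 \<le> (1 + Z) ^ 6" using XY by (intro power_mono) auto
        also have "\<dots> \<le> 64 + 64 * Z ^ 6"
        proof (cases "Z \<le> 1")
          case True
          then have "(1 + Z) ^ 6 \<le> 2 ^ 6" using Z0 by (intro power_mono) auto
          moreover have "0 \<le> Z ^ 6" using Z0 by (rule zero_le_power)
          moreover have "(2::real) ^ 6 = 64" by simp
          ultimately show ?thesis by linarith
        next
          case False
          then have "(1 + Z) ^ 6 \<le> (2 * Z) ^ 6" by (intro power_mono) auto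
          then show ?thesis by (simp add: power_mult_distrib)
        qed
        finally show ?thesis using Z by simp
      qed
      finally have "flat_const * (P / S\<^sup>2) ^ 4 * (1 + S)\<^sup>2 \<le> k * (X6 x + (64 + 64 * Z6 x))"
        using k by (simp add: mult_left_mono)
      also have "k * (X6 x + (64 + 64 * Z6 x)) = k * X6 x + (k * 64 + k * 64 * Z6 x)"
        by (simp add: distrib_left)
      also have "\<dots> \<le> (1 + M)\<^sup>2 * exp (M / 2) * exp (- 1 * S) + \<dots>" by simp
      finally show ?thesis using False unfolding bd_def S_def[symmetric] P_def[symmetric] by simp
    qed
  qed
  have mX: "(\<lambda>x. ennreal (X6 x)) \<in> borel_measurable (gauss L)" "(\<lambda>x. ennreal (Z6 x)) \<in> borel_measurable (gauss L)"
    unfolding X6_def Z6_def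
    by (intro measurable_compose[OF _ measurable_ennreal] borel_measurable_divide measurable_sum_pow_gauss borel_measurable_const)+
  have mE: "(\<lambda>x. ennreal (exp (- 1 * sum_pow L x 2))) \<in> borel_measurable (gauss L)"
    by (intro measurable_compose[OF measurable_sum_pow_gauss]) simp
  have b1: "bd x \<ge> flat_const * (sum_pow L x 4 / (sum_pow L x 2)\<^sup>2) ^ 4 \<or> bd x \<ge> 1"
    and b0: "sum_pow L x 2 \<le> 0 \<Longrightarrow> bd x \<ge> 1" for x
    using M by (auto simp: bd_def)
  have "(\<integral>\<^sup>+x. indicator (flat_event Q L l) x * ennreal ((1 + sum_pow L x 2)\<^sup>2) \<partial>gauss L)
      \<le> (\<integral>\<^sup>+x. ennreal (bd x) * ennreal ((1 + sum_pow L x 2)\<^sup>2) \<partial>gauss L)"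
    by (rule flat_event_signs[OF L(1,2) Q _ b1 bdm b0, where W = "\<lambda>s. (1 + s)\<^sup>2"]) auto
  also have "\<dots> \<le> (\<integral>\<^sup>+x. ennreal ((1 + M)\<^sup>2 * exp (M / 2)) * ennreal (exp (- 1 * sum_pow L x 2)) +
      (ennreal k * ennreal (X6 x) + (ennreal (k * 64) + ennreal (k * 64) * ennreal (Z6 x))) \<partial>gauss L)"
  proof (intro nn_integral_mono)
    fix x
    have "ennreal (bd x) * ennreal ((1 + sum_pow L x 2)\<^sup>2) = ennreal (bd x * (1 + sum_pow L x 2)\<^sup>2)"
      by (rule ennreal_mult''[symmetric]) simp
    also have "\<dots> \<le> ennreal ((1 + M)\<^sup>2 * exp (M / 2) * exp (- 1 * sum_pow L x 2) + (k * X6 x + (k * 64 + k * 64 * Z6 x)))"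
      by (rule ennreal_leI[OF pt])
    also have "\<dots> = ennreal ((1 + M)\<^sup>2 * exp (M / 2)) * ennreal (exp (- 1 * sum_pow L x 2)) +
      (ennreal k * ennreal (X6 x) + (ennreal (k * 64) + ennreal (k * 64) * ennreal (Z6 x)))"
      using k nn by (simp add: ennreal_mult')
    finally show "ennreal (bd x) * ennreal ((1 + sum_pow L x 2)\<^sup>2) \<le> \<dots>" .
  qed
  also have "\<dots> = ennreal ((1 + M)\<^sup>2 * exp (M / 2)) * (\<integral>\<^sup>+x. ennreal (exp (- 1 * sum_pow L x 2)) \<partial>gauss L) +
      (ennreal k * (\<integral>\<^sup>+x. ennreal (X6 x) \<partial>gauss L) + (ennreal (k * 64) + ennreal (k * 64) * (\<integral>\<^sup>+x. ennreal (Z6 x) \<partial>gauss L)))"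
    using mX mE prob_space.emeasure_space_1[OF prob_space_gauss, of L]
    by (simp add: nn_integral_add nn_integral_cmult)
  also have "(\<integral>\<^sup>+x. ennreal (exp (- 1 * sum_pow L x 2)) \<partial>gauss L) = ennreal ((1 / 2) ^ card L)"
    using nn_integral_gauss_exp_norm_square[OF L(1), of "- 1"] by simp
  also have "ennreal ((1 + M)\<^sup>2 * exp (M / 2)) * ennreal ((1 / 2) ^ card L) +
      (ennreal k * (\<integral>\<^sup>+x. ennreal (X6 x) \<partial>gauss L) + (ennreal (k * 64) + ennreal (k * 64) * (\<integral>\<^sup>+x. ennreal (Z6 x) \<partial>gauss L))) =
      ennreal ((1 + M)\<^sup>2 * exp (M / 2) * (1 / 2) ^ card L + (k * fact 12 + (k * 64 + k * 64 * fact 6)))"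
    unfolding X6 Z6 using k by (simp add: ennreal_mult')
  also have "k * fact 12 + (k * 64 + k * 64 * fact 6) = k * (fact 12 + 64 * (1 + fact 6))"
    by (simp add: distrib_left)
  finally show ?thesis by (simp only: k_def)
qed

text \<open>The cube covers a weight of order n^2 and leaves one further factor \<open>1 + n\<close>
  as decay.\<close>

lemma power_geometric_bounded:
  fixes q :: real
  assumes "0 \<le> q" "q < 1"
  shows "\<exists>K>0. \<forall>n::nat. (1 + real n) ^ 3 * q ^ n \<le> K"
proof -
  have "(\<lambda>n. (1 + real n) ^ 3 * q ^ n) \<longlonglongrightarrow> 0"
  proof (cases "q = 0")
    case True
    have "eventually (\<lambda>n. (1 + real n) ^ 3 * q ^ n = 0) sequentially"
      using eventually_gt_at_top[of 0] by eventually_elim (use True in simp)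
    then show ?thesis by (rule tendsto_eventually)
  next
    case False
    then show ?thesis using assms by real_asymp
  qed
  then have "Bseq (\<lambda>n. (1 + real n) ^ 3 * q ^ n)" by (intro convergent_imp_Bseq convergentI)
  then obtain K where "K > 0" "\<And>n. norm ((1 + real n) ^ 3 * q ^ n) \<le> K" by (auto simp: Bseq_def)
  then show ?thesis using assms by (intro exI[of _ K]) auto
qed

text \<open>The denominator is \<open>1 + card L\<close> because the bound is applied after two
  monomials have been removed, which may leave the empty set. The rare range decays geometrically
  with ratio \<open>exp (1 / 2) / 2\<close>, below 1.\<close>

lemma flat_event_weight:
  "\<exists>K>0. \<forall>(L :: 'i set) l Q. finite L \<longrightarrow> inj_on l L \<longrightarrow> (\<forall>\<alpha>\<in>L. 2 * l \<alpha> < Q) \<longrightarrow>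
    (\<integral>\<^sup>+x. indicator (flat_event Q L l) x * ennreal ((1 + sum_pow L x 2)\<^sup>2) \<partial>gauss L)
      \<le> ennreal (K / (1 + card L))"
proof -
  have "exp (1 / 2 :: real) < 2"
  proof (rule power2_less_imp_less)
    have "(exp (1 / 2 :: real))\<^sup>2 = exp 1" by (simp add: power2_eq_square flip: exp_add)
    then show "(exp (1 / 2 :: real))\<^sup>2 < 2\<^sup>2" using e_less_272 by simp
  qed simp
  then obtain K where K: "K > 0" "\<And>n::nat. (1 + real n) ^ 3 * (exp (1 / 2) / 2) ^ n \<le> K"
    using power_geometric_bounded[of "exp (1 / 2) / 2"] by auto
  define c where "c = flat_const * 256 * (fact 12 + 64 * (1 + fact 6))"
  have c: "c > 0" using flat_const_ge(2) unfolding c_def by (intro mult_pos_pos add_pos_pos) auto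
  show ?thesis
  proof (intro exI[of _ "1 + K + 2 * c"] conjI allI impI)
    show "1 + K + 2 * c > 0" using K c by simp
    fix L :: "'i set" and l :: "'i \<Rightarrow> nat" and Q :: nat
    assume L: "finite L" "inj_on l L" and Q: "\<forall>\<alpha>\<in>L. 2 * l \<alpha> < Q"
    show "(\<integral>\<^sup>+x. indicator (flat_event Q L l) x * ennreal ((1 + sum_pow L x 2)\<^sup>2) \<partial>gauss L)
      \<le> ennreal ((1 + K + 2 * c) / (1 + card L))"
    proof (cases "L = {}")
      case True
      have "(\<integral>\<^sup>+x. indicator (flat_event Q L l) x * ennreal ((1 + sum_pow L x 2)\<^sup>2) \<partial>gauss L) \<le> (\<integral>\<^sup>+x. 1 \<partial>gauss L)"
        using True by (intro nn_integral_mono) (simp add: indicator_def)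
      also have "\<dots> = ennreal 1" using prob_space.emeasure_space_1[OF prob_space_gauss, of L] by simp
      also have "\<dots> \<le> ennreal ((1 + K + 2 * c) / (1 + card L))"
        using True K c by (intro ennreal_leI) simp
      finally show ?thesis .
    next
      case False
      define M where "M = real (card L)"
      have M: "M \<ge> 1" using L False by (simp add: M_def Suc_le_eq card_gt_0_iff)
      have "(1 + M) ^ 3 * (exp (1 / 2) / 2) ^ card L \<le> K" using K(2)[of "card L"] by (simp add: M_def)
      moreover have "exp (M / 2) = exp (1 / 2) ^ card L" by (simp add: M_def flip: exp_of_nat_mult)
      ultimately have "(1 + M) * ((1 + M)\<^sup>2 * exp (M / 2) * (1 / 2) ^ card L) \<le> K"
        by (simp add: power_divide power3_eq_cube power2_eq_square mult_ac)
      then have 1: "(1 + M)\<^sup>2 * exp (M / 2) * (1 / 2) ^ card L \<le> K / (1 + M)"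
        using M by (simp add: pos_le_divide_eq mult_ac)
      have "1 + M \<le> 2 * M\<^sup>2" using M self_le_power[of M 2] by simp
      then have "c * (1 + M) \<le> c * (2 * M\<^sup>2)" using c by (intro mult_left_mono) auto
      then have 2: "c / M\<^sup>2 \<le> 2 * c / (1 + M)" using M by (simp add: field_simps)
      have "(\<integral>\<^sup>+x. indicator (flat_event Q L l) x * ennreal ((1 + sum_pow L x 2)\<^sup>2) \<partial>gauss L)
        \<le> ennreal ((1 + M)\<^sup>2 * exp (M / 2) * (1 / 2) ^ card L + flat_const * 256 / M\<^sup>2 * (fact 12 + 64 * (1 + fact 6)))"
        unfolding M_def using L False Q by (intro flat_event_weight_aux) auto
      also have "\<dots> \<le> ennreal ((1 + K + 2 * c) / (1 + M))"
      proof (intro ennreal_leI)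
        have "flat_const * 256 / M\<^sup>2 * (fact 12 + 64 * (1 + fact 6)) = c / M\<^sup>2" by (simp add: c_def)
        moreover have "0 \<le> 1 / (1 + M)" using M by simp
        ultimately show "(1 + M)\<^sup>2 * exp (M / 2) * (1 / 2) ^ card L + flat_const * 256 / M\<^sup>2 * (fact 12 + 64 * (1 + fact 6))
            \<le> (1 + K + 2 * c) / (1 + M)"
          using 1 2 unfolding add_divide_distrib by linarith
      qed
      finally show ?thesis by (simp add: M_def)
    qed
  qed
qed

section \<open>Few monomials\<close>

text \<open>Finitely many inequalities, both sides of which are homogeneous of degree 2 in
  \<open>x\<close>: the event is measurable and a cone.\<close>

definition peak_event :: "nat \<Rightarrow> 'i set \<Rightarrow> ('i \<Rightarrow> nat) \<Rightarrow> real \<Rightarrow> ('i \<Rightarrow> complex) set" where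
  "peak_event Q L l h = {x. \<forall>r<Q. (cmod (trig_poly L l x (uroot Q r)))\<^sup>2 \<le> h * sum_pow L x 2}"

lemma sets_peak_event:
  "peak_event Q L l h \<inter> space (gauss L) \<in> sets (gauss L)"
proof -
  have "(\<Inter>r\<in>{..<Q}. {x \<in> space (gauss L). (cmod (trig_poly L l x (uroot Q r)))\<^sup>2 \<le> h * sum_pow L x 2}) \<inter> space (gauss L) \<in> sets (gauss L)"
  proof (cases "Q = 0")
    case False
    then show ?thesis
      by (intro sets.Int sets.finite_INT sets.top borel_measurable_le borel_measurable_power borel_measurable_times
          borel_measurable_const measurable_sum_pow_gauss
          measurable_compose[OF measurable_trig_poly_gauss borel_measurable_norm]) auto
  qed simp
  also have "(\<Inter>r\<in>{..<Q}. {x \<in> space (gauss L). (cmod (trig_poly L l x (uroot Q r)))\<^sup>2 \<le> h * sum_pow L x 2}) \<inter> space (gauss L) =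
      peak_event Q L l h \<inter> space (gauss L)"
    by (auto simp: peak_event_def)
  finally show ?thesis .
qed

lemma measurable_indicator_peak_event:
  "(\<lambda>x. indicator (peak_event Q L l h) x :: ennreal) \<in> borel_measurable (gauss L)"
proof -
  have "(\<lambda>x. indicator (peak_event Q L l h \<inter> space (gauss L)) x :: ennreal) \<in> borel_measurable (gauss L)"
    using sets_peak_event by (rule borel_measurable_indicator)
  then show ?thesis
    by (rule measurable_cong[THEN iffD1, rotated]) (simp add: indicator_def)
qed

text \<open>If the polynomial is nearly flat, then the two extreme coefficients have a small product; hence
  either one of them is much smaller than the other, which is itself unusually large, or both are
  negligible and the remaining polynomial is nearly flat as well.\<close>

lemma peak_event_cases:
  assumes L: "finite L" "inj_on l L" and Q: "\<And>\<alpha>. \<alpha> \<in> L \<Longrightarrow> 2 * l \<alpha> < Q"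
    and a: "a \<in> L" "\<And>\<alpha>. \<alpha> \<in> L \<Longrightarrow> l \<alpha> \<le> l a" and b: "b \<in> L" "\<And>\<alpha>. \<alpha> \<in> L \<Longrightarrow> l b \<le> l \<alpha>"
    and ab: "a \<noteq> b" and eps: "0 < e" "e \<le> 1 / 20"
    and x: "x \<in> peak_event Q L l (1 + e)"
  defines "J \<equiv> L - {a, b}"
  shows "(cmod (x b))\<^sup>2 \<le> (2502 * e)\<^sup>2 * (cmod (x a))\<^sup>2 \<and> sum_pow J x 2 / 2500 < (cmod (x a))\<^sup>2 \<or>
    (cmod (x a))\<^sup>2 \<le> (2502 * e)\<^sup>2 * (cmod (x b))\<^sup>2 \<and> sum_pow J x 2 / 2500 < (cmod (x b))\<^sup>2 \<or>
    x \<in> flat_event Q J l \<and> (cmod (x b))\<^sup>2 * (cmod (x a))\<^sup>2 \<le> 4 * e\<^sup>2 * (1 + sum_pow J x 2)\<^sup>2"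
proof -
  define X where "X = cmod (x a)"
  define Y where "Y = cmod (x b)"
  define S where "S = sum_pow J x 2"
  have Ldec: "L = insert a (insert b J)" "a \<notin> insert b J" "b \<notin> J" "finite J"
    using a(1) b(1) ab L(1) by (auto simp: J_def)
  have SL: "sum_pow L x 2 = X\<^sup>2 + (Y\<^sup>2 + S)"
    unfolding Ldec(1) using Ldec by (simp add: X_def Y_def S_def)
  have nn: "X \<ge> 0" "Y \<ge> 0" "S \<ge> 0" by (auto simp: X_def Y_def S_def sum_nonneg)
  have peak: "(cmod (trig_poly L l x (uroot Q r)))\<^sup>2 \<le> (1 + e) * sum_pow L x 2" if "r < Q" for r
    using x that by (simp add: peak_event_def)
  have "X * Y \<le> (1 + e) * sum_pow L x 2 - sum_pow L x 2"
    unfolding X_def Y_def by (rule extreme_coefficients_bound[OF L Q a b ab peak])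
  then have XY: "X * Y \<le> e * (X\<^sup>2 + Y\<^sup>2 + S)" unfolding SL by (simp add: algebra_simps)
  \<comment> \<open>Here the larger coefficient controls the whole norm: 2502 = 1 + 1 + 2500.
    Dividing the product bound by it shows that the smaller one is at most \<open>2502 * e\<close>
    times the larger.\<close>
  have dominated: "V\<^sup>2 \<le> (2502 * e)\<^sup>2 * U\<^sup>2" if "V \<le> U" "S / 2500 < U\<^sup>2" "U * V \<le> e * (U\<^sup>2 + V\<^sup>2 + S)" "V \<ge> 0" for U V
  proof -
    have "U \<ge> 0" using that by linarith
    have "U > 0" using that(2) nn \<open>U \<ge> 0\<close> by (cases "U = 0") auto
    have "V\<^sup>2 \<le> U\<^sup>2" using that by (intro power_mono) auto
    then have "U\<^sup>2 + V\<^sup>2 + S \<le> 2502 * U\<^sup>2" using that(2) by linarith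
    then have "e * (U\<^sup>2 + V\<^sup>2 + S) \<le> e * (2502 * U\<^sup>2)" using eps by (intro mult_left_mono) auto
    then have "U * V \<le> U * (2502 * e * U)" using that(3) by (simp add: power2_eq_square mult_ac)
    then have "V \<le> 2502 * e * U" using \<open>U > 0\<close> by simp
    then have "V\<^sup>2 \<le> (2502 * e * U)\<^sup>2" using that by (intro power_mono) auto
    then show ?thesis by (simp add: power_mult_distrib)
  qed
  show ?thesis
  proof (cases "S / 2500 < max X Y ^ 2")
    case True
    show ?thesis
    proof (cases "Y \<le> X")
      case True
      then have "Y\<^sup>2 \<le> (2502 * e)\<^sup>2 * X\<^sup>2 \<and> S / 2500 < X\<^sup>2"
        using \<open>S / 2500 < max X Y ^ 2\<close> nn XY dominated[of Y X] by (auto simp: max_def)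
      then show ?thesis unfolding X_def Y_def S_def by blast
    next
      case False
      then have "X\<^sup>2 \<le> (2502 * e)\<^sup>2 * Y\<^sup>2 \<and> S / 2500 < Y\<^sup>2"
        using \<open>S / 2500 < max X Y ^ 2\<close> nn XY dominated[of X Y] by (auto simp: max_def mult.commute add_ac)
      then show ?thesis unfolding X_def Y_def S_def by blast
    qed
  next
    case False
    have "X\<^sup>2 \<le> max X Y ^ 2" "Y\<^sup>2 \<le> max X Y ^ 2" using nn by (auto intro!: power_mono)
    then have small: "X\<^sup>2 \<le> S / 2500" "Y\<^sup>2 \<le> S / 2500" using False by linarith+
    have "e * (X\<^sup>2 + Y\<^sup>2 + S) \<le> e * (2 * S)" using small nn eps by (intro mult_left_mono) auto
    then have "Y * X \<le> 2 * e * S" using XY by (simp add: mult_ac)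
    also have "\<dots> \<le> 2 * e * (1 + S)" using eps by simp
    finally have "(Y * X)\<^sup>2 \<le> (2 * e * (1 + S))\<^sup>2" using nn by (intro power_mono) auto
    then have prod: "Y\<^sup>2 * X\<^sup>2 \<le> 4 * e\<^sup>2 * (1 + S)\<^sup>2" by (simp add: power_mult_distrib)
    \<comment> \<open>Removing two coefficients of squared modulus at most \<open>S / 2500\<close>
      costs little: Young's inequality with weights 21/20 and 21, together with
      \<open>e \<le> 1 / 20\<close>, gives about 1.14 times \<open>S\<close>, below the 6/5
      required.\<close>
    have flat: "(cmod (trig_poly J l x (uroot Q r)))\<^sup>2 \<le> 6 / 5 * S" if "r < Q" for r
    proof -
      let ?z = "uroot Q r"
      define P where "P = cmod (trig_poly L l x ?z)"
      define D where "D = X + Y"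
      have "trig_poly L l x ?z = x a * ?z ^ l a + (x b * ?z ^ l b + trig_poly J l x ?z)"
        unfolding Ldec(1) trig_poly_def using Ldec by simp
      then have "trig_poly J l x ?z = trig_poly L l x ?z - (x a * ?z ^ l a + x b * ?z ^ l b)" by simp
      then have "cmod (trig_poly J l x ?z) \<le> P + cmod (x a * ?z ^ l a + x b * ?z ^ l b)"
        unfolding P_def by (metis norm_triangle_ineq4)
      also have "cmod (x a * ?z ^ l a + x b * ?z ^ l b) \<le> D"
        unfolding D_def X_def Y_def by (rule order_trans[OF norm_triangle_ineq]) (simp add: norm_mult norm_power)
      finally have "cmod (trig_poly J l x ?z) \<le> P + D" by simp
      then have "(cmod (trig_poly J l x ?z))\<^sup>2 \<le> (P + D)\<^sup>2" by (intro power_mono) auto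
      also have "\<dots> \<le> 21 / 20 * P\<^sup>2 + 21 * D\<^sup>2"
      proof -
        have "0 \<le> (P - 20 * D)\<^sup>2 / 20" by simp
        then show ?thesis by (simp add: power2_eq_square algebra_simps)
      qed
      also have "P\<^sup>2 \<le> 21 / 20 * (S + 2 * (S / 2500))"
      proof -
        have "P\<^sup>2 \<le> (1 + e) * (X\<^sup>2 + (Y\<^sup>2 + S))" using peak[OF that] unfolding SL P_def .
        also have "\<dots> \<le> 21 / 20 * (S + 2 * (S / 2500))"
          using small eps nn by (intro mult_mono) auto
        finally show ?thesis .
      qed
      also have "D\<^sup>2 \<le> 4 * (S / 2500)"
      proof -
        have "D\<^sup>2 \<le> 2 * X\<^sup>2 + 2 * Y\<^sup>2"
          using sum_squares_bound[of X Y] by (simp add: D_def power2_eq_square algebra_simps)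
        then show ?thesis using small by linarith
      qed
      finally show ?thesis using nn by simp
    qed
    have "root_avg Q (\<lambda>\<zeta>. (cmod (trig_poly J l x \<zeta>)) ^ 4) \<le> root_avg Q (\<lambda>\<zeta>. (6 / 5 * S) * (cmod (trig_poly J l x \<zeta>))\<^sup>2)"
    proof (rule root_avg_mono)
      fix r assume "r < Q"
      have "(cmod (trig_poly J l x (uroot Q r)))\<^sup>2 * (cmod (trig_poly J l x (uroot Q r)))\<^sup>2 \<le>
          (6 / 5 * S) * (cmod (trig_poly J l x (uroot Q r)))\<^sup>2"
        using flat[OF \<open>r < Q\<close>] by (rule mult_right_mono) simp
      then show "(cmod (trig_poly J l x (uroot Q r))) ^ 4 \<le> (6 / 5 * S) * (cmod (trig_poly J l x (uroot Q r)))\<^sup>2"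
        by (simp flip: power_add)
    qed
    also have "\<dots> = (6 / 5 * S) * S"
    proof -
      have "inj_on l J" using L(2) by (rule inj_on_subset) (auto simp: J_def)
      moreover have "l \<alpha> < Q" if "\<alpha> \<in> J" for \<alpha> using Q[of \<alpha>] that by (simp add: J_def)
      ultimately have "root_avg Q (\<lambda>\<zeta>. (cmod (trig_poly J l x \<zeta>))\<^sup>2) = S"
        unfolding S_def using Ldec(4) by (intro root_avg_norm_square)
      then show ?thesis unfolding root_avg_cmult by simp
    qed
    finally have "x \<in> flat_event Q J l"
      unfolding flat_event_def mem_Collect_eq unfolding S_def[symmetric] unfolding power2_eq_square by simp
    then show ?thesis using prod unfolding X_def Y_def S_def by blast
  qed
qed

text \<open>If the threshold exceeds 1, the right side exceeds 1; otherwise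
  \<open>cgauss_pair_product_small\<close> applies. Writing \<open>1 + s\<close> in place of
  \<open>s\<close> keeps the threshold above \<open>e\<^sup>2\<close>, so the logarithm depends on
  \<open>e\<close> alone.\<close>

lemma emeasure_peak_event_pointwise:
  assumes "0 < e" "e \<le> 1 / 20" "s \<ge> 0"
  shows "(\<integral>\<^sup>+w. \<integral>\<^sup>+z. indicator {z. (cmod w)\<^sup>2 * (cmod z)\<^sup>2 \<le> 4 * e\<^sup>2 * (1 + s)\<^sup>2} z \<partial>cgauss \<partial>cgauss)
    \<le> ennreal (8 * e\<^sup>2 * (1 + ln (1 / e)) * (1 + s)\<^sup>2)"
proof -
  define u where "u = 4 * e\<^sup>2 * (1 + s)\<^sup>2"
  have u0: "u > 0" using assms by (simp add: u_def zero_less_mult_iff)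
  have le: "0 \<le> ln (1 / e)" using assms by (intro ln_ge_zero) simp
  show ?thesis
  proof (cases "u \<le> 1")
    case True
    have "(\<integral>\<^sup>+w. \<integral>\<^sup>+z. indicator {z. (cmod w)\<^sup>2 * (cmod z)\<^sup>2 \<le> u} z \<partial>cgauss \<partial>cgauss) \<le> ennreal (u * (2 + ln (1 / u)))"
      using u0 True by (rule cgauss_pair_product_small)
    also have "\<dots> \<le> ennreal (u * (2 + 2 * ln (1 / e)))"
    proof (intro ennreal_leI mult_left_mono add_left_mono)
      have "1 \<le> (1 + s)\<^sup>2" using assms by (intro one_le_power) simp
      then have "1 \<le> 4 * (1 + s)\<^sup>2" by linarith
      then have "e\<^sup>2 * 1 \<le> e\<^sup>2 * (4 * (1 + s)\<^sup>2)" by (intro mult_left_mono) auto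
      then have "e\<^sup>2 \<le> u" by (simp add: u_def mult_ac)
      then have "1 / u \<le> 1 / e\<^sup>2" using assms by (intro divide_left_mono) (auto simp: u0)
      then have "ln (1 / u) \<le> ln (1 / e\<^sup>2)" using u0 assms by (subst ln_le_cancel_iff) auto
      also have "\<dots> = 2 * ln (1 / e)" using assms by (simp add: ln_div ln_realpow)
      finally show "ln (1 / u) \<le> 2 * ln (1 / e)" .
    qed (use u0 in simp)
    also have "u * (2 + 2 * ln (1 / e)) = 8 * e\<^sup>2 * (1 + ln (1 / e)) * (1 + s)\<^sup>2"
      unfolding u_def by (simp add: algebra_simps)
    finally show ?thesis unfolding u_def .
  next
    case False
    have "(\<integral>\<^sup>+w. \<integral>\<^sup>+z. indicator {z. (cmod w)\<^sup>2 * (cmod z)\<^sup>2 \<le> u} z \<partial>cgauss \<partial>cgauss) \<le> (\<integral>\<^sup>+w. \<integral>\<^sup>+z. 1 \<partial>cgauss \<partial>cgauss)"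
      by (intro nn_integral_mono) (simp add: indicator_def)
    also have "\<dots> = ennreal 1" using cgauss.emeasure_space_1 by simp
    also have "\<dots> \<le> ennreal (8 * e\<^sup>2 * (1 + ln (1 / e)) * (1 + s)\<^sup>2)"
    proof (intro ennreal_leI)
      have "u * 1 \<le> u * (2 * (1 + ln (1 / e)))" using u0 le by (intro mult_left_mono) auto
      moreover have "u * (2 * (1 + ln (1 / e))) = 8 * e\<^sup>2 * (1 + ln (1 / e)) * (1 + s)\<^sup>2"
        by (simp add: u_def)
      ultimately show "1 \<le> 8 * e\<^sup>2 * (1 + ln (1 / e)) * (1 + s)\<^sup>2" using False by linarith
    qed
    finally show ?thesis unfolding u_def .
  qed
qed

lemma measurable_norm_square_cgauss: "(\<lambda>z. (cmod z)\<^sup>2) \<in> borel_measurable cgauss"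
  by measurable

lemmas measurable_norm_square_fst = measurable_compose[OF measurable_fst measurable_norm_square_cgauss, of cgauss]
  and measurable_norm_square_snd = measurable_compose[OF measurable_snd measurable_norm_square_cgauss, of cgauss]

lemma measurable_pair_indicator:
  assumes "{p \<in> space (cgauss \<Otimes>\<^sub>M cgauss). P (fst p) (snd p)} \<in> sets (cgauss \<Otimes>\<^sub>M cgauss)"
  shows "case_prod (\<lambda>w z. indicator {z. P w z} z :: ennreal) \<in> borel_measurable (cgauss \<Otimes>\<^sub>M cgauss)"
    and "(\<lambda>z. indicator {z. P w z} z :: ennreal) \<in> borel_measurable cgauss"
    and "(\<lambda>w. \<integral>\<^sup>+z. indicator {z. P w z} z \<partial>cgauss) \<in> borel_measurable cgauss"
proof -
  have "(\<lambda>p. indicator {p \<in> space (cgauss \<Otimes>\<^sub>M cgauss). P (fst p) (snd p)} p :: ennreal)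
      \<in> borel_measurable (cgauss \<Otimes>\<^sub>M cgauss)"
    using assms by (rule borel_measurable_indicator)
  then show pair: "case_prod (\<lambda>w z. indicator {z. P w z} z :: ennreal) \<in> borel_measurable (cgauss \<Otimes>\<^sub>M cgauss)"
    by (rule measurable_cong[THEN iffD1, rotated]) (simp add: indicator_def case_prod_beta)
  show "(\<lambda>w. \<integral>\<^sup>+z. indicator {z. P w z} z \<partial>cgauss) \<in> borel_measurable cgauss"
    using pair by (rule cgauss.borel_measurable_nn_integral)
  show "(\<lambda>z. indicator {z. P w z} z :: ennreal) \<in> borel_measurable cgauss"
    using measurable_Pair2[OF pair, of w] by simp
qed

lemma sets_pair_comparison:
  "{p \<in> space (cgauss \<Otimes>\<^sub>M cgauss). (cmod (fst p))\<^sup>2 \<le> c * (cmod (snd p))\<^sup>2 \<and> d < (cmod (snd p))\<^sup>2} \<in> sets (cgauss \<Otimes>\<^sub>M cgauss)"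
  "{p \<in> space (cgauss \<Otimes>\<^sub>M cgauss). (cmod (snd p))\<^sup>2 \<le> c * (cmod (fst p))\<^sup>2 \<and> d < (cmod (fst p))\<^sup>2} \<in> sets (cgauss \<Otimes>\<^sub>M cgauss)"
  "{p \<in> space (cgauss \<Otimes>\<^sub>M cgauss). (cmod (fst p))\<^sup>2 * (cmod (snd p))\<^sup>2 \<le> c} \<in> sets (cgauss \<Otimes>\<^sub>M cgauss)"
  by (intro sets.sets_Collect_conj borel_measurable_le borel_measurable_less borel_measurable_times
      borel_measurable_const measurable_norm_square_fst measurable_norm_square_snd)+

lemma cgauss_pair_swap:
  "(\<integral>\<^sup>+w. \<integral>\<^sup>+z. indicator {z. (cmod w)\<^sup>2 \<le> c * (cmod z)\<^sup>2 \<and> d < (cmod z)\<^sup>2} z \<partial>cgauss \<partial>cgauss) =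
   (\<integral>\<^sup>+z. \<integral>\<^sup>+w. indicator {w. (cmod w)\<^sup>2 \<le> c * (cmod z)\<^sup>2 \<and> d < (cmod z)\<^sup>2} w \<partial>cgauss \<partial>cgauss)"
proof -
  interpret P: pair_sigma_finite cgauss cgauss by unfold_locales
  have "(\<integral>\<^sup>+z. \<integral>\<^sup>+w. indicator {z. (cmod w)\<^sup>2 \<le> c * (cmod z)\<^sup>2 \<and> d < (cmod z)\<^sup>2} z \<partial>cgauss \<partial>cgauss) =
      (\<integral>\<^sup>+w. \<integral>\<^sup>+z. indicator {z. (cmod w)\<^sup>2 \<le> c * (cmod z)\<^sup>2 \<and> d < (cmod z)\<^sup>2} z \<partial>cgauss \<partial>cgauss)"
    by (rule P.Fubini'[OF measurable_pair_indicator(1)[OF sets_pair_comparison(1)]])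
  then show ?thesis unfolding indicator_def mem_Collect_eq by simp
qed

text \<open>Fubini with the two extreme coefficients innermost. Given the others, the first two
  alternatives of \<open>peak_event_cases\<close> have probability of order \<open>e\<^sup>2\<close>
  times \<open>exp (- s / 5000)\<close>, which integrates to geometric decay in the number of
  monomials. In the third the pair contributes the weight (1 + s)^2, and the remaining flatness
  condition is integrated by \<open>flat_event_weight\<close>.\<close>

lemma peak_event_bound:
  "\<exists>K>0. \<forall>(L :: 'i set) l Q e. finite L \<longrightarrow> card L \<ge> 2 \<longrightarrow> inj_on l L \<longrightarrow> (\<forall>\<alpha>\<in>L. 2 * l \<alpha> < Q) \<longrightarrow>
    0 < e \<longrightarrow> e \<le> 1 / 20 \<longrightarrow>
    (\<integral>\<^sup>+x. indicator (peak_event Q L l (1 + e)) x \<partial>gauss L) \<le> ennreal (K * e\<^sup>2 * (1 + ln (1 / e)) / card L)"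
proof -
  \<comment> \<open>The mean of \<open>exp (- t / 5000)\<close> for the squared modulus
    \<open>t\<close> of one coefficient. The 5000 is twice 2500, because
    \<open>cgauss_pair_comparison_small\<close> decays like \<open>exp (- (d / 2))\<close>.\<close>
  define q where "q = 1 / (1 - (- 1 / 5000) :: real)"
  have q: "0 \<le> q" "q < 1" by (simp_all add: q_def)
  obtain Kq where Kq: "Kq > 0" "\<And>n::nat. (1 + real n) ^ 3 * q ^ n \<le> Kq"
    using power_geometric_bounded[OF q] by blast
  obtain K1 where K1: "K1 > 0" "\<And>(L :: 'i set) l Q. finite L \<Longrightarrow> inj_on l L \<Longrightarrow> (\<forall>\<alpha>\<in>L. 2 * l \<alpha> < Q) \<Longrightarrow>
    (\<integral>\<^sup>+x. indicator (flat_event Q L l) x * ennreal ((1 + sum_pow L x 2)\<^sup>2) \<partial>gauss L) \<le> ennreal (K1 / (1 + card L))"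
    using flat_event_weight by blast
  define C where "C = 32 * 2502\<^sup>2 * Kq + 8 * K1"
  show ?thesis
  proof (intro exI[of _ "2 * C"] conjI allI impI)
    show "2 * C > 0" using Kq K1 by (simp add: C_def)
    fix L :: "'i set" and l :: "'i \<Rightarrow> nat" and Q :: nat and e :: real
    assume L: "finite L" "inj_on l L" and card: "card L \<ge> 2" and Q: "\<forall>\<alpha>\<in>L. 2 * l \<alpha> < Q"
      and e: "0 < e" "e \<le> 1 / 20"
    have ne: "L \<noteq> {}" using card by auto
    have "Max (l ` L) \<in> l ` L" "Min (l ` L) \<in> l ` L" using L ne by auto
    then obtain a b where a: "a \<in> L" "l a = Max (l ` L)" and b: "b \<in> L" "l b = Min (l ` L)" by auto
    have a': "l \<alpha> \<le> l a" and b': "l b \<le> l \<alpha>" if "\<alpha> \<in> L" for \<alpha>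
      using that L a b by auto
    have ab: "a \<noteq> b"
    proof
      assume eq: "a = b"
      have "\<alpha> = a" if "\<alpha> \<in> L" for \<alpha>
      proof (rule inj_onD[OF L(2) _ that a(1)])
        show "l \<alpha> = l a" using a'[OF that] b'[OF that] unfolding eq by (rule antisym)
      qed
      then have "L \<subseteq> {a}" by blast
      then have "card L \<le> card {a}" by (rule card_mono[rotated]) simp
      then show False using card by simp
    qed
    define J where "J = L - {a, b}"
    have Ldec: "L = insert a (insert b J)" "a \<notin> insert b J" "b \<notin> J" "finite J" "finite (insert b J)"
      using a(1) b(1) ab L(1) by (auto simp: J_def)
    define M where "M = real (card J)"
    have cardL: "real (card L) = M + 2" unfolding Ldec(1) M_def using Ldec by simp
    define c where "c = (2502 * e)\<^sup>2"
    let ?E = "\<lambda>x. indicator (peak_event Q L l (1 + e)) x :: ennreal"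
    define W where "W = 8 * e\<^sup>2 * (1 + ln (1 / e))"
    have lne: "0 \<le> ln (1 / e)" using e by (intro ln_ge_zero) simp
    have W0: "W \<ge> 0" using lne by (simp add: W_def)
    have mE: "?E \<in> borel_measurable (gauss (insert a (insert b J)))"
      using measurable_indicator_peak_event[of Q L l "1 + e"] Ldec(1) by simp
    have inner: "(\<integral>\<^sup>+w. \<integral>\<^sup>+z. ?E ((x(b := w))(a := z)) \<partial>cgauss \<partial>cgauss) \<le>
        ennreal (32 * c) * ennreal (exp ((- 1 / 5000) * sum_pow J x 2)) +
        ennreal W * (indicator (flat_event Q J l) x * ennreal ((1 + sum_pow J x 2)\<^sup>2))" for x
    proof -
      define s where "s = sum_pow J x 2"
      have s: "s \<ge> 0" by (simp add: s_def sum_nonneg)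
      let ?f1 = "\<lambda>w z. indicator {z. (cmod w)\<^sup>2 \<le> c * (cmod z)\<^sup>2 \<and> s / 2500 < (cmod z)\<^sup>2} z :: ennreal"
      let ?f2 = "\<lambda>w z. indicator {z. (cmod z)\<^sup>2 \<le> c * (cmod w)\<^sup>2 \<and> s / 2500 < (cmod w)\<^sup>2} z :: ennreal"
      let ?f3 = "\<lambda>w z. indicator {z. (cmod w)\<^sup>2 * (cmod z)\<^sup>2 \<le> 4 * e\<^sup>2 * (1 + s)\<^sup>2} z :: ennreal"
      let ?i = "indicator (flat_event Q J l) x :: ennreal"
      have pt: "?E ((x(b := w))(a := z)) \<le> ?f1 w z + ?f2 w z + ?i * ?f3 w z" for w z
      proof (cases "(x(b := w))(a := z) \<in> peak_event Q L l (1 + e)")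
        case True
        let ?x = "(x(b := w))(a := z)"
        have sJ: "sum_pow J ?x k = sum_pow J x k" for k
          using Ldec by (intro sum.cong) auto
        have tJ: "trig_poly J l ?x = trig_poly J l x"
          using Ldec by (intro trig_poly_cong) auto
        have fJ: "?x \<in> flat_event Q J l \<longleftrightarrow> x \<in> flat_event Q J l"
          unfolding flat_event_def mem_Collect_eq sJ tJ ..
        have v: "?x a = z" "?x b = w" using ab by auto
        have "(cmod w)\<^sup>2 \<le> c * (cmod z)\<^sup>2 \<and> s / 2500 < (cmod z)\<^sup>2 \<or>
            (cmod z)\<^sup>2 \<le> c * (cmod w)\<^sup>2 \<and> s / 2500 < (cmod w)\<^sup>2 \<or>
            x \<in> flat_event Q J l \<and> (cmod w)\<^sup>2 * (cmod z)\<^sup>2 \<le> 4 * e\<^sup>2 * (1 + s)\<^sup>2"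
          using peak_event_cases[OF L _ a(1) a' b(1) b' ab e True] Q
          unfolding J_def[symmetric] sJ fJ v c_def s_def by blast
        then show ?thesis
          by (elim disjE) (auto simp: indicator_def)
      qed simp
      have i3: "(\<integral>\<^sup>+w. \<integral>\<^sup>+z. ?f3 w z \<partial>cgauss \<partial>cgauss) \<le> ennreal (W * (1 + s)\<^sup>2)"
        unfolding W_def using e s by (rule emeasure_peak_event_pointwise)
      have i2: "(\<integral>\<^sup>+w. \<integral>\<^sup>+z. ?f2 w z \<partial>cgauss \<partial>cgauss) \<le> ennreal (16 * c * exp (- (s / 2500 / 2)))"
        using s by (intro cgauss_pair_comparison_small) (simp_all add: c_def)
      have i1: "(\<integral>\<^sup>+w. \<integral>\<^sup>+z. ?f1 w z \<partial>cgauss \<partial>cgauss) \<le> ennreal (16 * c * exp (- (s / 2500 / 2)))"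
        unfolding cgauss_pair_swap using s by (intro cgauss_pair_comparison_small) (simp_all add: c_def)
      have m1: "(\<lambda>w. \<integral>\<^sup>+z. ?f1 w z \<partial>cgauss) \<in> borel_measurable cgauss" "?f1 w \<in> borel_measurable cgauss"
        and m2: "(\<lambda>w. \<integral>\<^sup>+z. ?f2 w z \<partial>cgauss) \<in> borel_measurable cgauss" "?f2 w \<in> borel_measurable cgauss"
        and m3: "(\<lambda>w. \<integral>\<^sup>+z. ?f3 w z \<partial>cgauss) \<in> borel_measurable cgauss" "?f3 w \<in> borel_measurable cgauss" for w
        using measurable_pair_indicator(2,3)[OF sets_pair_comparison(1)] measurable_pair_indicator(2,3)[OF sets_pair_comparison(2)]
          measurable_pair_indicator(2,3)[OF sets_pair_comparison(3)] by blast+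
      have "(\<integral>\<^sup>+w. \<integral>\<^sup>+z. ?E ((x(b := w))(a := z)) \<partial>cgauss \<partial>cgauss) \<le>
          (\<integral>\<^sup>+w. \<integral>\<^sup>+z. (?f1 w z + ?f2 w z + ?i * ?f3 w z) \<partial>cgauss \<partial>cgauss)"
        by (intro nn_integral_mono pt)
      also have "\<dots> = (\<integral>\<^sup>+w. \<integral>\<^sup>+z. ?f1 w z \<partial>cgauss \<partial>cgauss) + (\<integral>\<^sup>+w. \<integral>\<^sup>+z. ?f2 w z \<partial>cgauss \<partial>cgauss) +
          ?i * (\<integral>\<^sup>+w. \<integral>\<^sup>+z. ?f3 w z \<partial>cgauss \<partial>cgauss)"
        using m1 m2 m3 by (simp only: nn_integral_add nn_integral_cmult borel_measurable_add borel_measurable_times_ennreal borel_measurable_const)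
      also have "\<dots> \<le> ennreal (16 * c * exp (- (s / 2500 / 2))) + ennreal (16 * c * exp (- (s / 2500 / 2))) +
          ?i * ennreal (W * (1 + s)\<^sup>2)"
        by (intro add_mono mult_left_mono i1 i2 i3) auto
      also have "ennreal (16 * c * exp (- (s / 2500 / 2))) + ennreal (16 * c * exp (- (s / 2500 / 2))) =
          ennreal (32 * c) * ennreal (exp ((- 1 / 5000) * s))"
        by (subst ennreal_plus[symmetric], simp_all add: c_def, subst ennreal_mult'[symmetric], simp_all add: mult_ac)
      also have "?i * ennreal (W * (1 + s)\<^sup>2) = ennreal W * (?i * ennreal ((1 + s)\<^sup>2))"
        using W0 by (simp add: ennreal_mult' mult_ac)
      finally show ?thesis by (simp only: s_def)
    qed
    have mexp: "(\<lambda>x. ennreal (exp ((- 1 / 5000) * sum_pow J x 2))) \<in> borel_measurable (gauss J)"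
      by (intro measurable_compose[OF measurable_sum_pow_gauss]) simp
    have mfl: "(\<lambda>x. indicator (flat_event Q J l) x * ennreal ((1 + sum_pow J x 2)\<^sup>2)) \<in> borel_measurable (gauss J)"
      by (intro borel_measurable_times_ennreal measurable_indicator_flat_event
          measurable_compose[OF measurable_sum_pow_gauss, where g = "\<lambda>s. ennreal ((1 + s)\<^sup>2)"]) simp
    have "(\<integral>\<^sup>+x. ?E x \<partial>gauss L) = (\<integral>\<^sup>+x. \<integral>\<^sup>+z. ?E (x(a := z)) \<partial>cgauss \<partial>gauss (insert b J))"
      unfolding Ldec(1) using Ldec mE by (intro cg.product_nn_integral_insert) (auto simp flip: Ldec(1))
    also have "\<dots> = (\<integral>\<^sup>+x. \<integral>\<^sup>+w. \<integral>\<^sup>+z. ?E ((x(b := w))(a := z)) \<partial>cgauss \<partial>cgauss \<partial>gauss J)"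
    proof (rule cg.product_nn_integral_insert[OF Ldec(4,3)])
      have "(\<lambda>p. (fst p)(a := snd p)) \<in> gauss (insert b J) \<Otimes>\<^sub>M cgauss \<rightarrow>\<^sub>M gauss (insert a (insert b J))"
        by (rule measurable_fun_upd[where J = "insert b J"]) auto
      from measurable_compose[OF this mE]
      have "case_prod (\<lambda>x z. ?E (x(a := z))) \<in> borel_measurable (gauss (insert b J) \<Otimes>\<^sub>M cgauss)"
        by (simp add: case_prod_beta')
      then show "(\<lambda>x. \<integral>\<^sup>+z. ?E (x(a := z)) \<partial>cgauss) \<in> borel_measurable (gauss (insert b J))"
        by (rule cgauss.borel_measurable_nn_integral)
    qed
    also have "\<dots> \<le> (\<integral>\<^sup>+x. ennreal (32 * c) * ennreal (exp ((- 1 / 5000) * sum_pow J x 2)) +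
        ennreal W * (indicator (flat_event Q J l) x * ennreal ((1 + sum_pow J x 2)\<^sup>2)) \<partial>gauss J)"
      by (intro nn_integral_mono inner)
    also have "\<dots> = ennreal (32 * c) * (\<integral>\<^sup>+x. ennreal (exp ((- 1 / 5000) * sum_pow J x 2)) \<partial>gauss J) +
        ennreal W * (\<integral>\<^sup>+x. indicator (flat_event Q J l) x * ennreal ((1 + sum_pow J x 2)\<^sup>2) \<partial>gauss J)"
      using mexp mfl by (simp only: nn_integral_add nn_integral_cmult borel_measurable_times_ennreal borel_measurable_const)
    also have "\<dots> \<le> ennreal (32 * c) * ennreal (q ^ card J) + ennreal W * ennreal (K1 / (1 + card J))"
    proof (intro add_mono mult_left_mono)
      show "(\<integral>\<^sup>+x. ennreal (exp ((- 1 / 5000) * sum_pow J x 2)) \<partial>gauss J) \<le> ennreal (q ^ card J)"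
        using nn_integral_gauss_exp_norm_square[OF Ldec(4), of "- 1 / 5000"] by (simp only: q_def)
      have "inj_on l J" using L(2) by (rule inj_on_subset) (auto simp: J_def)
      then show "(\<integral>\<^sup>+x. indicator (flat_event Q J l) x * ennreal ((1 + sum_pow J x 2)\<^sup>2) \<partial>gauss J) \<le> ennreal (K1 / (1 + card J))"
        using Ldec(4) Q by (intro K1(2)) (auto simp: J_def)
    qed auto
    also have "\<dots> = ennreal (32 * c * q ^ card J + W * (K1 / (1 + M)))"
    proof -
      have "ennreal (32 * c) * ennreal (q ^ card J) = ennreal (32 * c * q ^ card J)"
        by (rule ennreal_mult'[symmetric]) (simp add: c_def)
      moreover have "ennreal W * ennreal (K1 / (1 + card J)) = ennreal (W * (K1 / (1 + M)))"
        using W0 by (simp add: M_def ennreal_mult'[symmetric])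
      moreover have "0 \<le> 32 * c * q ^ card J" "0 \<le> W * (K1 / (1 + M))"
        using q W0 K1(1) by (simp_all add: c_def M_def)
      ultimately show ?thesis by (simp only: ennreal_plus)
    qed
    also have "\<dots> \<le> ennreal (2 * C * e\<^sup>2 * (1 + ln (1 / e)) / card L)"
    proof (intro ennreal_leI)
      have M0: "M \<ge> 0" by (simp add: M_def)
      have "(1 + M) * q ^ card J \<le> (1 + M) ^ 3 * q ^ card J"
        using M0 q self_le_power[of "1 + M" 3] by (intro mult_right_mono) auto
      also have "\<dots> \<le> Kq" unfolding M_def by (rule Kq(2))
      finally have "q ^ card J \<le> Kq / (1 + M)" using M0 by (simp add: pos_le_divide_eq mult.commute)
      then have "32 * c * q ^ card J \<le> 32 * c * (Kq / (1 + M))" by (intro mult_left_mono) (auto simp: c_def)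
      also have "\<dots> \<le> (32 * c * (Kq / (1 + M))) * (1 + ln (1 / e))"
      proof -
        have "0 \<le> 32 * c * (Kq / (1 + M))" using Kq M0 by (simp add: c_def)
        from mult_left_mono[OF _ this, of 1 "1 + ln (1 / e)"] show ?thesis using lne by simp
      qed
      finally have "32 * c * q ^ card J + W * (K1 / (1 + M)) \<le> C * e\<^sup>2 * (1 + ln (1 / e)) / (1 + M)"
        unfolding C_def W_def c_def by (simp add: power_mult_distrib algebra_simps add_divide_distrib)
      also have "\<dots> \<le> C * e\<^sup>2 * (1 + ln (1 / e)) * (2 / (M + 2))"
      proof -
        have "1 / (1 + M) \<le> 2 / (M + 2)" using M0 by (simp add: divide_simps)
        moreover have "0 \<le> C * e\<^sup>2 * (1 + ln (1 / e))" using Kq K1 lne by (simp add: C_def)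
        ultimately have "C * e\<^sup>2 * (1 + ln (1 / e)) * (1 / (1 + M)) \<le> C * e\<^sup>2 * (1 + ln (1 / e)) * (2 / (M + 2))"
          by (rule mult_left_mono)
        then show ?thesis by simp
      qed
      finally show "32 * c * q ^ card J + W * (K1 / (1 + M)) \<le> 2 * C * e\<^sup>2 * (1 + ln (1 / e)) / card L"
        unfolding cardL by (simp only: times_divide_eq_right mult_ac)
    qed
    finally show "(\<integral>\<^sup>+x. ?E x \<partial>gauss L) \<le> ennreal (2 * C * e\<^sup>2 * (1 + ln (1 / e)) / card L)" .
  qed
qed

section \<open>Moments of homogeneous polynomials\<close>

text \<open>Digit positions start at 1, hence the exponent \<open>Suc n\<close>. The alternative
  \<open>n = 0\<close> covers the empty sum when \<open>B = 0\<close>.\<close>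

lemma sum_digits_less:
  fixes f :: "nat \<Rightarrow> nat"
  assumes "\<And>j. j \<in> {1..n} \<Longrightarrow> f j < B"
  shows "(\<Sum>j=1..n. f j * B ^ j) < B ^ Suc n \<or> n = 0"
  using assms
proof (induction n)
  case (Suc n)
  have IH: "(\<Sum>j=1..n. f j * B ^ j) < B ^ Suc n \<or> n = 0" using Suc by simp
  have B: "B > 0" using Suc.prems[of 1] by simp
  then have "(\<Sum>j=1..n. f j * B ^ j) < B ^ Suc n" using IH by (cases "n = 0") auto
  moreover have "f (Suc n) * B ^ Suc n \<le> (B - 1) * B ^ Suc n"
    using Suc.prems[of "Suc n"] by (intro mult_right_mono) auto
  ultimately have "(\<Sum>j=1..n. f j * B ^ j) + f (Suc n) * B ^ Suc n < B ^ Suc n + (B - 1) * B ^ Suc n"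
    by (rule add_less_le_mono)
  then have "(\<Sum>j=1..Suc n. f j * B ^ j) < B ^ Suc n + (B - 1) * B ^ Suc n" by simp
  also have "\<dots> = B ^ Suc (Suc n)" using B by (cases B) auto
  finally show ?case by simp
qed simp

text \<open>Division by \<open>B ^ Suc n\<close> reads off the top digit, since the lower digits
  together stay below the divisor; the rest is induction.\<close>

lemma digits_unique:
  fixes f g :: "nat \<Rightarrow> nat"
  assumes "\<And>j. j \<in> {1..n} \<Longrightarrow> f j < B" "\<And>j. j \<in> {1..n} \<Longrightarrow> g j < B"
    and "(\<Sum>j=1..n. f j * B ^ j) = (\<Sum>j=1..n. g j * B ^ j)" and "j \<in> {1..n}"
  shows "f j = g j"
  using assms
proof (induction n arbitrary: j)
  case (Suc n)
  have B: "B > 0" using Suc.prems(1)[of 1] by simp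
  define F where "F = (\<Sum>j=1..n. f j * B ^ j)"
  define G where "G = (\<Sum>j=1..n. g j * B ^ j)"
  have lt: "F < B ^ Suc n" "G < B ^ Suc n"
    unfolding F_def G_def using sum_digits_less[of n f B] sum_digits_less[of n g B] Suc.prems(1,2) B by (cases "n = 0"; force)+
  have eq: "F + f (Suc n) * B ^ Suc n = G + g (Suc n) * B ^ Suc n"
    using Suc.prems(3) by (simp add: F_def G_def)
  have "f (Suc n) = (F + f (Suc n) * B ^ Suc n) div B ^ Suc n" using lt by (subst div_mult_self1) (use B in auto)
  also have "\<dots> = g (Suc n)" unfolding eq using lt by (subst div_mult_self1) (use B in auto)
  finally have top: "f (Suc n) = g (Suc n)" .
  then have "F = G" using eq by simp
  then show ?case
    using Suc.IH[of j] Suc.prems top unfolding F_def G_def by (cases "j = Suc n") auto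
qed simp

text \<open>Kronecker substitution: the exponents of a multi-index become base-\<open>B\<close>
  digits. A base above all digit sums in question rules out carries, so even sums of several
  multi-indices can be recovered from their frequencies.\<close>

definition digit_freq :: "nat \<Rightarrow> nat \<Rightarrow> (nat \<Rightarrow> nat) \<Rightarrow> nat" where
  "digit_freq B n \<alpha> = (\<Sum>j=1..n. \<alpha> j * B ^ j)"

lemma multi_indices_le: "\<alpha> \<in> multi_indices m n \<Longrightarrow> j \<in> {1..n} \<Longrightarrow> \<alpha> j \<le> m"
  using member_le_sum[of j "{1..n}" \<alpha>] by (auto simp: multi_indices_def)

lemma inj_on_digit_freq:
  assumes "B > m" shows "inj_on (digit_freq B n) (multi_indices m n)"
proof (rule inj_onI)
  fix \<alpha> \<beta> assume ab: "\<alpha> \<in> multi_indices m n" "\<beta> \<in> multi_indices m n" "digit_freq B n \<alpha> = digit_freq B n \<beta>"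
  have "\<alpha> j = \<beta> j" if "j \<in> {1..n}" for j
    using ab(3) that assms multi_indices_le[OF ab(1)] multi_indices_le[OF ab(2)] unfolding digit_freq_def
    by (intro digits_unique[of n \<alpha> B \<beta> j]) (auto intro: le_less_trans)
  then show "\<alpha> = \<beta>" using ab by (intro PiE_ext[of _ "{1..n}" "\<lambda>_. UNIV"]) (auto simp: multi_indices_def)
qed

definition array_sums :: "nat \<Rightarrow> 'j set \<Rightarrow> ('j \<Rightarrow> nat) \<Rightarrow> (nat \<times> 'j \<Rightarrow> nat) set" where
  "array_sums k J \<gamma> = {u \<in> ({..<k} \<times> J) \<rightarrow>\<^sub>E UNIV. \<forall>j\<in>J. (\<Sum>i<k. u (i, j)) = \<gamma> j}"

text \<open>Every unit of the total is assigned to one of \<open>k\<close> rows. In the induction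
  one unit is taken from a nonzero column, and the array is recovered from the smaller one and the
  row that lost the unit.\<close>

lemma card_array_sums:
  assumes "finite J"
  shows "finite (array_sums k J \<gamma>) \<and> card (array_sums k J \<gamma>) \<le> k ^ (\<Sum>j\<in>J. \<gamma> j)"
proof (induction "\<Sum>j\<in>J. \<gamma> j" arbitrary: \<gamma>)
  case 0
  then have z: "\<gamma> j = 0" if "j \<in> J" for j using assms that by simp
  have sub: "array_sums k J \<gamma> \<subseteq> {\<lambda>p\<in>{..<k} \<times> J. 0}"
  proof
    fix u assume u: "u \<in> array_sums k J \<gamma>"
    then have "u (i, j) = 0" if "i < k" "j \<in> J" for i j
      using that z by (auto simp: array_sums_def)
    then have "u = (\<lambda>p\<in>{..<k} \<times> J. 0)"
      using u by (intro PiE_ext[of u "{..<k} \<times> J" "\<lambda>_. UNIV"]) (auto simp: array_sums_def)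
    then show "u \<in> {\<lambda>p\<in>{..<k} \<times> J. 0}" by simp
  qed
  have "card (array_sums k J \<gamma>) \<le> card {\<lambda>p\<in>{..<k} \<times> J. 0 :: nat}" by (rule card_mono[OF _ sub]) simp
  moreover have "finite (array_sums k J \<gamma>)" by (rule finite_subset[OF sub]) simp
  ultimately show ?case unfolding 0[symmetric] by simp
next
  case (Suc s)
  have "\<exists>j\<in>J. \<gamma> j > 0"
  proof (rule ccontr)
    assume "\<not> (\<exists>j\<in>J. \<gamma> j > 0)"
    then have "(\<Sum>j\<in>J. \<gamma> j) = 0" by (intro sum.neutral) simp
    then show False using Suc.hyps(2) by simp
  qed
  then obtain j where j: "j \<in> J" "\<gamma> j > 0" by blast
  define \<delta> where "\<delta> = \<gamma>(j := \<gamma> j - 1)"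
  have sd: "(\<Sum>j\<in>J. \<gamma> j) = Suc (\<Sum>j\<in>J. \<delta> j)"
  proof -
    have "(\<Sum>j\<in>J. \<gamma> j) = \<gamma> j + (\<Sum>j\<in>J - {j}. \<gamma> j)" "(\<Sum>j\<in>J. \<delta> j) = \<delta> j + (\<Sum>j\<in>J - {j}. \<delta> j)"
      using j assms by (simp_all only: sum.remove)
    moreover have "(\<Sum>j\<in>J - {j}. \<delta> j) = (\<Sum>j\<in>J - {j}. \<gamma> j)"
      by (intro sum.cong) (auto simp: \<delta>_def)
    ultimately show ?thesis using j by (simp add: \<delta>_def)
  qed
  then have s: "s = (\<Sum>j\<in>J. \<delta> j)" using Suc.hyps(2) by simp
  have IH: "finite (array_sums k J \<delta>)" "card (array_sums k J \<delta>) \<le> k ^ s"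
    using Suc.hyps(1)[OF s] s by auto
  define inc where "inc i u = u((i, j) := Suc (u (i, j)))" for i :: nat and u :: "nat \<times> 'a \<Rightarrow> nat"
  have sub: "array_sums k J \<gamma> \<subseteq> (\<Union>i<k. inc i ` array_sums k J \<delta>)"
  proof
    fix u assume u: "u \<in> array_sums k J \<gamma>"
    then have "(\<Sum>i<k. u (i, j)) = \<gamma> j" using j by (simp add: array_sums_def)
    then have "(\<Sum>i<k. u (i, j)) > 0" using j by (simp only:)
    have "\<exists>i<k. u (i, j) > 0"
    proof (rule ccontr)
      assume "\<not> (\<exists>i<k. u (i, j) > 0)"
      then have "(\<Sum>i<k. u (i, j)) = 0" by (intro sum.neutral) simp
      then show False using \<open>(\<Sum>i<k. u (i, j)) > 0\<close> by simp
    qed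
    then obtain i where i: "i < k" "u (i, j) > 0" by blast
    define v where "v = u((i, j) := u (i, j) - 1)"
    have "inc i v = u" using i by (simp add: inc_def v_def)
    moreover have "v \<in> array_sums k J \<delta>"
    proof -
      have "(\<Sum>i'<k. v (i', j')) = \<delta> j'" if j': "j' \<in> J" for j'
      proof (cases "j' = j")
        case True
        have "(\<Sum>i'<k. u (i', j)) = u (i, j) + (\<Sum>i'\<in>{..<k} - {i}. u (i', j))"
          using i by (intro sum.remove) auto
        moreover have "(\<Sum>i'<k. v (i', j)) = v (i, j) + (\<Sum>i'\<in>{..<k} - {i}. v (i', j))"
          using i by (intro sum.remove) auto
        moreover have "(\<Sum>i'\<in>{..<k} - {i}. v (i', j)) = (\<Sum>i'\<in>{..<k} - {i}. u (i', j))"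
          by (intro sum.cong) (auto simp: v_def)
        ultimately show ?thesis using u j i True by (simp add: array_sums_def \<delta>_def v_def)
      next
        case False
        then have "(\<Sum>i'<k. v (i', j')) = (\<Sum>i'<k. u (i', j'))" by (simp add: v_def)
        then show ?thesis using u j' False by (simp add: array_sums_def \<delta>_def)
      qed
      moreover have "v \<in> ({..<k} \<times> J) \<rightarrow>\<^sub>E UNIV"
        using u i j unfolding v_def array_sums_def by (auto simp: PiE_iff extensional_def)
      ultimately show ?thesis unfolding array_sums_def by blast
    qed
    ultimately show "u \<in> (\<Union>i<k. inc i ` array_sums k J \<delta>)" using i by blast
  qed
  have fin: "finite (\<Union>i<k. inc i ` array_sums k J \<delta>)" using IH by simp
  have "card (array_sums k J \<gamma>) \<le> card (\<Union>i<k. inc i ` array_sums k J \<delta>)"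
    using fin sub by (rule card_mono)
  also have "\<dots> \<le> (\<Sum>i<k. card (inc i ` array_sums k J \<delta>))" by (rule card_UN_le) simp
  also have "\<dots> \<le> (\<Sum>i<k. k ^ s)" by (intro sum_mono order_trans[OF card_image_le[OF IH(1)] IH(2)])
  also have "\<dots> = k ^ Suc s" by simp
  finally show ?case using finite_subset[OF sub fin] unfolding Suc.hyps(2)[symmetric] by blast
qed

text \<open>Hypercontractivity for homogeneous polynomials: the \<open>2 k\<close>-th moment counts pairs of
  \<open>k\<close>-tuples of multi-indices with equal sums, and a sum of total degree \<open>k m\<close> splits into \<open>k\<close>
  pieces in at most \<open>k ^ (k m)\<close> ways.\<close>

lemma card_equal_sum_tuples:
  assumes Lam: "\<Lambda> \<subseteq> multi_indices m n" and v: "v \<in> {..<k} \<rightarrow>\<^sub>E \<Lambda>" and B: "B > m * k"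
  shows "card {w \<in> {..<k} \<rightarrow>\<^sub>E \<Lambda>. (\<Sum>i<k. digit_freq B n (v i)) = (\<Sum>i<k. digit_freq B n (w i))} \<le> k ^ (m * k)"
proof -
  define \<gamma> where "\<gamma> j = (\<Sum>i<k. v i j)" for j
  let ?W = "{w \<in> {..<k} \<rightarrow>\<^sub>E \<Lambda>. (\<Sum>i<k. digit_freq B n (v i)) = (\<Sum>i<k. digit_freq B n (w i))}"
  let ?\<phi> = "\<lambda>w. \<lambda>p\<in>{..<k} \<times> {1..n}. w (fst p) (snd p) :: nat"
  have freq: "(\<Sum>i<k. digit_freq B n (w i)) = (\<Sum>j=1..n. (\<Sum>i<k. w i j) * B ^ j)" for w
    unfolding digit_freq_def by (subst sum.swap) (simp add: sum_distrib_right)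
  have le: "(\<Sum>i<k. w i j) < B" if "w \<in> {..<k} \<rightarrow>\<^sub>E \<Lambda>" "j \<in> {1..n}" for w j
  proof -
    have "(\<Sum>i<k. w i j) \<le> (\<Sum>i<k. m)"
      using that Lam multi_indices_le by (intro sum_mono) (auto simp: PiE_iff subset_iff)
    then show ?thesis using B by (simp add: mult.commute)
  qed
  have img: "?\<phi> ` ?W \<subseteq> array_sums k {1..n} \<gamma>"
  proof
    fix u assume "u \<in> ?\<phi> ` ?W"
    then obtain w where w: "w \<in> {..<k} \<rightarrow>\<^sub>E \<Lambda>" "(\<Sum>i<k. digit_freq B n (v i)) = (\<Sum>i<k. digit_freq B n (w i))" "u = ?\<phi> w"
      by auto
    have "(\<Sum>i<k. w i j) = \<gamma> j" if "j \<in> {1..n}" for j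
      unfolding \<gamma>_def using w(2) le[OF w(1)] le[OF v] that unfolding freq
      by (intro digits_unique[of n "\<lambda>j. \<Sum>i<k. w i j" B "\<lambda>j. \<Sum>i<k. v i j" j]) auto
    then show "u \<in> array_sums k {1..n} \<gamma>" by (auto simp: w(3) array_sums_def)
  qed
  have inj: "inj_on ?\<phi> ?W"
  proof (rule inj_onI)
    fix w w' assume w: "w \<in> ?W" "w' \<in> ?W" "?\<phi> w = ?\<phi> w'"
    have "w i = w' i" if i: "i < k" for i
    proof -
      have "w i \<in> multi_indices m n" "w' i \<in> multi_indices m n" using w i Lam by (auto simp: PiE_iff)
      moreover have "w i j = w' i j" if "j \<in> {1..n}" for j
        using fun_cong[OF w(3), of "(i, j)"] i that by simp
      ultimately show ?thesis by (intro PiE_ext[of _ "{1..n}" "\<lambda>_. UNIV"]) (auto simp: multi_indices_def)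
    qed
    then show "w = w'" using w by (intro PiE_ext[of w "{..<k}" "\<lambda>_. \<Lambda>"]) auto
  qed
  have "(\<Sum>j=1..n. \<gamma> j) = (\<Sum>i<k. \<Sum>j=1..n. v i j)" unfolding \<gamma>_def by (rule sum.swap)
  also have "\<dots> = (\<Sum>i<k. m)"
    using v Lam by (intro sum.cong refl) (auto simp: PiE_iff multi_indices_def subset_iff)
  finally have "(\<Sum>j=1..n. \<gamma> j) = m * k" by simp
  then show ?thesis
    using card_inj_on_le[OF inj img] card_array_sums[of "{1..n}" k \<gamma>] by fastforce
qed

text \<open>The \<open>k\<close>-th power is a polynomial indexed by \<open>k\<close>-tuples with
  coefficients of modulus at most 1. By orthogonality its mean square is a sum over pairs of tuples
  with equal frequency, and each tuple has at most \<open>k ^ (m * k)\<close> partners.\<close>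

lemma root_avg_moment_bound:
  fixes b :: "(nat \<Rightarrow> nat) \<Rightarrow> complex"
  assumes Lam: "\<Lambda> \<subseteq> multi_indices m n" and B: "B > m * k"
    and Q: "\<And>\<alpha>. \<alpha> \<in> \<Lambda> \<Longrightarrow> k * digit_freq B n \<alpha> < Q" and b: "\<And>\<alpha>. \<alpha> \<in> \<Lambda> \<Longrightarrow> cmod (b \<alpha>) \<le> 1"
    and k: "k > 0"
  shows "root_avg Q (\<lambda>\<zeta>. (cmod (trig_poly \<Lambda> (digit_freq B n) b \<zeta>)) ^ (2 * k)) \<le> real (card \<Lambda>) ^ k * real k ^ (m * k)"
proof -
  have fin: "finite \<Lambda>" using Lam finite_multi_indices finite_subset by blast
  define V where "V = ({..<k} \<rightarrow>\<^sub>E \<Lambda>)"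
  define f where "f v = (\<Sum>i<k. digit_freq B n (v i))" for v
  define c where "c v = (\<Prod>i<k. b (v i))" for v
  have finV: "finite V" using fin by (simp add: V_def finite_PiE)
  have pow: "(trig_poly \<Lambda> (digit_freq B n) b \<zeta>) ^ k = trig_poly V f c \<zeta>" for \<zeta>
  proof -
    have "(trig_poly \<Lambda> (digit_freq B n) b \<zeta>) ^ k = (\<Prod>i<k. \<Sum>\<alpha>\<in>\<Lambda>. b \<alpha> * \<zeta> ^ digit_freq B n \<alpha>)"
      by (simp add: trig_poly_def)
    also have "\<dots> = (\<Sum>v\<in>V. \<Prod>i<k. b (v i) * \<zeta> ^ digit_freq B n (v i))"
      unfolding V_def using fin by (intro prod_sum_PiE) auto
    finally show ?thesis
      by (simp add: trig_poly_def c_def f_def prod.distrib power_sum)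
  qed
  have fQ: "f v < Q" if "v \<in> V" for v
  proof -
    have ne: "\<Lambda> \<noteq> {}" using that k by (auto simp: V_def PiE_iff)
    define M where "M = Max (digit_freq B n ` \<Lambda>)"
    have "f v \<le> (\<Sum>i<k. M)"
      unfolding f_def using that fin by (intro sum_mono) (auto simp: V_def PiE_iff M_def intro!: Max_ge)
    also have "\<dots> = k * M" by simp
    also have "M \<in> digit_freq B n ` \<Lambda>" unfolding M_def using fin ne by (intro Max_in) auto
    then have "k * M < Q" using Q by auto
    finally show ?thesis .
  qed
  have c1: "cmod (c v) \<le> 1" if "v \<in> V" for v
    unfolding c_def prod_norm[symmetric] using that b by (intro prod_le_1) (auto simp: V_def PiE_iff)
  let ?P = "{x \<in> V \<times> V. f (fst x) = f (snd x)}"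
  have "complex_of_real (root_avg Q (\<lambda>\<zeta>. (cmod (trig_poly V f c \<zeta>))\<^sup>2)) = (\<Sum>x\<in>?P. c (fst x) * cnj (c (snd x)))"
    unfolding root_avg_of_real trig_poly_norm_square using finV fQ by (intro root_avg_sum) auto
  then have "root_avg Q (\<lambda>\<zeta>. (cmod (trig_poly V f c \<zeta>))\<^sup>2) = Re (\<Sum>x\<in>?P. c (fst x) * cnj (c (snd x)))"
    by (metis Re_complex_of_real)
  also have "\<dots> \<le> (\<Sum>x\<in>?P. 1)"
    unfolding Re_sum
  proof (intro sum_mono)
    fix x assume x: "x \<in> ?P"
    have "cmod (c (fst x) * cnj (c (snd x))) \<le> 1"
      using x c1 by (auto simp: norm_mult intro!: mult_le_one)
    then show "Re (c (fst x) * cnj (c (snd x))) \<le> 1" using complex_Re_le_cmod order_trans by blast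
  qed
  also have "\<dots> = real (card ?P)" by simp
  also have "?P = (SIGMA v:V. {w \<in> V. f v = f w})" by auto
  also have "real (card (SIGMA v:V. {w \<in> V. f v = f w})) = real (\<Sum>v\<in>V. card {w \<in> V. f v = f w})"
    using finV by (subst card_SigmaI) auto
  also have "\<dots> \<le> real (\<Sum>v\<in>V. k ^ (m * k))"
    unfolding V_def f_def using Lam B by (intro of_nat_mono sum_mono card_equal_sum_tuples) auto
  also have "\<dots> = real (card \<Lambda>) ^ k * real k ^ (m * k)"
    by (simp add: V_def card_PiE)
  finally show ?thesis
    by (simp add: pow[symmetric] norm_power power_mult[symmetric] mult.commute)
qed

section \<open>Many monomials\<close>

text \<open>Chernoff bound with parameter 1/2: the exponential moment is 2^N, against a threshold
  factor exp (-N).\<close>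

lemma gauss_norm_square_large:
  assumes "finite L"
  shows "measure (gauss L) {x \<in> space (gauss L). 2 * real (card L) < sum_pow L x 2} \<le> (2 / exp 1) ^ card L"
proof -
  let ?A = "{x \<in> space (gauss L). 2 * real (card L) < sum_pow L x 2}"
  have A: "?A \<in> sets (gauss L)"
    by (intro borel_measurable_less borel_measurable_const measurable_sum_pow_gauss)
  have m: "(\<lambda>x. ennreal (exp (1 / 2 * sum_pow L x 2))) \<in> borel_measurable (gauss L)"
    by (intro measurable_compose[OF measurable_sum_pow_gauss]) simp
  have "emeasure (gauss L) ?A = (\<integral>\<^sup>+x. indicator ?A x \<partial>gauss L)"
    using A by simp
  also have "\<dots> \<le> (\<integral>\<^sup>+x. ennreal (exp (- real (card L))) * ennreal (exp (1 / 2 * sum_pow L x 2)) \<partial>gauss L)"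
  proof (intro nn_integral_mono)
    fix x
    show "indicator ?A x \<le> ennreal (exp (- real (card L))) * ennreal (exp (1 / 2 * sum_pow L x 2))"
    proof (cases "x \<in> ?A")
      case True
      have "1 \<le> exp (- real (card L) + 1 / 2 * sum_pow L x 2)"
        using True by (subst one_le_exp_iff) simp
      then have "ennreal 1 \<le> ennreal (exp (- real (card L)) * exp (1 / 2 * sum_pow L x 2))"
        unfolding exp_add by (rule ennreal_leI)
      then show ?thesis using True by (simp add: ennreal_mult')
    qed simp
  qed
  also have "\<dots> = ennreal (exp (- real (card L))) * ennreal ((1 / (1 - 1 / 2)) ^ card L)"
    using m nn_integral_gauss_exp_norm_square[OF assms, of "1 / 2"] by (subst nn_integral_cmult) auto
  also have "\<dots> = ennreal (exp (- real (card L)) * 2 ^ card L)"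
    by (subst ennreal_mult') simp_all
  also have "exp (- real (card L)) * 2 ^ card L = (2 / exp 1) ^ card L"
    by (simp add: exp_minus power_divide field_simps flip: exp_of_nat_mult)
  finally show ?thesis
    unfolding measure_def by (rule enn2real_leI[rotated]) simp
qed

lemma nn_integral_gauss_exp_linear:
  assumes "finite L"
  shows "(\<integral>\<^sup>+x. ennreal (exp (Re (\<Sum>\<alpha>\<in>L. w \<alpha> * x \<alpha>))) \<partial>gauss L) = ennreal (exp ((\<Sum>\<alpha>\<in>L. (cmod (w \<alpha>))\<^sup>2) / 4))"
proof -
  have "(\<integral>\<^sup>+x. ennreal (exp (Re (\<Sum>\<alpha>\<in>L. w \<alpha> * x \<alpha>))) \<partial>gauss L) =
      (\<integral>\<^sup>+x. (\<Prod>\<alpha>\<in>L. ennreal (exp (Re (w \<alpha> * x \<alpha>)))) \<partial>gauss L)"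
    unfolding Re_sum exp_sum[OF assms] by (simp add: prod_ennreal)
  also have "\<dots> = (\<Prod>\<alpha>\<in>L. \<integral>\<^sup>+z. ennreal (exp (Re (w \<alpha> * z))) \<partial>cgauss)"
    using assms by (intro nn_integral_gauss_prod) auto
  also have "\<dots> = (\<Prod>\<alpha>\<in>L. ennreal (exp ((cmod (w \<alpha>))\<^sup>2 / 4)))"
    by (simp only: nn_integral_cgauss_exp_Re)
  also have "\<dots> = ennreal (exp ((\<Sum>\<alpha>\<in>L. (cmod (w \<alpha>))\<^sup>2) / 4))"
    unfolding sum_divide_distrib exp_sum[OF assms] by (simp add: prod_ennreal)
  finally show ?thesis .
qed

lemma (in prob_space) second_moment_lower_tail:
  assumes f: "f \<in> borel_measurable M" "\<And>x. 0 \<le> f x"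
    and a: "(\<integral>\<^sup>+x. ennreal (f x) \<partial>M) = ennreal a" "a > 0"
    and b: "(\<integral>\<^sup>+x. ennreal ((f x)\<^sup>2) \<partial>M) = ennreal b" "b \<ge> 0"
  shows "prob {x \<in> space M. f x \<le> a / 2} \<le> 4 * (b / a\<^sup>2 - 1)"
proof -
  have i1: "integrable M f" "expectation f = a"
    using nn_integral_eq_integrable[of f M a] f a by auto
  have i2: "integrable M (\<lambda>x. (f x)\<^sup>2)" "expectation (\<lambda>x. (f x)\<^sup>2) = b"
    using nn_integral_eq_integrable[of "\<lambda>x. (f x)\<^sup>2" M b] f b by auto
  have "prob {x \<in> space M. f x \<le> a / 2} \<le> prob {x \<in> space M. a / 2 \<le> \<bar>f x - expectation f\<bar>}"
    using f(1) a(2) unfolding i1(2)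
    by (intro finite_measure_mono subsetI) (auto simp: abs_if intro!: borel_measurable_le)
  also have "\<dots> \<le> variance f / (a / 2)\<^sup>2"
    using f i2 a by (intro Chebyshev_inequality) auto
  also have "variance f = b - a\<^sup>2"
    using variance_eq[OF i1(1) i2(1)] i1 i2 by simp
  also have "(b - a\<^sup>2) / (a / 2)\<^sup>2 = 4 * (b / a\<^sup>2 - 1)"
    using a by (simp add: field_simps power2_eq_square)
  finally show ?thesis .
qed

text \<open>Moments of the correlation help only up to order \<open>k0\<close>. Beyond it,
  \<open>r \<le> 1\<close> bounds each term by \<open>r ^ (2 * k0)\<close> times the corresponding
  term of \<open>cosh y\<close>.\<close>

lemma cosh_truncation:
  fixes f y r :: real
  assumes "\<bar>f\<bar> \<le> y * r" "0 \<le> r" "r \<le> 1" "0 \<le> y"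
  shows "cosh f \<le> (\<Sum>k<k0. y ^ (2 * k) / fact (2 * k) * r ^ (2 * k)) + exp y * r ^ (2 * k0)"
proof -
  have ser: "(\<lambda>k. x ^ (2 * k) / fact (2 * k)) sums cosh x" for x :: real
  proof -
    let ?c = "\<lambda>n. if even n then x ^ n /\<^sub>R fact n else 0"
    have "(\<lambda>k. ?c (2 * k)) sums cosh x \<longleftrightarrow> ?c sums cosh x"
      by (rule sums_mono_reindex) (auto simp: strict_mono_def elim!: evenE)
    then have "(\<lambda>k. x ^ (2 * k) /\<^sub>R fact (2 * k)) sums cosh x"
      using cosh_converges[of x] by simp
    then show ?thesis by (simp add: divide_inverse mult.commute)
  qed
  let ?t = "\<lambda>k. y ^ (2 * k) / fact (2 * k) * r ^ (2 * k)"
  let ?u = "\<lambda>k. r ^ (2 * k0) * (y ^ (2 * k) / fact (2 * k))"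
  have bound: "(\<lambda>k. (if k \<in> {..<k0} then ?t k else 0) + ?u k) sums ((\<Sum>k<k0. ?t k) + r ^ (2 * k0) * cosh y)"
    by (intro sums_add sums_mult ser sums_If_finite_set) simp
  have le: "f ^ (2 * k) / fact (2 * k) \<le> (if k \<in> {..<k0} then ?t k else 0) + ?u k" for k
  proof -
    have "\<bar>f\<bar> ^ (2 * k) \<le> (y * r) ^ (2 * k)" using assms by (intro power_mono) auto
    then have "f ^ (2 * k) \<le> y ^ (2 * k) * r ^ (2 * k)" by (simp add: power_mult_distrib power_even_abs)
    then have 1: "f ^ (2 * k) / fact (2 * k) \<le> ?t k" by (simp add: divide_right_mono)
    show ?thesis
    proof (cases "k < k0")
      case True
      have "0 \<le> ?u k" using assms by simp
      then show ?thesis using 1 True by (simp only: lessThan_iff if_True)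
    next
      case False
      then have "r ^ (2 * k) \<le> r ^ (2 * k0)" using assms by (intro power_decreasing) auto
      then have "?t k \<le> y ^ (2 * k) / fact (2 * k) * r ^ (2 * k0)" using assms by (intro mult_left_mono) auto
      then show ?thesis using 1 False by (simp add: mult.commute)
    qed
  qed
  have "cosh f \<le> (\<Sum>k<k0. ?t k) + r ^ (2 * k0) * cosh y"
    by (rule sums_le[OF le ser bound])
  also have "cosh y \<le> exp y" using assms by (simp add: cosh_def)
  then have "r ^ (2 * k0) * cosh y \<le> r ^ (2 * k0) * exp y" using assms by (intro mult_left_mono) auto
  finally show ?thesis by (simp add: mult.commute)
qed

text \<open>Second moment method for \<open>\<zeta> \<mapsto> exp (u Re p(\<zeta>))\<close>: two values of the Gaussian polynomial are
  correlated only through \<open>\<rho>(\<zeta>, \<eta>)\<close>, whose moments are controlled by hypercontractivity.\<close>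

lemma peak_event_second_moment:
  assumes Lam: "\<Lambda> \<subseteq> multi_indices m n" "\<Lambda> \<noteq> {}" and m: "m \<ge> 1" and k0: "k0 \<ge> 1" and B: "B > m * k0"
    and Q: "\<And>\<alpha>. \<alpha> \<in> \<Lambda> \<Longrightarrow> k0 * digit_freq B n \<alpha> < Q" and h: "h \<ge> 1"
  defines "N \<equiv> real (card \<Lambda>)"
  shows "measure (gauss \<Lambda>) (peak_event Q \<Lambda> (digit_freq B n) h \<inter> space (gauss \<Lambda>)) \<le>
    (2 / exp 1) ^ card \<Lambda> +
    8 * ((\<Sum>k\<in>{1..<k0}. (36 * h) ^ (2 * k) / fact (2 * k) * (real k ^ m / N) ^ k) + exp (36 * h) * (real k0 ^ m / N) ^ k0)"
proof -
  define l where "l = digit_freq B n"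
  have fin: "finite \<Lambda>" using Lam finite_multi_indices finite_subset by blast
  have N: "N \<ge> 1" using fin Lam by (simp add: N_def Suc_le_eq card_gt_0_iff)
  \<comment> \<open>With this \<open>u\<close> the mean of \<open>I\<close> is \<open>exp T\<close>,
    where \<open>T = 18 * h\<close>. On the event, if also \<open>S \<le> 2 * N\<close>, the
    exponent is at most \<open>u * sqrt (2 * h * N) = 12 * h\<close>. The gap
    \<open>exp (6 * h)\<close> covers the factor 2 lost in Chebyshev's inequality.\<close>
  define u where "u = sqrt (72 * h / N)"
  have u: "u > 0" "u\<^sup>2 = 72 * h / N" using h N by (simp_all add: u_def)
  define I where "I x = root_avg Q (\<lambda>\<zeta>. exp (u * Re (trig_poly \<Lambda> l x \<zeta>)))" for x
  define T where "T = 18 * h"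
  define y where "y = 36 * h"
  \<comment> \<open>For unimodular arguments this is the normalised correlation of the Gaussian
    values at \<zeta> and \<eta>. As a polynomial in \<zeta> it has unimodular coefficients up to
    the factor 1 / N, as \<open>root_avg_moment_bound\<close> requires.\<close>
  define R where "R \<zeta> \<eta> = trig_poly \<Lambda> l (\<lambda>\<alpha>. cnj \<eta> ^ l \<alpha>) \<zeta> / of_real N" for \<zeta> \<eta>
  define A where "A = root_avg Q (\<lambda>\<eta>. root_avg Q (\<lambda>\<zeta>. exp (y * Re (R \<zeta> \<eta>))))"
  obtain \<alpha>0 where \<alpha>0: "\<alpha>0 \<in> \<Lambda>" using Lam by auto
  have Q0: "Q > 0" using Q[OF \<alpha>0] by simp
  have lQ: "l \<alpha> < Q" if "\<alpha> \<in> \<Lambda>" for \<alpha>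
    using Q[OF that] k0 unfolding l_def by (cases k0) auto
  \<comment> \<open>Positive degree excludes a constant term, so the correlation has mean zero over
    the circle.\<close>
  have lpos: "l \<alpha> > 0" if "\<alpha> \<in> \<Lambda>" for \<alpha>
  proof (rule ccontr)
    assume "\<not> l \<alpha> > 0"
    then have "\<forall>j\<in>{1..n}. \<alpha> j * B ^ j = 0" by (simp add: l_def digit_freq_def)
    then have "\<forall>j\<in>{1..n}. \<alpha> j = 0" using B by auto
    then have "(\<Sum>j=1..n. \<alpha> j) = 0" by (intro sum.neutral) auto
    then show False using that Lam m by (auto simp: multi_indices_def)
  qed
  have mI: "I \<in> borel_measurable (gauss \<Lambda>)"
    unfolding I_def root_avg_def
    by (intro borel_measurable_divide borel_measurable_sum borel_measurable_const
        measurable_compose[OF measurable_trig_poly_gauss, where g = "\<lambda>z. exp (u * Re z)"]) measurable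
  have Inn: "I x \<ge> 0" for x by (auto simp: I_def root_avg_def intro!: divide_nonneg_nonneg sum_nonneg)
  have lin1: "(\<integral>\<^sup>+x. ennreal (exp (u * Re (trig_poly \<Lambda> l x \<zeta>))) \<partial>gauss \<Lambda>) = ennreal (exp T)" if "cmod \<zeta> = 1" for \<zeta>
  proof -
    have eq: "u * Re (trig_poly \<Lambda> l x \<zeta>) = Re (\<Sum>\<alpha>\<in>\<Lambda>. (of_real u * \<zeta> ^ l \<alpha>) * x \<alpha>)" for x
    proof -
      have "(\<Sum>\<alpha>\<in>\<Lambda>. (of_real u * \<zeta> ^ l \<alpha>) * x \<alpha>) = of_real u * trig_poly \<Lambda> l x \<zeta>"
        unfolding trig_poly_def sum_distrib_left by (intro sum.cong refl) (simp only: mult_ac)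
      then show ?thesis by simp
    qed
    have "(\<integral>\<^sup>+x. ennreal (exp (u * Re (trig_poly \<Lambda> l x \<zeta>))) \<partial>gauss \<Lambda>) =
        ennreal (exp ((\<Sum>\<alpha>\<in>\<Lambda>. (cmod (of_real u * \<zeta> ^ l \<alpha>))\<^sup>2) / 4))"
      unfolding eq by (rule nn_integral_gauss_exp_linear[OF fin])
    also have "(\<Sum>\<alpha>\<in>\<Lambda>. (cmod (of_real u * \<zeta> ^ l \<alpha>))\<^sup>2) / 4 = T"
      using that u N by (simp add: norm_mult norm_power T_def N_def)
    finally show ?thesis .
  qed
  have lin2: "(\<integral>\<^sup>+x. ennreal (exp (u * Re (trig_poly \<Lambda> l x \<zeta>)) * exp (u * Re (trig_poly \<Lambda> l x \<eta>))) \<partial>gauss \<Lambda>) =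
      ennreal (exp (2 * T) * exp (y * Re (R \<zeta> \<eta>)))" if "cmod \<zeta> = 1" "cmod \<eta> = 1" for \<zeta> \<eta>
  proof -
    have eq: "exp (u * Re (trig_poly \<Lambda> l x \<zeta>)) * exp (u * Re (trig_poly \<Lambda> l x \<eta>)) =
        exp (Re (\<Sum>\<alpha>\<in>\<Lambda>. (of_real u * (\<zeta> ^ l \<alpha> + \<eta> ^ l \<alpha>)) * x \<alpha>))" for x
    proof -
      have "(\<Sum>\<alpha>\<in>\<Lambda>. (of_real u * (\<zeta> ^ l \<alpha> + \<eta> ^ l \<alpha>)) * x \<alpha>) = of_real u * (trig_poly \<Lambda> l x \<zeta> + trig_poly \<Lambda> l x \<eta>)"
        by (simp add: trig_poly_def sum_distrib_left sum.distrib[symmetric] algebra_simps)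
      then show ?thesis by (simp add: exp_add[symmetric] distrib_left)
    qed
    have "(\<integral>\<^sup>+x. ennreal (exp (u * Re (trig_poly \<Lambda> l x \<zeta>)) * exp (u * Re (trig_poly \<Lambda> l x \<eta>))) \<partial>gauss \<Lambda>) =
        ennreal (exp ((\<Sum>\<alpha>\<in>\<Lambda>. (cmod (of_real u * (\<zeta> ^ l \<alpha> + \<eta> ^ l \<alpha>)))\<^sup>2) / 4))"
      unfolding eq by (rule nn_integral_gauss_exp_linear[OF fin])
    also have "(\<Sum>\<alpha>\<in>\<Lambda>. (cmod (of_real u * (\<zeta> ^ l \<alpha> + \<eta> ^ l \<alpha>)))\<^sup>2) / 4 = 2 * T + y * Re (R \<zeta> \<eta>)"
    proof -
      have sq: "(cmod (a + b))\<^sup>2 = 2 + 2 * Re (cnj b * a)" if "cmod a = 1" "cmod b = 1" for a b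
      proof -
        have "(cmod (a + b))\<^sup>2 = (cmod a)\<^sup>2 + (cmod b)\<^sup>2 + 2 * Re (cnj b * a)"
          unfolding cmod_power2 by (simp add: power2_eq_square algebra_simps)
        then show ?thesis using that by simp
      qed
      have "(\<Sum>\<alpha>\<in>\<Lambda>. (cmod (of_real u * (\<zeta> ^ l \<alpha> + \<eta> ^ l \<alpha>)))\<^sup>2) =
          (\<Sum>\<alpha>\<in>\<Lambda>. u\<^sup>2 * (2 + 2 * Re (cnj \<eta> ^ l \<alpha> * \<zeta> ^ l \<alpha>)))"
        using that by (intro sum.cong refl) (simp add: norm_mult power_mult_distrib sq norm_power)
      also have "\<dots> = u\<^sup>2 * (2 * N + 2 * Re (trig_poly \<Lambda> l (\<lambda>\<alpha>. cnj \<eta> ^ l \<alpha>) \<zeta>))"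
      proof -
        define g where "g \<alpha> = cnj \<eta> ^ l \<alpha> * \<zeta> ^ l \<alpha>" for \<alpha>
        have "Re (trig_poly \<Lambda> l (\<lambda>\<alpha>. cnj \<eta> ^ l \<alpha>) \<zeta>) = (\<Sum>\<alpha>\<in>\<Lambda>. Re (g \<alpha>))"
          unfolding trig_poly_def g_def by (rule Re_sum)
        then show ?thesis
          unfolding g_def[symmetric] by (simp add: sum_distrib_left[symmetric] sum.distrib N_def)
      qed
      also have "trig_poly \<Lambda> l (\<lambda>\<alpha>. cnj \<eta> ^ l \<alpha>) \<zeta> = of_real N * R \<zeta> \<eta>"
        using N by (simp add: R_def)
      also have "Re (of_real N * R \<zeta> \<eta>) = N * Re (R \<zeta> \<eta>)" by simp
      also have "u\<^sup>2 * (2 * N + 2 * (N * Re (R \<zeta> \<eta>))) = 4 * (2 * T + y * Re (R \<zeta> \<eta>))"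
        using N unfolding u(2) T_def y_def by (simp add: field_simps)
      finally show ?thesis by simp
    qed
    finally show ?thesis by (simp add: exp_add)
  qed
  have mexp: "(\<lambda>x. ennreal (exp (u * Re (trig_poly \<Lambda> l x \<zeta>)))) \<in> borel_measurable (gauss \<Lambda>)"
    "(\<lambda>x. ennreal (exp (u * Re (trig_poly \<Lambda> l x \<zeta>)) * exp (u * Re (trig_poly \<Lambda> l x \<eta>)))) \<in> borel_measurable (gauss \<Lambda>)" for \<zeta> \<eta>
  proof -
    have e: "(\<lambda>x. exp (u * Re (trig_poly \<Lambda> l x \<zeta>))) \<in> borel_measurable (gauss \<Lambda>)" for \<zeta>
      by (intro measurable_compose[OF measurable_trig_poly_gauss, where g = "\<lambda>z. exp (u * Re z)"]) measurable
    show "(\<lambda>x. ennreal (exp (u * Re (trig_poly \<Lambda> l x \<zeta>)))) \<in> borel_measurable (gauss \<Lambda>)"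
      by (rule measurable_compose[OF e measurable_ennreal])
    show "(\<lambda>x. ennreal (exp (u * Re (trig_poly \<Lambda> l x \<zeta>)) * exp (u * Re (trig_poly \<Lambda> l x \<eta>)))) \<in> borel_measurable (gauss \<Lambda>)"
      by (intro measurable_compose[OF borel_measurable_times measurable_ennreal] e)
  qed
  have EI: "(\<integral>\<^sup>+x. ennreal (I x) \<partial>gauss \<Lambda>) = ennreal (exp T)"
  proof -
    have "(\<integral>\<^sup>+x. ennreal (I x) \<partial>gauss \<Lambda>) = (\<integral>\<^sup>+x. ennreal (1 / Q) * (\<Sum>r<Q. ennreal (exp (u * Re (trig_poly \<Lambda> l x (uroot Q r))))) \<partial>gauss \<Lambda>)"
      by (intro nn_integral_cong) (simp add: I_def root_avg_def sum_ennreal ennreal_mult'[symmetric])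
    also have "\<dots> = ennreal (1 / Q) * (\<integral>\<^sup>+x. (\<Sum>r<Q. ennreal (exp (u * Re (trig_poly \<Lambda> l x (uroot Q r))))) \<partial>gauss \<Lambda>)"
      by (intro nn_integral_cmult borel_measurable_sum mexp)
    also have "(\<integral>\<^sup>+x. (\<Sum>r<Q. ennreal (exp (u * Re (trig_poly \<Lambda> l x (uroot Q r))))) \<partial>gauss \<Lambda>) = (\<Sum>r<Q. ennreal (exp T))"
      by (subst nn_integral_sum) (simp_all only: mexp lin1 norm_uroot)
    also have "(\<Sum>r<Q. ennreal (exp T)) = ennreal (\<Sum>r<Q. exp T)" by (rule sum_ennreal) simp
    also have "ennreal (1 / Q) * ennreal (\<Sum>r<Q. exp T) = ennreal (1 / Q * (\<Sum>r<Q. exp T))"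
      by (rule ennreal_mult'[symmetric]) simp
    finally show ?thesis using Q0 by simp
  qed
  have EI2: "(\<integral>\<^sup>+x. ennreal ((I x)\<^sup>2) \<partial>gauss \<Lambda>) = ennreal (exp (2 * T) * A)"
  proof -
    let ?g = "\<lambda>p x. exp (u * Re (trig_poly \<Lambda> l x (uroot Q (fst p)))) * exp (u * Re (trig_poly \<Lambda> l x (uroot Q (snd p))))"
    have "(\<integral>\<^sup>+x. ennreal ((I x)\<^sup>2) \<partial>gauss \<Lambda>) = (\<integral>\<^sup>+x. ennreal (1 / Q / Q) * (\<Sum>p\<in>{..<Q} \<times> {..<Q}. ennreal (?g p x)) \<partial>gauss \<Lambda>)"
    proof (intro nn_integral_cong)
      fix x
      have "(I x)\<^sup>2 = 1 / Q / Q * (\<Sum>p\<in>{..<Q} \<times> {..<Q}. ?g p x)"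
        unfolding I_def root_avg_def power2_eq_square times_divide_times_eq sum_product sum.cartesian_product
        by (simp add: case_prod_beta)
      then show "ennreal ((I x)\<^sup>2) = ennreal (1 / Q / Q) * (\<Sum>p\<in>{..<Q} \<times> {..<Q}. ennreal (?g p x))"
        by (simp only: sum_ennreal mult_nonneg_nonneg exp_ge_zero) (rule ennreal_mult', simp)
    qed
    also have "\<dots> = ennreal (1 / Q / Q) * (\<integral>\<^sup>+x. (\<Sum>p\<in>{..<Q} \<times> {..<Q}. ennreal (?g p x)) \<partial>gauss \<Lambda>)"
      by (intro nn_integral_cmult borel_measurable_sum mexp)
    also have "(\<integral>\<^sup>+x. (\<Sum>p\<in>{..<Q} \<times> {..<Q}. ennreal (?g p x)) \<partial>gauss \<Lambda>) =
        (\<Sum>p\<in>{..<Q} \<times> {..<Q}. ennreal (exp (2 * T) * exp (y * Re (R (uroot Q (fst p)) (uroot Q (snd p))))))"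
      by (subst nn_integral_sum) (simp_all only: mexp lin2 norm_uroot)
    also have "\<dots> = ennreal (\<Sum>p\<in>{..<Q} \<times> {..<Q}. exp (2 * T) * exp (y * Re (R (uroot Q (fst p)) (uroot Q (snd p)))))"
      by (rule sum_ennreal) simp
    also have "ennreal (1 / Q / Q) * \<dots> = ennreal (1 / Q / Q * (\<Sum>p\<in>{..<Q} \<times> {..<Q}. exp (2 * T) * exp (y * Re (R (uroot Q (fst p)) (uroot Q (snd p))))))"
      by (rule ennreal_mult'[symmetric]) simp
    also have "1 / Q / Q * (\<Sum>p\<in>{..<Q} \<times> {..<Q}. exp (2 * T) * exp (y * Re (R (uroot Q (fst p)) (uroot Q (snd p))))) = exp (2 * T) * A"
    proof -
      have "(\<Sum>p\<in>{..<Q} \<times> {..<Q}. exp (y * Re (R (uroot Q (fst p)) (uroot Q (snd p))))) =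
          (\<Sum>r<Q. \<Sum>s<Q. exp (y * Re (R (uroot Q s) (uroot Q r))))"
        by (subst sum.swap) (simp add: sum.cartesian_product case_prod_beta)
      then show ?thesis
        unfolding A_def root_avg_def sum_distrib_left[symmetric] by (simp add: sum_divide_distrib[symmetric])
    qed
    finally show ?thesis .
  qed
  define Z where "Z = (\<Sum>k\<in>{1..<k0}. y ^ (2 * k) / fact (2 * k) * (real k ^ m / N) ^ k) + exp y * (real k0 ^ m / N) ^ k0"
  have A: "A \<le> 1 + 2 * Z"
  proof -
    have y0: "y \<ge> 0" using h by (simp add: y_def)
    have "root_avg Q (\<lambda>\<zeta>. exp (y * Re (R \<zeta> \<eta>))) \<le> 1 + 2 * Z" if \<eta>: "cmod \<eta> = 1" for \<eta>
    proof -
      have mean: "root_avg Q (\<lambda>\<zeta>. Re (R \<zeta> \<eta>)) = 0"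
      proof -
        have "root_avg Q (\<lambda>\<zeta>. \<Sum>\<alpha>\<in>\<Lambda>. (cnj \<eta> ^ l \<alpha> / of_real N) * (\<zeta> ^ l \<alpha> * cnj \<zeta> ^ 0)) = (\<Sum>\<alpha>\<in>{\<alpha> \<in> \<Lambda>. l \<alpha> = 0}. cnj \<eta> ^ l \<alpha> / of_real N)"
          using fin lQ Q0 by (intro root_avg_sum) auto
        also have "{\<alpha> \<in> \<Lambda>. l \<alpha> = 0} = {}" using lpos by auto
        finally have "root_avg Q (\<lambda>\<zeta>. R \<zeta> \<eta>) = 0"
          by (simp add: R_def trig_poly_def sum_divide_distrib)
        then have "Re (root_avg Q (\<lambda>\<zeta>. R \<zeta> \<eta>)) = 0" by simp
        then show ?thesis by (simp add: root_avg_def Re_divide_of_nat)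
      qed
      have R1: "cmod (R \<zeta> \<eta>) \<le> 1" if "cmod \<zeta> = 1" for \<zeta>
      proof -
        have "cmod (trig_poly \<Lambda> l (\<lambda>\<alpha>. cnj \<eta> ^ l \<alpha>) \<zeta>) \<le> (\<Sum>\<alpha>\<in>\<Lambda>. 1)"
          unfolding trig_poly_def using that \<eta> by (intro sum_norm_le) (simp add: norm_mult norm_power)
        then show ?thesis using N by (simp add: R_def norm_divide N_def divide_le_eq)
      qed
      have Mk: "root_avg Q (\<lambda>\<zeta>. (cmod (R \<zeta> \<eta>)) ^ (2 * k)) \<le> (real k ^ m / N) ^ k" if k: "k \<ge> 1" "k \<le> k0" for k
      proof -
        have "m * k \<le> m * k0" using k by simp
        then have Bk: "B > m * k" using B by linarith
        have Qk: "k * digit_freq B n \<alpha> < Q" if "\<alpha> \<in> \<Lambda>" for \<alpha>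
          by (rule le_less_trans[OF mult_le_mono1[OF k(2)] Q[OF that]])
        have "root_avg Q (\<lambda>\<zeta>. (cmod (trig_poly \<Lambda> l (\<lambda>\<alpha>. cnj \<eta> ^ l \<alpha>) \<zeta>)) ^ (2 * k)) \<le> N ^ k * real k ^ (m * k)"
          unfolding l_def N_def using Lam(1) Bk Qk k \<eta> by (intro root_avg_moment_bound) (auto simp: norm_power)
        then have "root_avg Q (\<lambda>\<zeta>. (cmod (trig_poly \<Lambda> l (\<lambda>\<alpha>. cnj \<eta> ^ l \<alpha>) \<zeta>)) ^ (2 * k)) / N ^ (2 * k) \<le> N ^ k * real k ^ (m * k) / N ^ (2 * k)"
          using N by (intro divide_right_mono) auto
        also have "N ^ k * real k ^ (m * k) / N ^ (2 * k) = (real k ^ m / N) ^ k"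
          using N by (simp add: power_divide power_mult mult_2 power_add)
        also have "root_avg Q (\<lambda>\<zeta>. (cmod (trig_poly \<Lambda> l (\<lambda>\<alpha>. cnj \<eta> ^ l \<alpha>) \<zeta>)) ^ (2 * k)) / N ^ (2 * k) =
            root_avg Q (\<lambda>\<zeta>. 1 / N ^ (2 * k) * (cmod (trig_poly \<Lambda> l (\<lambda>\<alpha>. cnj \<eta> ^ l \<alpha>) \<zeta>)) ^ (2 * k))"
          unfolding root_avg_cmult by simp
        also have "\<dots> = root_avg Q (\<lambda>\<zeta>. (cmod (R \<zeta> \<eta>)) ^ (2 * k))"
          using N by (simp add: R_def norm_divide power_divide)
        finally show ?thesis .
      qed
      have "root_avg Q (\<lambda>\<zeta>. exp (y * Re (R \<zeta> \<eta>))) \<le>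
          root_avg Q (\<lambda>\<zeta>. (y * Re (R \<zeta> \<eta>) + (- 1)) + 2 * ((\<Sum>k<k0. y ^ (2 * k) / fact (2 * k) * (cmod (R \<zeta> \<eta>)) ^ (2 * k)) + exp y * (cmod (R \<zeta> \<eta>)) ^ (2 * k0)))"
      proof (rule root_avg_mono)
        fix r assume "r < Q"
        define f where "f = y * Re (R (uroot Q r) \<eta>)"
        have "\<bar>f\<bar> \<le> y * cmod (R (uroot Q r) \<eta>)"
          unfolding f_def abs_mult using y0 abs_Re_le_cmod[of "R (uroot Q r) \<eta>"] by (simp add: mult_left_mono)
        then have "cosh f \<le> (\<Sum>k<k0. y ^ (2 * k) / fact (2 * k) * (cmod (R (uroot Q r) \<eta>)) ^ (2 * k)) + exp y * (cmod (R (uroot Q r) \<eta>)) ^ (2 * k0)"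
          using R1[of "uroot Q r"] y0 by (intro cosh_truncation) auto
        \<comment> \<open>Equivalent to \<open>1 - f \<le> exp (- f)\<close>. It keeps the linear
          term, which averages to zero, and puts everything else into even powers, whose means are
          under control.\<close>
        moreover have "exp f \<le> f - 1 + 2 * cosh f"
        proof -
          have "2 * cosh f = exp f + exp (- f)" by (simp add: cosh_field_def)
          then show ?thesis using exp_ge_add_one_self[of "- f"] by linarith
        qed
        ultimately have "exp f \<le> f + - 1 + 2 * ((\<Sum>k<k0. y ^ (2 * k) / fact (2 * k) * (cmod (R (uroot Q r) \<eta>)) ^ (2 * k)) + exp y * (cmod (R (uroot Q r) \<eta>)) ^ (2 * k0))"
          by argo
        then show "exp (y * Re (R (uroot Q r) \<eta>)) \<le> (y * Re (R (uroot Q r) \<eta>) + (- 1)) + 2 * ((\<Sum>k<k0. y ^ (2 * k) / fact (2 * k) * (cmod (R (uroot Q r) \<eta>)) ^ (2 * k)) + exp y * (cmod (R (uroot Q r) \<eta>)) ^ (2 * k0))"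
          unfolding f_def .
      qed
      also have "\<dots> = - 1 + 2 * ((\<Sum>k<k0. y ^ (2 * k) / fact (2 * k) * root_avg Q (\<lambda>\<zeta>. (cmod (R \<zeta> \<eta>)) ^ (2 * k))) + exp y * root_avg Q (\<lambda>\<zeta>. (cmod (R \<zeta> \<eta>)) ^ (2 * k0)))"
      proof -
        have sw: "root_avg Q (\<lambda>\<zeta>. \<Sum>k<k0. y ^ (2 * k) / fact (2 * k) * (cmod (R \<zeta> \<eta>)) ^ (2 * k)) =
            (\<Sum>k<k0. y ^ (2 * k) / fact (2 * k) * root_avg Q (\<lambda>\<zeta>. (cmod (R \<zeta> \<eta>)) ^ (2 * k)))"
          unfolding root_avg_def by (subst sum.swap) (simp add: sum_divide_distrib sum_distrib_left)
        show ?thesis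
          unfolding root_avg_add root_avg_cmult root_avg_const[OF Q0] sw mean by simp
      qed
      \<comment> \<open>The term \<open>k = 0\<close> contributes 1, so -1 + 2 leaves exactly the
        normalised square of the mean; the remaining terms bound the relative variance.\<close>
      also have "(\<Sum>k<k0. y ^ (2 * k) / fact (2 * k) * root_avg Q (\<lambda>\<zeta>. (cmod (R \<zeta> \<eta>)) ^ (2 * k))) =
          1 + (\<Sum>k\<in>{1..<k0}. y ^ (2 * k) / fact (2 * k) * root_avg Q (\<lambda>\<zeta>. (cmod (R \<zeta> \<eta>)) ^ (2 * k)))"
        using k0 Q0 by (simp add: lessThan_atLeast0 sum.atLeast_Suc_lessThan root_avg_const)
      also have "- 1 + 2 * (1 + (\<Sum>k\<in>{1..<k0}. y ^ (2 * k) / fact (2 * k) * root_avg Q (\<lambda>\<zeta>. (cmod (R \<zeta> \<eta>)) ^ (2 * k))) + exp y * root_avg Q (\<lambda>\<zeta>. (cmod (R \<zeta> \<eta>)) ^ (2 * k0))) \<le>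
          - 1 + 2 * (1 + (\<Sum>k\<in>{1..<k0}. y ^ (2 * k) / fact (2 * k) * (real k ^ m / N) ^ k) + exp y * (real k0 ^ m / N) ^ k0)"
        using k0 y0 by (intro add_left_mono add_mono mult_left_mono sum_mono Mk) auto
      finally show ?thesis by (simp add: Z_def)
    qed
    then have "A \<le> root_avg Q (\<lambda>_. 1 + 2 * Z)" unfolding A_def by (intro root_avg_mono) simp
    then show ?thesis using Q0 by (simp add: root_avg_const)
  qed
  interpret P: prob_space "gauss \<Lambda>" by (rule prob_space_gauss)
  have A0: "A \<ge> 0" by (auto simp: A_def root_avg_def intro!: divide_nonneg_nonneg sum_nonneg)
  have tail: "P.prob {x \<in> space (gauss \<Lambda>). I x \<le> exp T / 2} \<le> 4 * (exp (2 * T) * A / (exp T)\<^sup>2 - 1)"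
    using mI Inn EI EI2 A0 by (intro P.second_moment_lower_tail) auto
  have "exp (2 * T) = (exp T)\<^sup>2" by (simp add: power2_eq_square exp_add[symmetric])
  then have tail': "P.prob {x \<in> space (gauss \<Lambda>). I x \<le> exp T / 2} \<le> 8 * Z"
    using tail A by simp
  have "peak_event Q \<Lambda> l h \<inter> space (gauss \<Lambda>) \<subseteq>
      {x \<in> space (gauss \<Lambda>). 2 * N < sum_pow \<Lambda> x 2} \<union> {x \<in> space (gauss \<Lambda>). I x \<le> exp T / 2}"
  proof
    fix x assume x: "x \<in> peak_event Q \<Lambda> l h \<inter> space (gauss \<Lambda>)"
    show "x \<in> {x \<in> space (gauss \<Lambda>). 2 * N < sum_pow \<Lambda> x 2} \<union> {x \<in> space (gauss \<Lambda>). I x \<le> exp T / 2}"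
    proof (cases "2 * N < sum_pow \<Lambda> x 2")
      case False
      have "I x \<le> root_avg Q (\<lambda>_. exp (12 * h))"
        unfolding I_def
      proof (rule root_avg_mono)
        fix r assume r: "r < Q"
        have "(cmod (trig_poly \<Lambda> l x (uroot Q r)))\<^sup>2 \<le> h * sum_pow \<Lambda> x 2"
          using x r by (simp add: peak_event_def)
        also have "\<dots> \<le> h * (2 * N)" using False h by (intro mult_left_mono) auto
        finally have "(u * cmod (trig_poly \<Lambda> l x (uroot Q r)))\<^sup>2 \<le> (72 * h / N) * (h * (2 * N))"
          unfolding power_mult_distrib u(2) using h N by (intro mult_left_mono) auto
        also have "\<dots> = (12 * h)\<^sup>2" using N by (simp add: power2_eq_square)
        finally have "u * cmod (trig_poly \<Lambda> l x (uroot Q r)) \<le> 12 * h"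
          by (rule power2_le_imp_le) (use h in simp)
        moreover have "u * Re (trig_poly \<Lambda> l x (uroot Q r)) \<le> u * cmod (trig_poly \<Lambda> l x (uroot Q r))"
          using u by (intro mult_left_mono complex_Re_le_cmod) auto
        ultimately show "exp (u * Re (trig_poly \<Lambda> l x (uroot Q r))) \<le> exp (12 * h)" by simp
      qed
      also have "\<dots> = exp (12 * h)" using Q0 by (simp add: root_avg_const)
      also have "\<dots> \<le> exp T / 2"
      proof -
        have "2 \<le> exp (6 * h)" using exp_ge_add_one_self[of "6 * h"] h by linarith
        then have "exp (12 * h) * 2 \<le> exp (12 * h) * exp (6 * h)" by (intro mult_left_mono) auto
        also have "\<dots> = exp T" by (simp add: T_def exp_add[symmetric])
        finally show ?thesis by simp
      qed
      finally show ?thesis using x by simp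
    qed (use x in simp)
  qed
  then have "P.prob (peak_event Q \<Lambda> l h \<inter> space (gauss \<Lambda>)) \<le>
      P.prob ({x \<in> space (gauss \<Lambda>). 2 * N < sum_pow \<Lambda> x 2} \<union> {x \<in> space (gauss \<Lambda>). I x \<le> exp T / 2})"
    using mI by (intro P.finite_measure_mono sets.Un borel_measurable_less borel_measurable_le
        borel_measurable_const measurable_sum_pow_gauss)
  also have "\<dots> \<le> P.prob {x \<in> space (gauss \<Lambda>). 2 * N < sum_pow \<Lambda> x 2} + P.prob {x \<in> space (gauss \<Lambda>). I x \<le> exp T / 2}"
    using mI by (intro measure_Un_le borel_measurable_less borel_measurable_le
        borel_measurable_const measurable_sum_pow_gauss)
  also have "\<dots> \<le> (2 / exp 1) ^ card \<Lambda> + 8 * Z"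
    using gauss_norm_square_large[OF fin] tail' unfolding N_def by (intro add_mono)
  finally show ?thesis unfolding Z_def y_def l_def .
qed

section \<open>The Bohnenblust--Hille ratio\<close>

lemma poly_sup_norm_nonneg_bdd:
  "bdd_above ((\<lambda>z. cmod (poly_fun n \<Lambda> a z)) ` unit_polydisc n)"
  using poly_fun_bound[of _ n \<Lambda> a] by (intro bdd_aboveI2) auto

text \<open>The supremum is over the open polydisc, so a point of the torus is approached radially.
  By homogeneity the value at radius \<open>r\<close> is \<open>r ^ m\<close> times the value at the
  end point.\<close>

lemma poly_fun_le_sup_norm:
  assumes "\<Lambda> \<subseteq> multi_indices m n" and z: "\<And>j. j \<in> {1..n} \<Longrightarrow> cmod (z j) = 1"
  shows "cmod (poly_fun n \<Lambda> a z) \<le> poly_sup_norm n \<Lambda> a"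
proof (rule tendsto_upperbound)
  have hom: "poly_fun n \<Lambda> a (\<lambda>j. of_real r * z j) = of_real r ^ m * poly_fun n \<Lambda> a z" for r
  proof -
    have "(\<Prod>j=1..n. (of_real r * z j) ^ \<alpha> j) = of_real r ^ m * (\<Prod>j=1..n. z j ^ \<alpha> j)" if "\<alpha> \<in> \<Lambda>" for \<alpha>
    proof -
      have "(\<Sum>j=1..n. \<alpha> j) = m" using that assms by (auto simp: multi_indices_def)
      then show ?thesis by (simp add: power_mult_distrib prod.distrib flip: power_sum)
    qed
    then show ?thesis by (simp add: poly_fun_def sum_distrib_left mult_ac)
  qed
  show "((\<lambda>r::real. r ^ m * cmod (poly_fun n \<Lambda> a z)) \<longlongrightarrow> cmod (poly_fun n \<Lambda> a z)) (at_left 1)"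
    by (auto intro!: tendsto_eq_intros)
  show "\<forall>\<^sub>F r in at_left 1. r ^ m * cmod (poly_fun n \<Lambda> a z) \<le> poly_sup_norm n \<Lambda> a"
    using eventually_at_left_real[of 0 "1::real", OF zero_less_one]
  proof eventually_elim
    case (elim r)
    then have "(\<lambda>j. of_real r * z j) \<in> unit_polydisc n"
      using z by (auto simp: unit_polydisc_def norm_mult)
    then have "cmod (poly_fun n \<Lambda> a (\<lambda>j. of_real r * z j)) \<le> poly_sup_norm n \<Lambda> a"
      unfolding poly_sup_norm_def by (intro cSUP_upper poly_sup_norm_nonneg_bdd)
    then show ?case using elim by (simp add: hom norm_mult norm_power)
  qed
qed simp

text \<open>The power mean inequality with exponent \<open>p = 2 / q = (m + 1) / m\<close>; the
  power of the cardinality it costs is \<open>p - 1 = 1 / m\<close>.\<close>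

lemma lp_norm_bh_exponent_le:
  assumes "finite \<Lambda>" "\<Lambda> \<noteq> {}" "m \<ge> 1"
  shows "(lp_norm (bh_exponent m) \<Lambda> a)\<^sup>2 \<le> real (card \<Lambda>) powr (1 / m) * sum_pow \<Lambda> a 2"
proof -
  define q where "q = bh_exponent m"
  define p where "p = 2 / q"
  \<comment> \<open>Zero coefficients are dropped so that every \<open>y \<alpha>\<close> is
    positive in the convexity step. Monotonicity restores the full cardinality at the end.\<close>
  define L where "L = {\<alpha> \<in> \<Lambda>. a \<alpha> \<noteq> 0}"
  define N where "N = real (card L)"
  define y where "y \<alpha> = cmod (a \<alpha>) powr q" for \<alpha>
  define S where "S = sum_pow L a 2"
  have L: "finite L" "L \<subseteq> \<Lambda>" using assms by (auto simp: L_def)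
  have q: "q > 0" using assms by (simp add: q_def bh_exponent_def)
  have p: "p = (real m + 1) / m" "p \<ge> 1" using assms by (simp_all add: p_def q_def bh_exponent_def field_simps)
  have S: "sum_pow \<Lambda> a 2 = S"
    unfolding S_def L_def using assms by (intro sum.mono_neutral_right) auto
  have Y: "(\<Sum>\<alpha>\<in>\<Lambda>. y \<alpha>) = (\<Sum>\<alpha>\<in>L. y \<alpha>)"
    unfolding L_def using assms by (intro sum.mono_neutral_right) (auto simp: y_def)
  show ?thesis
  proof (cases "L = {}")
    case True
    then have "lp_norm q \<Lambda> a = 0" using Y unfolding lp_norm_def y_def by simp
    then show ?thesis using S by (simp add: S_def True q_def)
  next
    case False
    have N: "N \<ge> 1" using L False by (simp add: N_def Suc_le_eq card_gt_0_iff)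
    have S0: "S > 0" unfolding S_def using L False by (intro sum_pos) (auto simp: L_def)
    have "(\<Sum>\<alpha>\<in>L. (1 / N) *\<^sub>R y \<alpha>) powr p \<le> (\<Sum>\<alpha>\<in>L. 1 / N * (y \<alpha> powr p))"
      using L False p N by (intro convex_on_sum[OF _ _ powr_convex]) (auto simp: N_def y_def L_def)
    also have "(\<Sum>\<alpha>\<in>L. 1 / N * (y \<alpha> powr p)) = S / N"
    proof -
      have "y \<alpha> powr p = (cmod (a \<alpha>))\<^sup>2" if "\<alpha> \<in> L" for \<alpha>
        using that q by (simp add: y_def powr_powr p_def L_def)
      then show ?thesis by (simp add: S_def sum_divide_distrib)
    qed
    also have "(\<Sum>\<alpha>\<in>L. (1 / N) *\<^sub>R y \<alpha>) = (\<Sum>\<alpha>\<in>L. y \<alpha>) / N" by (simp add: sum_divide_distrib)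
    finally have J: "((\<Sum>\<alpha>\<in>L. y \<alpha>) / N) powr p \<le> S / N" .
    define Y where "Y = (\<Sum>\<alpha>\<in>L. y \<alpha>)"
    have Y0: "Y > 0" unfolding Y_def using L False by (intro sum_pos) (auto simp: y_def L_def)
    have "Y powr p \<le> N powr p * (S / N)"
      using J N Y0 unfolding Y_def[symmetric] by (simp add: powr_divide field_simps)
    also have "\<dots> = N powr (p - 1) * S" using N by (simp add: powr_diff)
    also have "p - 1 = 1 / m" using p assms by (simp add: field_simps)
    also have "Y powr p = (Y powr (1 / q))\<^sup>2"
      using Y0 by (simp add: powr_powr p_def flip: powr_numeral)
    also have "Y powr (1 / q) = lp_norm q \<Lambda> a"
      unfolding lp_norm_def Y_def using \<open>(\<Sum>\<alpha>\<in>\<Lambda>. y \<alpha>) = (\<Sum>\<alpha>\<in>L. y \<alpha>)\<close> by (simp add: y_def)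
    finally have "(lp_norm q \<Lambda> a)\<^sup>2 \<le> N powr (1 / m) * S" .
    also have "\<dots> \<le> real (card \<Lambda>) powr (1 / m) * S"
      using S0 N L assms by (intro mult_right_mono powr_mono2) (auto simp: N_def card_mono)
    finally show ?thesis unfolding q_def S .
  qed
qed

lemma trig_poly_digit_freq:
  "trig_poly \<Lambda> (digit_freq B n) a \<zeta> = poly_fun n \<Lambda> a (\<lambda>j. \<zeta> ^ (B ^ j))"
  by (simp add: trig_poly_def poly_fun_def digit_freq_def power_sum mult.commute flip: power_mult)

lemma bh_ratio_gt_1D:
  assumes Lam: "\<Lambda> \<subseteq> multi_indices m n" "\<Lambda> \<noteq> {}" and m: "m \<ge> 1" and R: "bh_ratio m n \<Lambda> a > 1"
  shows "poly_sup_norm n \<Lambda> a < lp_norm (bh_exponent m) \<Lambda> a"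
    and "a \<in> peak_event Q \<Lambda> (digit_freq B n) (real (card \<Lambda>) powr (1 / m))"
proof -
  have fin: "finite \<Lambda>" using Lam finite_multi_indices finite_subset by blast
  have "cmod (poly_fun n \<Lambda> a (\<lambda>_. 1)) \<le> poly_sup_norm n \<Lambda> a"
    by (rule poly_fun_le_sup_norm[OF Lam(1)]) simp
  then have s0: "poly_sup_norm n \<Lambda> a \<ge> 0" using norm_ge_zero order_trans by blast
  have R': "lp_norm (bh_exponent m) \<Lambda> a / poly_sup_norm n \<Lambda> a > 1"
    using R unfolding bh_ratio_def by (auto split: if_splits)
  \<comment> \<open>A quotient with denominator 0 is 0, hence not above 1.\<close>
  then have "poly_sup_norm n \<Lambda> a \<noteq> 0" by auto
  then have "poly_sup_norm n \<Lambda> a > 0" using s0 by simp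
  then show lt: "poly_sup_norm n \<Lambda> a < lp_norm (bh_exponent m) \<Lambda> a"
    using R' by (simp add: less_divide_eq)
  show "a \<in> peak_event Q \<Lambda> (digit_freq B n) (real (card \<Lambda>) powr (1 / m))"
    unfolding peak_event_def mem_Collect_eq
  proof (intro allI impI)
    fix r assume "r < Q"
    have "cmod (trig_poly \<Lambda> (digit_freq B n) a (uroot Q r)) \<le> poly_sup_norm n \<Lambda> a"
      unfolding trig_poly_digit_freq by (rule poly_fun_le_sup_norm[OF Lam(1)]) (simp add: norm_power)
    then have "(cmod (trig_poly \<Lambda> (digit_freq B n) a (uroot Q r)))\<^sup>2 \<le> (lp_norm (bh_exponent m) \<Lambda> a)\<^sup>2"
      using lt by (intro power_mono) auto
    also have "\<dots> \<le> real (card \<Lambda>) powr (1 / m) * sum_pow \<Lambda> a 2"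
      using fin Lam(2) m by (rule lp_norm_bh_exponent_le)
    finally show "(cmod (trig_poly \<Lambda> (digit_freq B n) a (uroot Q r)))\<^sup>2 \<le> real (card \<Lambda>) powr (1 / m) * sum_pow \<Lambda> a 2" .
  qed
qed

text \<open>The transfer to the Gaussian measure is made for the larger peak event, which is defined
  by homogeneous inequalities and thus is a cone. \<open>Q\<close> and \<open>B\<close> remain free,
  so that each regime can choose its own.\<close>

lemma sphere_measure_le_peak_event:
  assumes Lam: "\<Lambda> \<subseteq> multi_indices m n" "\<Lambda> \<noteq> {}" and m: "m \<ge> 1"
  shows "measure (sphere_measure \<Lambda>) {a \<in> coeff_sphere \<Lambda>. bh_ratio m n \<Lambda> a > 1} \<le>
    measure (gauss \<Lambda>) (peak_event Q \<Lambda> (digit_freq B n) (real (card \<Lambda>) powr (1 / m)) \<inter> space (gauss \<Lambda>))"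
proof -
  have fin: "finite \<Lambda>" using Lam finite_multi_indices finite_subset by blast
  interpret P: prob_space "sphere_measure \<Lambda>" using fin Lam(2) by (rule prob_space_sphere_measure)
  let ?A = "peak_event Q \<Lambda> (digit_freq B n) (real (card \<Lambda>) powr (1 / m)) \<inter> space (gauss \<Lambda>)"
  have A: "?A \<in> sets (coeff_lborel \<Lambda>)" unfolding sets_gauss[symmetric] by (rule sets_peak_event)
  have cone: "(\<lambda>i\<in>\<Lambda>. of_real r * x i) \<in> ?A \<longleftrightarrow> x \<in> ?A" if r: "0 < r" and x: "x \<in> \<Lambda> \<rightarrow>\<^sub>E UNIV" for r x
  proof -
    have t: "trig_poly \<Lambda> (digit_freq B n) (\<lambda>i\<in>\<Lambda>. of_real r * x i) \<zeta> = of_real r * trig_poly \<Lambda> (digit_freq B n) x \<zeta>" for \<zeta>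
      by (simp add: trig_poly_def sum_distrib_left mult_ac)
    have s: "sum_pow \<Lambda> (\<lambda>i\<in>\<Lambda>. of_real r * x i) 2 = r\<^sup>2 * sum_pow \<Lambda> x 2"
      by (simp add: norm_mult power_mult_distrib sum_distrib_left)
    have "r\<^sup>2 * u \<le> c * (r\<^sup>2 * v) \<longleftrightarrow> u \<le> c * v" for u v c :: real
    proof -
      have "c * (r\<^sup>2 * v) = r\<^sup>2 * (c * v)" by simp
      then show ?thesis using r by (simp only: mult_le_cancel_left_pos zero_less_power)
    qed
    then show ?thesis
      using x unfolding peak_event_def space_gauss Int_iff mem_Collect_eq t s norm_mult power_mult_distrib norm_of_real power2_abs
      by simp
  qed
  have "{a \<in> coeff_sphere \<Lambda>. bh_ratio m n \<Lambda> a > 1} \<subseteq> ?A \<inter> coeff_sphere \<Lambda>"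
    using bh_ratio_gt_1D(2)[OF Lam m] by (auto simp: space_gauss coeff_sphere_def)
  then have "P.prob {a \<in> coeff_sphere \<Lambda>. bh_ratio m n \<Lambda> a > 1} \<le> P.prob (?A \<inter> coeff_sphere \<Lambda>)"
    using sphere_measure_cone(1)[OF fin Lam(2) A cone] by (intro P.finite_measure_mono)
  also have "\<dots> = measure (gauss \<Lambda>) ?A"
    by (rule sphere_measure_cone(2)[OF fin Lam(2) A cone])
  finally show ?thesis .
qed

text \<open>A single coefficient on the sphere has modulus 1, and so have all the norms. This serves
  the optimality of the threshold and also the supports of size 1, which have no pair of extreme
  coefficients.\<close>

lemma bh_ratio_singleton:
  assumes Lam: "\<Lambda> \<subseteq> multi_indices m n" "card \<Lambda> = 1" and m: "m \<ge> 1" and a: "a \<in> coeff_sphere \<Lambda>"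
  shows "bh_ratio m n \<Lambda> a = 1"
proof -
  obtain \<alpha> where \<alpha>: "\<Lambda> = {\<alpha>}" using Lam(2) by (auto simp: card_Suc_eq)
  have a1: "cmod (a \<alpha>) = 1" using a by (simp add: coeff_sphere_def lp_norm_2 \<alpha>)
  have "cmod (poly_fun n \<Lambda> a (\<lambda>_. 1)) \<le> poly_sup_norm n \<Lambda> a"
    by (rule poly_fun_le_sup_norm[OF Lam(1)]) simp
  then have "1 \<le> poly_sup_norm n \<Lambda> a" using a1 by (simp add: poly_fun_def \<alpha>)
  moreover have "poly_sup_norm n \<Lambda> a \<le> 1"
    unfolding poly_sup_norm_def
  proof (rule cSUP_least)
    show "unit_polydisc n \<noteq> {}" by (auto simp: unit_polydisc_def intro: exI[of _ "\<lambda>_. 0"])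
    show "cmod (poly_fun n \<Lambda> a z) \<le> 1" if "z \<in> unit_polydisc n" for z
      using poly_fun_bound[OF that, of \<Lambda> a] a1 by (simp add: \<alpha>)
  qed
  moreover have "lp_norm (bh_exponent m) \<Lambda> a = 1" using a1 by (simp add: lp_norm_def \<alpha>)
  moreover have "a \<alpha> \<noteq> 0" using a1 by auto
  ultimately show ?thesis by (simp add: bh_ratio_def \<alpha>)
qed

section \<open>Numerical estimates and the tail bound\<close>

lemma geometric_le_inverse_square:
  fixes q :: real
  assumes "0 \<le> q" "q < 1"
  shows "\<exists>K>0. \<forall>m::nat. m \<ge> 1 \<longrightarrow> q ^ m \<le> K / (real m)\<^sup>2"
proof -
  obtain K where K: "K > 0" "\<And>n::nat. (1 + real n) ^ 3 * q ^ n \<le> K"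
    using power_geometric_bounded[OF assms] by blast
  have "q ^ m \<le> K / (real m)\<^sup>2" if "m \<ge> 1" for m :: nat
  proof -
    have "(real m)\<^sup>2 \<le> (1 + real m)\<^sup>2" by (intro power_mono) auto
    also have "\<dots> \<le> (1 + real m) ^ 3" by (intro power_increasing) auto
    finally have "(real m)\<^sup>2 * q ^ m \<le> (1 + real m) ^ 3 * q ^ m" using assms by (intro mult_right_mono) auto
    also have "\<dots> \<le> K" by (rule K(2))
    finally show ?thesis using that by (simp add: pos_le_divide_eq mult.commute)
  qed
  then show ?thesis using K(1) by blast
qed

text \<open>A single term of the exponential series. With \<open>x = n\<close> it bounds n^n / n! by
  exp n and so stands in for Stirling's formula.\<close>

lemma power_div_fact_le_exp:
  fixes x :: real
  assumes "x \<ge> 0" shows "x ^ n / fact n \<le> exp x"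
proof -
  have "(\<Sum>k\<in>{n}. x ^ k /\<^sub>R fact k) \<le> (\<Sum>k. x ^ k /\<^sub>R fact k)"
    using assms by (intro sum_le_suminf summable_exp_generic) auto
  then show ?thesis by (simp add: exp_def divide_inverse mult.commute)
qed

lemma sum_powers_le:
  fixes x :: real
  assumes "0 \<le> x" "x \<le> 1 / 2"
  shows "(\<Sum>k\<in>{1..<k0}. x ^ k) \<le> 2 * x"
proof -
  have "(\<Sum>k\<in>{1..<Suc k}. x ^ k) \<le> 2 * x - 2 * x ^ Suc k" for k
  proof (induction k)
    case (Suc k)
    have "2 * x ^ Suc (Suc k) \<le> x ^ Suc k"
      using assms mult_right_mono[of x "1 / 2" "x ^ Suc k"] by simp
    then show ?case using Suc by simp
  qed simp
  moreover have "0 \<le> x ^ Suc k" for k using assms by simp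
  ultimately have "(\<Sum>k\<in>{1..<Suc k}. x ^ k) \<le> 2 * x" for k
    by (smt (verit))
  then show ?thesis using assms by (cases k0) auto
qed

text \<open>Put \<open>s = k / h\<close>, at most 1/2 in the range of summation. The part
  \<open>s ^ (2 * k)\<close> of \<open>s ^ (m * k)\<close> turns (36 h)^(2k) into (36 k)^(2k), which
  the factorial reduces to the \<open>k\<close>-th power of a constant. The rest of the power of
  \<open>s\<close> makes each summand the \<open>k\<close>-th power of an exponentially small
  number.\<close>

lemma correlation_sum_bound:
  fixes h :: real
  assumes m: "m \<ge> 576" and h: "h \<ge> 4" and N: "N = h ^ m" and k0: "k0 = nat \<lfloor>h / 2\<rfloor>"
  shows "(\<Sum>k\<in>{1..<k0}. (36 * h) ^ (2 * k) / fact (2 * k) * (real k ^ m / N) ^ k) + exp (36 * h) * (real k0 ^ m / N) ^ k0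
    \<le> 23328 * (1 / 2) ^ m + (exp (- 1 / 4)) ^ m"
proof -
  have k0h: "real k0 \<le> h / 2" "h / 4 \<le> real k0" using h unfolding k0 by linarith+
  have "2 + (m - 2) = m" using m by simp
  then have m2: "x ^ m = x ^ (2 + (m - 2))" for x :: real by (simp only:)
  \<comment> \<open>11664 is 4 times 18^2 times 9: the 9 bounds exp 2, and the 4 accounts for the
    exponent \<open>m - 2\<close> left after \<open>s\<^sup>2\<close> has been spent.\<close>
  define x where "x = 11664 * (1 / 2 :: real) ^ m"
  have "(2::real) ^ 15 \<le> 2 ^ m" using m by (intro power_increasing) auto
  then have x: "0 \<le> x" "x \<le> 1 / 2" by (simp_all add: x_def power_divide divide_le_eq)
  have summand: "(36 * h) ^ (2 * k) / fact (2 * k) * (real k ^ m / N) ^ k \<le> x ^ k" if k: "1 \<le> k" "k < k0" for k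
  proof -
    define s where "s = real k / h"
    have s: "0 \<le> s" "s \<le> 1 / 2" proof -
      have "real k \<le> real k0" using k by simp
      then have "real k * 2 \<le> h" using k0h by linarith
      then show "0 \<le> s" "s \<le> 1 / 2" using h by (auto simp: s_def divide_le_eq)
    qed
    have "(real k ^ m / N) ^ k = (s ^ m) ^ k" by (simp add: N s_def power_divide)
    also have "s ^ m = s\<^sup>2 * s ^ (m - 2)" by (subst m2, rule power_add)
    also have "(s\<^sup>2 * s ^ (m - 2)) ^ k = s ^ (2 * k) * (s ^ (m - 2)) ^ k" by (simp add: power_mult_distrib power_mult)
    finally have "(36 * h) ^ (2 * k) / fact (2 * k) * (real k ^ m / N) ^ k =
        ((36 * h) ^ (2 * k) * s ^ (2 * k)) / fact (2 * k) * (s ^ (m - 2)) ^ k" by simp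
    also have "(36 * h) ^ (2 * k) * s ^ (2 * k) = (18 * real (2 * k)) ^ (2 * k)"
      using h unfolding power_mult_distrib[symmetric] by (simp add: s_def)
    also have "(18 * real (2 * k)) ^ (2 * k) / fact (2 * k) = (18\<^sup>2) ^ k * (real (2 * k) ^ (2 * k) / fact (2 * k))"
      by (simp only: power_mult_distrib power_mult) simp
    also have "\<dots> * (s ^ (m - 2)) ^ k \<le> (18\<^sup>2) ^ k * 9 ^ k * ((1 / 2) ^ (m - 2)) ^ k"
    proof (intro mult_mono mult_left_mono power_mono s)
      have "real (2 * k) ^ (2 * k) / fact (2 * k) \<le> exp (real (2 * k))" by (intro power_div_fact_le_exp) simp
      also have "\<dots> = (exp 1 ^ 2) ^ k" by (simp flip: exp_of_nat_mult power_mult)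
      also have "\<dots> \<le> (3\<^sup>2) ^ k" using exp_le by (intro power_mono) auto
      finally show "real (2 * k) ^ (2 * k) / fact (2 * k) \<le> 9 ^ k" by simp
    qed (use s in auto)
    also have "\<dots> = (18\<^sup>2 * 9 * (1 / 2) ^ (m - 2)) ^ k" by (simp only: power_mult_distrib)
    also have "18\<^sup>2 * 9 * (1 / 2 :: real) ^ (m - 2) = x"
    proof -
      have "(1 / 2 :: real) ^ m = (1 / 2)\<^sup>2 * (1 / 2) ^ (m - 2)" by (subst m2, rule power_add)
      then show ?thesis by (simp add: x_def power2_eq_square)
    qed
    finally show ?thesis .
  qed
  have "(\<Sum>k\<in>{1..<k0}. (36 * h) ^ (2 * k) / fact (2 * k) * (real k ^ m / N) ^ k) \<le> (\<Sum>k\<in>{1..<k0}. x ^ k)"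
    using summand by (intro sum_mono) auto
  also have "\<dots> \<le> 2 * x" using x by (rule sum_powers_le)
  finally have 1: "(\<Sum>k\<in>{1..<k0}. (36 * h) ^ (2 * k) / fact (2 * k) * (real k ^ m / N) ^ k) \<le> 2 * x" .
  have 2: "exp (36 * h) * (real k0 ^ m / N) ^ k0 \<le> (exp (- 1 / 4)) ^ m"
  proof -
    have "(real k0 ^ m / N) ^ k0 = (real k0 / h) ^ (m * k0)" by (simp add: N power_divide power_mult)
    also have "\<dots> \<le> (1 / 2) ^ (m * k0)" using k0h h by (intro power_mono) (auto simp: divide_le_eq)
    also have "\<dots> \<le> (exp (- 1 / 2)) ^ (m * k0)"
    proof (intro power_mono)
      have "exp (1 / 2 :: real) \<le> 2"
      proof (rule power2_le_imp_le)
        have "(exp (1 / 2 :: real))\<^sup>2 = exp 1" by (simp add: power2_eq_square flip: exp_add)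
        then show "(exp (1 / 2 :: real))\<^sup>2 \<le> 2\<^sup>2" using exp_le by simp
      qed simp
      then show "1 / 2 \<le> exp (- 1 / 2 :: real)" by (simp add: exp_minus field_simps)
    qed simp
    also have "\<dots> = exp (- (real m * real k0 / 2))" by (simp flip: exp_of_nat_mult)
    also have "\<dots> \<le> exp (- (real m * (h / 4) / 2))"
      using k0h mult_left_mono[of "h / 4" "real k0" "real m"] unfolding exp_le_cancel_iff by linarith
    finally have "exp (36 * h) * (real k0 ^ m / N) ^ k0 \<le> exp (36 * h) * exp (- (real m * (h / 4) / 2))"
      by (intro mult_left_mono) auto
    also have "\<dots> = exp (h * (36 - m / 8))" by (simp add: exp_add[symmetric] algebra_simps)
    also have "\<dots> \<le> exp (4 * (- (real m / 16)))"
    proof -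
      \<comment> \<open>576 is 16 times 36, so half of \<open>m / 8\<close> absorbs the 36 that
        stems from \<open>exp (36 * h)\<close>.\<close>
      have "36 - real m / 8 \<le> - (real m / 16)" using m by simp
      then have "h * (36 - real m / 8) \<le> h * (- (real m / 16))" using h by (intro mult_left_mono) auto
      also have "\<dots> \<le> 4 * (- (real m / 16))" using h by (intro mult_right_mono_neg) auto
      finally show ?thesis by simp
    qed
    also have "\<dots> = (exp (- 1 / 4)) ^ m" by (simp flip: exp_of_nat_mult)
    finally show ?thesis .
  qed
  show ?thesis using 1 2 by (simp add: x_def)
qed

lemma ln_ge_half: "m \<ge> 2 \<Longrightarrow> ln (real m) \<ge> 1 / 2"
proof -
  assume "m \<ge> 2"
  have "exp (1 / 2 :: real) \<le> 2"
  proof (rule power2_le_imp_le)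
    have "(exp (1 / 2 :: real))\<^sup>2 = exp 1" by (simp add: power2_eq_square flip: exp_add)
    then show "(exp (1 / 2 :: real))\<^sup>2 \<le> 2\<^sup>2" using exp_le by simp
  qed simp
  then have "exp (1 / 2) \<le> real m" using \<open>m \<ge> 2\<close> by linarith
  then show ?thesis using \<open>m \<ge> 2\<close> by (subst ln_ge_iff) auto
qed

text \<open>Here \<open>N = h ^ m\<close> exceeds \<open>(21 / 20) ^ m\<close>, so even a single
  factor \<open>1 / N\<close> is exponentially small in \<open>m\<close>.\<close>

lemma many_monomials_bound:
  "\<exists>C>0. \<forall>m n \<Lambda>. m \<ge> 576 \<longrightarrow> \<Lambda> \<subseteq> multi_indices m n \<longrightarrow> \<Lambda> \<noteq> {} \<longrightarrow> real (card \<Lambda>) powr (1 / m) > 21 / 20 \<longrightarrow>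
    measure (sphere_measure \<Lambda>) {a \<in> coeff_sphere \<Lambda>. bh_ratio m n \<Lambda> a > 1} \<le> C / (real m)\<^sup>2"
proof -
  have "2 / exp 1 < (1::real)"
  proof -
    have "(3 / 2)\<^sup>2 \<le> (exp (1 / 2 :: real))\<^sup>2"
      using exp_ge_add_one_self[of "1 / 2 :: real"] by (intro power_mono) auto
    also have "\<dots> = exp 1" by (simp add: power2_eq_square flip: exp_add)
    finally have "2 < exp (1::real)" by (simp add: power2_eq_square)
    then show ?thesis by simp
  qed
  then obtain K1 where K1: "K1 > 0" "\<And>n::nat. (1 + real n) ^ 3 * (2 / exp 1) ^ n \<le> K1"
    using power_geometric_bounded[of "2 / exp 1"] by auto
  obtain K2 where K2: "K2 > 0" "\<And>m::nat. m \<ge> 1 \<Longrightarrow> (20 / 21) ^ m \<le> K2 / (real m)\<^sup>2"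
    using geometric_le_inverse_square[of "20 / 21"] by auto
  obtain K3 where K3: "K3 > 0" "\<And>m::nat. m \<ge> 1 \<Longrightarrow> (1 / 2) ^ m \<le> K3 / (real m)\<^sup>2"
    using geometric_le_inverse_square[of "1 / 2"] by auto
  obtain K4 where K4: "K4 > 0" "\<And>m::nat. m \<ge> 1 \<Longrightarrow> (exp (- 1 / 4)) ^ m \<le> K4 / (real m)\<^sup>2"
    using geometric_le_inverse_square[of "exp (- 1 / 4)"] by auto
  define C where "C = K1 * K2 + 8 * (exp 144 * K2) + 8 * (23328 * K3 + K4)"
  show ?thesis
  proof (intro exI[of _ C] conjI allI impI)
    show "C > 0" unfolding C_def using K1 K2 K3 K4 by (intro add_pos_pos mult_pos_pos) auto
    fix m n \<Lambda> assume m: "m \<ge> (576::nat)" and Lam: "\<Lambda> \<subseteq> multi_indices m n" "\<Lambda> \<noteq> {}" and big: "real (card \<Lambda>) powr (1 / m) > 21 / 20"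
    define N where "N = real (card \<Lambda>)"
    define h where "h = N powr (1 / m)"
    have fin: "finite \<Lambda>" using Lam finite_multi_indices finite_subset by blast
    have N: "N \<ge> 1" using fin Lam by (simp add: N_def Suc_le_eq card_gt_0_iff)
    have h: "h > 21 / 20" using big by (simp add: h_def N_def)
    have hm: "N = h ^ m" using m N by (simp add: h_def powr_powr flip: powr_realpow)
    have invN: "1 / N \<le> K2 / (real m)\<^sup>2"
    proof -
      have "(21 / 20) ^ m \<le> N" unfolding hm using h by (intro power_mono) auto
      then have "1 / N \<le> 1 / (21 / 20) ^ m" using N by (intro divide_left_mono) auto
      also have "\<dots> = (20 / 21) ^ m" by (simp add: power_divide)
      also have "\<dots> \<le> K2 / (real m)\<^sup>2" using m by (intro K2) simp
      finally show ?thesis .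
    qed
    \<comment> \<open>For \<open>h < 4\<close> the factor \<open>exp (36 * h)\<close> is bounded,
      the sum is empty, and the first moment suffices. For larger \<open>h\<close> about
      \<open>h / 2\<close> moments are needed to beat it.\<close>
    define k0 where "k0 = (if h < 4 then 1 else nat \<lfloor>h / 2\<rfloor>)"
    have k0: "k0 \<ge> 1"
    proof (cases "h < 4")
      case False
      then have "nat 1 \<le> nat \<lfloor>h / 2\<rfloor>" by (intro nat_mono) linarith
      then show ?thesis using False by (simp add: k0_def)
    qed (simp add: k0_def)
    \<comment> \<open>\<open>B\<close> exceeds every sum of \<open>k0\<close> exponents of one
      variable, and \<open>Q\<close> below exceeds every sum of \<open>k0\<close>
      frequencies.\<close>
    define B where "B = m * k0 + 1"
    define Q where "Q = k0 * Max (digit_freq B n ` \<Lambda>) + 1"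
    have Q: "k0 * digit_freq B n \<alpha> < Q" if "\<alpha> \<in> \<Lambda>" for \<alpha>
    proof -
      have "digit_freq B n \<alpha> \<le> Max (digit_freq B n ` \<Lambda>)" using fin that by simp
      then have "k0 * digit_freq B n \<alpha> \<le> k0 * Max (digit_freq B n ` \<Lambda>)" by (rule mult_left_mono) simp
      then show ?thesis unfolding Q_def by linarith
    qed
    define Z where "Z = (\<Sum>k\<in>{1..<k0}. (36 * h) ^ (2 * k) / fact (2 * k) * (real k ^ m / N) ^ k) + exp (36 * h) * (real k0 ^ m / N) ^ k0"
    have "measure (sphere_measure \<Lambda>) {a \<in> coeff_sphere \<Lambda>. bh_ratio m n \<Lambda> a > 1} \<le>
        measure (gauss \<Lambda>) (peak_event Q \<Lambda> (digit_freq B n) h \<inter> space (gauss \<Lambda>))"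
      unfolding h_def N_def using Lam m by (intro sphere_measure_le_peak_event) auto
    also have "\<dots> \<le> (2 / exp 1) ^ card \<Lambda> + 8 * Z"
      unfolding Z_def N_def using Lam m k0 Q h by (intro peak_event_second_moment) (auto simp: B_def)
    also have "(2 / exp 1) ^ card \<Lambda> \<le> K1 * K2 / (real m)\<^sup>2"
    proof -
      have "N * (2 / exp 1) ^ card \<Lambda> \<le> (1 + N) ^ 3 * (2 / exp 1) ^ card \<Lambda>"
        using N self_le_power[of "1 + N" 3] by (intro mult_right_mono) auto
      also have "\<dots> \<le> K1" unfolding N_def by (rule K1(2))
      finally have "(2 / exp 1) ^ card \<Lambda> \<le> K1 * (1 / N)" using N by (simp add: pos_le_divide_eq mult.commute)
      also have "\<dots> \<le> K1 * (K2 / (real m)\<^sup>2)" using invN K1 by (intro mult_left_mono) auto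
      finally show ?thesis by simp
    qed
    also have "Z \<le> (exp 144 * K2 + (23328 * K3 + K4)) / (real m)\<^sup>2"
    proof (cases "h < 4")
      case True
      have "Z = exp (36 * h) * (1 / N)" using True by (simp add: Z_def k0_def)
      also have "\<dots> \<le> exp 144 * (K2 / (real m)\<^sup>2)" using True invN N by (intro mult_mono) auto
      also have "\<dots> \<le> (exp 144 * K2 + (23328 * K3 + K4)) / (real m)\<^sup>2"
        using K3 K4 by (simp add: divide_right_mono)
      finally show ?thesis .
    next
      case False
      have "Z \<le> 23328 * (1 / 2) ^ m + (exp (- 1 / 4)) ^ m"
        unfolding Z_def using m False hm by (intro correlation_sum_bound) (auto simp: k0_def)
      also have "\<dots> \<le> 23328 * (K3 / (real m)\<^sup>2) + K4 / (real m)\<^sup>2"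
        using m by (intro add_mono mult_left_mono K3 K4) auto
      also have "\<dots> = (23328 * K3 + K4) / (real m)\<^sup>2" by (simp add: add_divide_distrib)
      also have "\<dots> \<le> (exp 144 * K2 + (23328 * K3 + K4)) / (real m)\<^sup>2"
        using K2 by (intro divide_right_mono) auto
      finally show ?thesis .
    qed
    also have "K1 * K2 / (real m)\<^sup>2 + 8 * ((exp 144 * K2 + (23328 * K3 + K4)) / (real m)\<^sup>2) = C / (real m)\<^sup>2"
      unfolding C_def by (simp add: add_divide_distrib)
    finally show "measure (sphere_measure \<Lambda>) {a \<in> coeff_sphere \<Lambda>. bh_ratio m n \<Lambda> a > 1} \<le> C / (real m)\<^sup>2" by simp
  qed
qed

text \<open>With \<open>t = ln N / m\<close> one has \<open>t \<le> e \<le> 2 * t\<close>, so the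
  bound of \<open>peak_event_bound\<close> is at most a constant times ln m / m^2 times (ln N)^2 /
  N. The last factor is at most 4; this is where the decay in \<open>N\<close> is spent.\<close>

lemma few_monomials_bound:
  "\<exists>C>0. \<forall>m n \<Lambda>. m \<ge> 2 \<longrightarrow> \<Lambda> \<subseteq> multi_indices m n \<longrightarrow> \<Lambda> \<noteq> {} \<longrightarrow> real (card \<Lambda>) powr (1 / m) \<le> 21 / 20 \<longrightarrow>
    measure (sphere_measure \<Lambda>) {a \<in> coeff_sphere \<Lambda>. bh_ratio m n \<Lambda> a > 1} \<le> C * (ln (real m) / (real m)\<^sup>2)"
proof -
  obtain K where K: "K > 0" "\<And>(L :: (nat \<Rightarrow> nat) set) l Q e. finite L \<Longrightarrow> card L \<ge> 2 \<Longrightarrow> inj_on l L \<Longrightarrow> (\<forall>\<alpha>\<in>L. 2 * l \<alpha> < Q) \<Longrightarrow>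
    0 < e \<Longrightarrow> e \<le> 1 / 20 \<Longrightarrow>
    (\<integral>\<^sup>+x. indicator (peak_event Q L l (1 + e)) x \<partial>gauss L) \<le> ennreal (K * e\<^sup>2 * (1 + ln (1 / e)) / card L)"
    using peak_event_bound by blast
  show ?thesis
  proof (intro exI[of _ "64 * K"] conjI allI impI)
    show "64 * K > 0" using K by simp
    fix m n \<Lambda> assume m: "m \<ge> (2::nat)" and Lam: "\<Lambda> \<subseteq> multi_indices m n" "\<Lambda> \<noteq> {}" and small: "real (card \<Lambda>) powr (1 / m) \<le> 21 / 20"
    define N where "N = real (card \<Lambda>)"
    have fin: "finite \<Lambda>" using Lam finite_multi_indices finite_subset by blast
    have N1: "card \<Lambda> \<ge> 1" using fin Lam by (simp add: Suc_le_eq card_gt_0_iff)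
    have lnm: "ln (real m) \<ge> 1 / 2" using m by (rule ln_ge_half)
    show "measure (sphere_measure \<Lambda>) {a \<in> coeff_sphere \<Lambda>. bh_ratio m n \<Lambda> a > 1} \<le> 64 * K * (ln (real m) / (real m)\<^sup>2)"
    proof (cases "card \<Lambda> = 1")
      case True
      then have "{a \<in> coeff_sphere \<Lambda>. bh_ratio m n \<Lambda> a > 1} = {}"
        using bh_ratio_singleton[OF Lam(1) True] m by auto
      then have "measure (sphere_measure \<Lambda>) {a \<in> coeff_sphere \<Lambda>. bh_ratio m n \<Lambda> a > 1} = 0" by (simp only: measure_empty)
      then show ?thesis using K lnm by simp
    next
      case False
      then have N2: "card \<Lambda> \<ge> 2" "N \<ge> 2" using N1 by (auto simp: N_def)
      define h where "h = N powr (1 / m)"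
      define e where "e = h - 1"
      define t where "t = ln N / m"
      have ht: "h = exp t" using N2 by (simp add: h_def t_def powr_def)
      have lnN: "ln N \<ge> 1 / 2" using ln_ge_half[OF N2(1)] by (simp add: N_def)
      have t: "t \<ge> 1 / (2 * m)" using lnN m by (simp add: t_def field_simps)
      moreover have "1 / (2 * real m) > 0" using m by simp
      ultimately have t0: "t > 0" by linarith
      have et: "e \<ge> t" unfolding e_def ht using exp_ge_add_one_self[of t] by linarith
      have e: "0 < e" "e \<le> 1 / 20" using et t0 small by (auto simp: e_def h_def N_def)
      have e2: "e \<le> 2 * t"
      proof -
        have "t \<le> 1" using et e by linarith
        then have "exp t \<le> 1 + t + t\<^sup>2" using t0 by (intro exp_bound) auto
        moreover have "t\<^sup>2 \<le> t" using t0 \<open>t \<le> 1\<close> mult_left_mono[of t 1 t] by (simp add: power2_eq_square)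
        ultimately show ?thesis by (simp add: e_def ht)
      qed
      define Q where "Q = 2 * Max (digit_freq (m + 1) n ` \<Lambda>) + 1"
      have Q: "\<forall>\<alpha>\<in>\<Lambda>. 2 * digit_freq (m + 1) n \<alpha> < Q"
      proof
        fix \<alpha> assume "\<alpha> \<in> \<Lambda>"
        then have "digit_freq (m + 1) n \<alpha> \<le> Max (digit_freq (m + 1) n ` \<Lambda>)" using fin by simp
        then show "2 * digit_freq (m + 1) n \<alpha> < Q" by (simp add: Q_def)
      qed
      let ?A = "peak_event Q \<Lambda> (digit_freq (m + 1) n) (1 + e)"
      have inj: "inj_on (digit_freq (m + 1) n) \<Lambda>"
        using inj_on_digit_freq[of m "m + 1" n] Lam(1) by (auto intro: inj_on_subset)
      have "emeasure (gauss \<Lambda>) (?A \<inter> space (gauss \<Lambda>)) = (\<integral>\<^sup>+x. indicator (?A \<inter> space (gauss \<Lambda>)) x \<partial>gauss \<Lambda>)"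
        by (rule nn_integral_indicator[symmetric]) (rule sets_peak_event)
      also have "\<dots> \<le> (\<integral>\<^sup>+x. indicator ?A x \<partial>gauss \<Lambda>)" by (intro nn_integral_mono) (simp add: indicator_def)
      also have "\<dots> \<le> ennreal (K * e\<^sup>2 * (1 + ln (1 / e)) / card \<Lambda>)"
        using fin N2(1) inj Q e by (rule K(2))
      finally have em: "emeasure (gauss \<Lambda>) (?A \<inter> space (gauss \<Lambda>)) \<le> ennreal (K * e\<^sup>2 * (1 + ln (1 / e)) / N)"
        by (simp add: N_def)
      have ln1e: "0 \<le> ln (1 / e)" using e by (intro ln_ge_zero) simp
      have "measure (sphere_measure \<Lambda>) {a \<in> coeff_sphere \<Lambda>. bh_ratio m n \<Lambda> a > 1} \<le> measure (gauss \<Lambda>) (?A \<inter> space (gauss \<Lambda>))"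
        using sphere_measure_le_peak_event[OF Lam, of Q "m + 1"] m by (simp add: e_def h_def N_def)
      also have "\<dots> \<le> K * e\<^sup>2 * (1 + ln (1 / e)) / N"
        unfolding measure_def using em K ln1e N2 by (intro enn2real_leI) auto
      also have "\<dots> \<le> K * (4 * t\<^sup>2) * (4 * ln (real m)) / N"
      proof (intro divide_right_mono mult_mono mult_left_mono)
        have "e\<^sup>2 \<le> (2 * t)\<^sup>2" using e e2 by (intro power_mono) auto
        then show "e\<^sup>2 \<le> 4 * t\<^sup>2" by (simp add: power_mult_distrib)
        \<comment> \<open>Two monomials already make \<open>t\<close> at least
          \<open>1 / (2 * m)\<close>, so \<open>ln (1 / e)\<close> is at most of order
          \<open>ln m\<close>: the origin of the logarithm in the final bound.\<close>
        have "1 / e \<le> 1 / (1 / (2 * m))" using t et e m by (intro divide_left_mono mult_pos_pos) auto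
        then have "1 / e \<le> 2 * real m" by simp
        then have "ln (1 / e) \<le> ln (2 * real m)" using e m by (subst ln_le_cancel_iff) auto
        also have "\<dots> \<le> ln (real m * real m)" using m by (subst ln_le_cancel_iff) auto
        also have "\<dots> = 2 * ln (real m)" using m by (simp add: ln_mult)
        finally show "1 + ln (1 / e) \<le> 4 * ln (real m)" using lnm by linarith
      qed (use K N2 ln1e in auto)
      also have "\<dots> = 16 * K * ln (real m) / (real m)\<^sup>2 * ((ln N)\<^sup>2 / N)"
        using m by (simp add: t_def power_divide)
      also have "\<dots> \<le> 16 * K * ln (real m) / (real m)\<^sup>2 * 4"
      proof (intro mult_left_mono)
        have "ln (sqrt N) \<le> sqrt N" using ln_le_minus_one[of "sqrt N"] N2 by simp
        then have "ln N \<le> 2 * sqrt N" using N2 by (simp add: ln_sqrt)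
        then have "(ln N)\<^sup>2 \<le> (2 * sqrt N)\<^sup>2" using lnN by (intro power_mono) auto
        also have "\<dots> = 4 * N" using N2 by (simp add: power_mult_distrib)
        finally show "(ln N)\<^sup>2 / N \<le> 4" using N2 by (simp add: divide_le_eq)
      qed (use K lnm in auto)
      finally show ?thesis by simp
    qed
  qed
qed

text \<open>Degrees below 576 are covered by the trivial bound 1 through the size of the constant.
  Bounds without a logarithm are absorbed because \<open>ln m\<close> is at least 1/2.\<close>

lemma bh_ratio_tail_bound:
  "\<exists>C>0. \<forall>m n \<Lambda>. m \<ge> 2 \<longrightarrow> \<Lambda> \<noteq> {} \<longrightarrow> \<Lambda> \<subseteq> multi_indices m n \<longrightarrow>
    measure (sphere_measure \<Lambda>) {a \<in> coeff_sphere \<Lambda>. bh_ratio m n \<Lambda> a > 1} \<le> C * (ln (real m) / (real m)\<^sup>2)"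
proof -
  obtain C1 where C1: "C1 > 0" "\<And>m n \<Lambda>. m \<ge> 576 \<Longrightarrow> \<Lambda> \<subseteq> multi_indices m n \<Longrightarrow> \<Lambda> \<noteq> {} \<Longrightarrow> real (card \<Lambda>) powr (1 / m) > 21 / 20 \<Longrightarrow>
    measure (sphere_measure \<Lambda>) {a \<in> coeff_sphere \<Lambda>. bh_ratio m n \<Lambda> a > 1} \<le> C1 / (real m)\<^sup>2"
    using many_monomials_bound by blast
  obtain C2 where C2: "C2 > 0" "\<And>m n \<Lambda>. m \<ge> 2 \<Longrightarrow> \<Lambda> \<subseteq> multi_indices m n \<Longrightarrow> \<Lambda> \<noteq> {} \<Longrightarrow> real (card \<Lambda>) powr (1 / m) \<le> 21 / 20 \<Longrightarrow>
    measure (sphere_measure \<Lambda>) {a \<in> coeff_sphere \<Lambda>. bh_ratio m n \<Lambda> a > 1} \<le> C2 * (ln (real m) / (real m)\<^sup>2)"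
    using few_monomials_bound by blast
  define C where "C = 2 * C1 + C2 + 2 * 576\<^sup>2"
  have C: "C > 0" "2 * C1 \<le> C" "C2 \<le> C" "2 * 576\<^sup>2 \<le> C" using C1 C2 by (auto simp: C_def)
  have "measure (sphere_measure \<Lambda>) {a \<in> coeff_sphere \<Lambda>. bh_ratio m n \<Lambda> a > 1} \<le> C * (ln (real m) / (real m)\<^sup>2)"
    if m: "m \<ge> 2" and Lam: "\<Lambda> \<noteq> {}" "\<Lambda> \<subseteq> multi_indices m n" for m n \<Lambda>
  proof -
    have lnm: "ln (real m) \<ge> 1 / 2" using m by (rule ln_ge_half)
    have D: "D / (real m)\<^sup>2 \<le> C * (ln (real m) / (real m)\<^sup>2)" if "0 \<le> D" "2 * D \<le> C" for D
    proof -
      have "D \<le> C * (1 / 2)" using that by simp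
      also have "\<dots> \<le> C * ln (real m)" using lnm C(1) by (intro mult_left_mono) auto
      finally have "D / (real m)\<^sup>2 \<le> C * ln (real m) / (real m)\<^sup>2" by (intro divide_right_mono) auto
      then show ?thesis by simp
    qed
    show ?thesis
    proof (cases "real (card \<Lambda>) powr (1 / m) \<le> 21 / 20")
      case True
      have "measure (sphere_measure \<Lambda>) {a \<in> coeff_sphere \<Lambda>. bh_ratio m n \<Lambda> a > 1} \<le> C2 * (ln (real m) / (real m)\<^sup>2)"
        using m Lam True by (intro C2(2))
      also have "\<dots> \<le> C * (ln (real m) / (real m)\<^sup>2)" using C lnm by (intro mult_right_mono) auto
      finally show ?thesis .
    next
      case False
      show ?thesis
      proof (cases "m \<ge> 576")
        case True
        then have "measure (sphere_measure \<Lambda>) {a \<in> coeff_sphere \<Lambda>. bh_ratio m n \<Lambda> a > 1} \<le> C1 / (real m)\<^sup>2"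
          using Lam False by (intro C1(2)) auto
        also have "\<dots> \<le> C * (ln (real m) / (real m)\<^sup>2)" using C C1 by (intro D) auto
        finally show ?thesis .
      next
        case False
        have fin: "finite \<Lambda>" using Lam finite_multi_indices finite_subset by blast
        interpret P: prob_space "sphere_measure \<Lambda>" using fin Lam(1) by (rule prob_space_sphere_measure)
        have "P.prob {a \<in> coeff_sphere \<Lambda>. bh_ratio m n \<Lambda> a > 1} \<le> 1" by (rule P.prob_le_1)
        also have "1 \<le> 576\<^sup>2 / (real m)\<^sup>2" using False m power_mono[of "real m" 576 2] by (simp add: le_divide_eq)
        also have "\<dots> \<le> C * (ln (real m) / (real m)\<^sup>2)" using C by (intro D) auto
        finally show ?thesis .
      qed
    qed
  qed
  then show ?thesis using C(1) by blast
qed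

section \<open>Borel-Cantelli and the three claims\<close>

lemma summable_ln_div_square: "summable (\<lambda>m. ln (real m) / (real m)\<^sup>2)"
proof (rule summable_comparison_test_bigo)
  show "summable (\<lambda>m. norm (real m powr (- 3 / 2)))"
    using summable_real_powr_iff[of "- 3 / 2"] by simp
  show "(\<lambda>m. ln (real m) / (real m)\<^sup>2) \<in> O(\<lambda>m. real m powr (- 3 / 2))" by real_asymp
qed

lemma AE_eventually_bh_ratio_le_1:
  fixes n :: "nat \<Rightarrow> nat"
  assumes Lam: "\<And>m. m \<ge> 2 \<Longrightarrow> \<Lambda> m \<noteq> {} \<and> \<Lambda> m \<subseteq> multi_indices m (n m)"
  shows "measure (\<Pi>\<^sub>M m\<in>{2..}. sphere_measure (\<Lambda> m))
    {a \<in> \<Pi>\<^sub>E m\<in>{2..}. coeff_sphere (\<Lambda> m). \<forall>\<^sub>F m in sequentially. bh_ratio m (n m) (\<Lambda> m) (a m) \<le> 1} = 1"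
proof -
  \<comment> \<open>Every member of the family has to be a probability space, including those
    outside the index set, so a nonempty default support is supplied for \<open>m < 2\<close>. The
    product over \<open>{2..}\<close> is unchanged.\<close>
  define \<Lambda>' where "\<Lambda>' m = (if m \<ge> 2 then \<Lambda> m else {\<lambda>_. 0})" for m
  have fin: "finite (\<Lambda> m)" if "m \<ge> 2" for m
    using Lam[OF that] finite_multi_indices finite_subset by blast
  interpret product_prob_space "\<lambda>m. sphere_measure (\<Lambda>' m)" "{2..}"
    by (intro product_prob_spaceI prob_space_sphere_measure) (use fin Lam in \<open>auto simp: \<Lambda>'_def\<close>)
  let ?P = "\<Pi>\<^sub>M m\<in>{2..}. sphere_measure (\<Lambda>' m)"
  have P_eq: "(\<Pi>\<^sub>M m\<in>{2..}. sphere_measure (\<Lambda> m)) = ?P"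
    by (rule PiM_cong) (auto simp: \<Lambda>'_def)
  obtain C where C: "C > 0" "\<And>m n \<Lambda>. m \<ge> 2 \<Longrightarrow> \<Lambda> \<noteq> {} \<Longrightarrow> \<Lambda> \<subseteq> multi_indices m n \<Longrightarrow>
    measure (sphere_measure \<Lambda>) {a \<in> coeff_sphere \<Lambda>. bh_ratio m n \<Lambda> a > 1} \<le> C * (ln (real m) / (real m)\<^sup>2)"
    using bh_ratio_tail_bound by blast
  define S where "S m = {a \<in> space (sphere_measure (\<Lambda> m)). bh_ratio m (n m) (\<Lambda> m) a > 1}" for m
  define A where "A m = (if m \<ge> 2 then (\<lambda>a. a m) -` S m \<inter> space ?P else {})" for m
  have S: "S m \<in> sets (sphere_measure (\<Lambda> m))" if "m \<ge> 2" for m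
    unfolding S_def using borel_measurable_less[OF borel_measurable_const measurable_bh_ratio[OF fin[OF that]], of 1 m "n m"]
    by simp
  have comp: "(\<lambda>a. a m) \<in> ?P \<rightarrow>\<^sub>M sphere_measure (\<Lambda> m)" if "m \<ge> 2" for m
    using measurable_component_singleton[of m "{2..}" "\<lambda>m. sphere_measure (\<Lambda>' m)"] that by (simp add: \<Lambda>'_def)
  have A: "A m \<in> sets ?P" for m
    using measurable_sets[OF comp S] by (simp add: A_def)
  have PA: "prob (A m) \<le> C * (ln (real m) / (real m)\<^sup>2)" for m
  proof (cases "m \<ge> 2")
    case True
    have "sphere_measure (\<Lambda> m) = distr ?P (sphere_measure (\<Lambda> m)) (\<lambda>a. a m)"
      using PiM_component[of m] True by (simp add: \<Lambda>'_def)
    then have "measure (sphere_measure (\<Lambda> m)) (S m) = measure (distr ?P (sphere_measure (\<Lambda> m)) (\<lambda>a. a m)) (S m)"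
      by (rule arg_cong)
    also have "\<dots> = prob (A m)"
      using True by (simp add: A_def measure_distr[OF comp S])
    finally show ?thesis
      using C(2)[of m "\<Lambda> m" "n m"] Lam[OF True] True by (simp add: S_def space_sphere_measure)
  next
    case False
    then have "m = 0 \<or> m = 1" by linarith
    then show ?thesis using False by (auto simp: A_def)
  qed
  have summable: "summable (\<lambda>m. prob (A m))"
    using PA by (intro summable_comparison_test'[OF summable_mult[OF summable_ln_div_square, of C]]) auto
  have ae: "AE a in ?P. \<forall>\<^sub>F m in sequentially. a \<in> space ?P - A m"
    using summable
    by (intro borel_cantelli_AE1 A) (auto simp: emeasure_eq_measure)
  have ratio: "\<forall>\<^sub>F m in sequentially. bh_ratio m (n m) (\<Lambda> m) (a m) \<le> 1"
    if a: "a \<in> space ?P" and ev: "\<forall>\<^sub>F m in sequentially. a \<in> space ?P - A m" for a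
    using ev eventually_ge_at_top[of 2]
  proof eventually_elim
    case (elim m)
    have "a m \<in> space (sphere_measure (\<Lambda> m))" using measurable_space[OF comp a] elim by simp
    then show ?case using elim by (auto simp: A_def S_def not_less)
  qed
  have space: "space ?P = (\<Pi>\<^sub>E m\<in>{2..}. coeff_sphere (\<Lambda> m))"
    unfolding P_eq[symmetric] by (simp add: space_PiM space_sphere_measure)
  let ?E = "{a \<in> \<Pi>\<^sub>E m\<in>{2..}. coeff_sphere (\<Lambda> m). \<forall>\<^sub>F m in sequentially. bh_ratio m (n m) (\<Lambda> m) (a m) \<le> 1}"
  have "AE a in ?P. a \<in> ?E"
    using ae AE_space
  proof eventually_elim
    case (elim a)
    show ?case unfolding mem_Collect_eq space[symmetric] using elim(2) ratio[OF elim(2,1)] by (rule conjI)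
  qed
  moreover have "?E \<in> sets ?P"
    unfolding P_eq[symmetric] by (rule sets_eventually_bh_ratio_le) (rule fin)
  ultimately have "prob ?E = 1" by (simp only: prob_eq_1)
  then show ?thesis by (simp only: P_eq)
qed

theorem theoremA:
  shows
    "(\<exists>C::real. \<forall>m n :: nat. \<forall>\<Lambda>. m \<ge> 2 \<longrightarrow> n \<ge> 1 \<longrightarrow> \<Lambda> \<noteq> {} \<longrightarrow> \<Lambda> \<subseteq> multi_indices m n \<longrightarrow>
        measure (sphere_measure \<Lambda>) {a \<in> coeff_sphere \<Lambda>. bh_ratio m n \<Lambda> a > 1}
          \<le> C * (ln (real m) / (real m)\<^sup>2))
    \<and> (\<forall>(n :: nat \<Rightarrow> nat) (\<Lambda> :: nat \<Rightarrow> (nat \<Rightarrow> nat) set).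
        (\<forall>m\<ge>2. n m \<ge> 1 \<and> \<Lambda> m \<noteq> {} \<and> \<Lambda> m \<subseteq> multi_indices m (n m)) \<longrightarrow>
        measure (\<Pi>\<^sub>M m\<in>{2..}. sphere_measure (\<Lambda> m))
          {a \<in> \<Pi>\<^sub>E m\<in>{2..}. coeff_sphere (\<Lambda> m).
             \<forall>\<^sub>F m in sequentially. bh_ratio m (n m) (\<Lambda> m) (a m) \<le> 1} = 1)
    \<and> (\<forall>t::real. t < 1 \<longrightarrow> ( \<exists>(n :: nat \<Rightarrow> nat) (\<Lambda> :: nat \<Rightarrow> (nat \<Rightarrow> nat) set).
        (\<forall>m\<ge>2. n m \<ge> 1 \<and> \<Lambda> m \<noteq> {} \<and> \<Lambda> m \<subseteq> multi_indices m (n m)) \<and>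
        measure (\<Pi>\<^sub>M m\<in>{2..}. sphere_measure (\<Lambda> m))
          {a \<in> \<Pi>\<^sub>E m\<in>{2..}. coeff_sphere (\<Lambda> m).
             \<forall>\<^sub>F m in sequentially. bh_ratio m (n m) (\<Lambda> m) (a m) \<le> t} \<noteq> 1))"
proof (intro conjI allI impI)
  obtain C where C: "\<forall>m n \<Lambda>. m \<ge> 2 \<longrightarrow> \<Lambda> \<noteq> {} \<longrightarrow> \<Lambda> \<subseteq> multi_indices m n \<longrightarrow>
      measure (sphere_measure \<Lambda>) {a \<in> coeff_sphere \<Lambda>. bh_ratio m n \<Lambda> a > 1} \<le> C * (ln (real m) / (real m)\<^sup>2)"
    using bh_ratio_tail_bound by (elim exE conjE)
  show "\<exists>C::real. \<forall>m n :: nat. \<forall>\<Lambda>. m \<ge> 2 \<longrightarrow> n \<ge> 1 \<longrightarrow> \<Lambda> \<noteq> {} \<longrightarrow> \<Lambda> \<subseteq> multi_indices m n \<longrightarrow>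
      measure (sphere_measure \<Lambda>) {a \<in> coeff_sphere \<Lambda>. bh_ratio m n \<Lambda> a > 1} \<le> C * (ln (real m) / (real m)\<^sup>2)"
    using C by (intro exI[of _ C]) simp
next
  fix n :: "nat \<Rightarrow> nat" and \<Lambda> :: "nat \<Rightarrow> (nat \<Rightarrow> nat) set"
  assume "\<forall>m\<ge>2. n m \<ge> 1 \<and> \<Lambda> m \<noteq> {} \<and> \<Lambda> m \<subseteq> multi_indices m (n m)"
  then show "measure (\<Pi>\<^sub>M m\<in>{2..}. sphere_measure (\<Lambda> m))
      {a \<in> \<Pi>\<^sub>E m\<in>{2..}. coeff_sphere (\<Lambda> m).
         \<forall>\<^sub>F m in sequentially. bh_ratio m (n m) (\<Lambda> m) (a m) \<le> 1} = 1"
    by (intro AE_eventually_bh_ratio_le_1) blast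
next
  fix t :: real assume t: "t < 1"
  \<comment> \<open>The single monomial given by the \<open>m\<close>-th power of one variable: its
    ratio is 1 on the whole sphere, so for \<open>t < 1\<close> the event is empty and has measure
    0.\<close>
  define \<Lambda> :: "nat \<Rightarrow> (nat \<Rightarrow> nat) set" where "\<Lambda> m = {\<lambda>j\<in>{1..1}. m}" for m
  have Lam: "\<Lambda> m \<subseteq> multi_indices m 1" for m by (simp add: \<Lambda>_def multi_indices_def)
  have "\<not> (\<forall>\<^sub>F m in sequentially. bh_ratio m 1 (\<Lambda> m) (a m) \<le> t)"
    if a: "a \<in> (\<Pi>\<^sub>E m\<in>{2..}. coeff_sphere (\<Lambda> m))" for a
  proof
    assume "\<forall>\<^sub>F m in sequentially. bh_ratio m 1 (\<Lambda> m) (a m) \<le> t"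
    then have "\<forall>\<^sub>F m::nat in sequentially. False"
      using eventually_ge_at_top[of 2]
    proof eventually_elim
      case (elim m)
      have "a m \<in> coeff_sphere (\<Lambda> m)" using PiE_mem[OF a, of m] elim by simp
      then have "bh_ratio m 1 (\<Lambda> m) (a m) = 1"
        using elim by (intro bh_ratio_singleton[OF Lam]) (auto simp: \<Lambda>_def)
      then show ?case using elim t by simp
    qed
    then show False by simp
  qed
  then have "{a \<in> \<Pi>\<^sub>E m\<in>{2..}. coeff_sphere (\<Lambda> m). \<forall>\<^sub>F m in sequentially. bh_ratio m 1 (\<Lambda> m) (a m) \<le> t} = {}"
    by blast
  then have fails: "measure (\<Pi>\<^sub>M m\<in>{2..}. sphere_measure (\<Lambda> m))
      {a \<in> \<Pi>\<^sub>E m\<in>{2..}. coeff_sphere (\<Lambda> m). \<forall>\<^sub>F m in sequentially. bh_ratio m 1 (\<Lambda> m) (a m) \<le> t} \<noteq> 1"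
    by (simp only: measure_empty)
  show "\<exists>(n :: nat \<Rightarrow> nat) (\<Lambda> :: nat \<Rightarrow> (nat \<Rightarrow> nat) set).
      (\<forall>m\<ge>2. n m \<ge> 1 \<and> \<Lambda> m \<noteq> {} \<and> \<Lambda> m \<subseteq> multi_indices m (n m)) \<and>
      measure (\<Pi>\<^sub>M m\<in>{2..}. sphere_measure (\<Lambda> m))
        {a \<in> \<Pi>\<^sub>E m\<in>{2..}. coeff_sphere (\<Lambda> m).
           \<forall>\<^sub>F m in sequentially. bh_ratio m (n m) (\<Lambda> m) (a m) \<le> t} \<noteq> 1"
  proof (intro exI[of _ "\<lambda>_. 1"] exI[of _ \<Lambda>] conjI allI impI)
    show "\<Lambda> m \<subseteq> multi_indices m 1" for m by (rule Lam)
    show "\<Lambda> m \<noteq> {}" for m by (simp add: \<Lambda>_def)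
  qed (rule order_refl, rule fails)
qed

end
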